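(* Let $l\ge 1$, let $\Lambda$ be a graded self-injective algebra of Loewy length $l+1$ given by a stable bound quiver $Q=(Q,\rho)$ with Nakayama translation $\tau$, and let $\sigma$ be a graded automorphism of $\Lambda$. Let $\tilde Q$ be the quiver obtained from $Q$ by adding an arrow $\alpha_i:i\longrightarrow\tau i$ for each $i\in Q_0$. Then the relation set $\tilde\rho^{\sigma}$ of the twisted trivial extension $\tilde\Lambda^{\sigma}=\Lambda\ltimes D\Lambda^{\sigma}\simeq k\tilde Q/(\tilde\rho^\sigma)$ can be taken as $\tilde\rho^{\sigma}=\rho\cup\rho''$ with $$\rho''=\{\alpha_{\tau i}\alpha_i\mid i\in Q_0\}\cup\{\alpha_j\beta-\nu\sigma^{-1}(\beta)\alpha_i\mid \beta:i\longrightarrow j\in Q_1\}.$$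
   Context: $k$ is a field and $D=\mathrm{Hom}_k(-,k)$. A graded algebra is $\Gamma=\bigoplus_{t\ge0}\Gamma_t$, generated by $\Gamma_0$ and $\Gamma_1$, with $\Gamma_0=\bigoplus_{i=1}^n ke_i$, where $1=e_1+\cdots+e_n$ is a decomposition into orthogonal primitive idempotents. Paths are composed from right to left: a path from $i$ to $j$ lies in $e_j(kQ)e_i$. A bound quiver $Q=(Q_0,Q_1,\rho)$ is a quiver with a set $\rho$ of relations (linear combinations of paths of length $\ge2$); the algebra it gives is $k(Q)=kQ/(\rho)$. A bound path is a path with nonzero image in $k(Q)$. The bound quiver is homogeneous if in each element of $\rho$ all paths have the same length. A homogeneous bound quiver is stable of Loewy length $l+1$ ($l\ge1$) if: (i) a permutation $\tau$ of $Q_0$ is given (the Nakayama translation); (ii) all maximal bound paths have the same length $l$; (iii) for each vertex $i$ there is a maximal bound path from $\tau i$ to $i$ and there is no bound path of length $l$ from $\tau i$ to $j$ for any $j\ne i$; (iv) any two maximal bound paths starting at the same vertex are linearly dependent in $k(Q)$. A finite-dimensional graded algebra is graded self-injective of Loewy length $l+1$ if and only if it is given by a stable bound quiver of Loewy length $l+1$. The trivial extension $\Lambda\ltimes M$ of $\Lambda$ by a $\Lambda$-bimodule $M$ is $\Lambda\oplus M$ with multiplication $(a,x)(b,y)=(ab,ay+xb)$. A graded automorphism is an algebra automorphism preserving degrees of homogeneous elements. For a graded automorphism $\sigma$ and a $\Lambda$-bimodule $M$, the twist $M^\sigma$ is the vector space $M$ with the same left multiplication and with right multiplication $x\cdot b=x\sigma(b)$.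 Notation: for each vertex $i$ fix a maximal bound path $p_{l,i}$ from $\tau i$ to $i$ (a basis of the one-dimensional space $e_i\Lambda_l e_{\tau i}$), chosen as part of a basis of $\Lambda$ consisting of bound paths; $p_{l,i}^*\in D\Lambda$ is the corresponding dual basis element, and the new arrow $\alpha_i$ corresponds to $p_{l,i}^*$. Let $\eta_i: e_i\Lambda_le_{\tau i}\to k$ be the linear function with $z=\eta_i(z)p_{l,i}$. The map $\nu$ is the linear map on $\Lambda_1$ sending $\beta\in e_j\Lambda_1e_i$ to the element $\nu(\beta)\in e_{\tau j}\Lambda_1e_{\tau i}$ determined by $\eta_j(\beta q)=\eta_i(q\,\nu(\beta))$ for all $q\in e_i\Lambda_{l-1}e_{\tau j}$; it is the restriction to $\Lambda_1$ of the Nakayama automorphism of $\Lambda$.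
   Formalization: The graded automorphism σ is additionally required to fix every vertex idempotent e_i (otherwise the claim fails, e.g. the two-vertex cyclic quiver with l=1 and σ the swap), and DΛ^σ is read as D(Λ^σ), the dual of the twisted bimodule. *)

theory Defs
  imports "HOL-Algebra.QuotRing" "HOL-Algebra.Module" "Graph_Theory.Arc_Walk"
begin

section \<open>Algebras and bimodules over a field\<close>

text \<open>
  A quiver is a \<open>pre_digraph\<close>.  An algebra over a field \<open>'k\<close> is a \<open>('k, 'a) module\<close> record: a ring
  record together with a scalar multiplication by elements of \<open>'k\<close>.
\<close>

definition alg_iso :: "('k::field, 'a) module \<Rightarrow> ('k, 'b) module \<Rightarrow> ('a \<Rightarrow> 'b) set" where
  "alg_iso A B = {h \<in> ring_iso A B. \<forall>c. \<forall>x\<in>carrier A. h (c \<odot>\<^bsub>A\<^esub> x) = c \<odot>\<^bsub>B\<^esub> h x}"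

definition quot_alg :: "('k::field, 'a) module \<Rightarrow> 'a set \<Rightarrow> ('k, 'a set) module" where
  "quot_alg A I =
     ring.extend (A Quot I) (module.fields (\<lambda>c X. \<Union>x\<in>X. I +>\<^bsub>A\<^esub> (c \<odot>\<^bsub>A\<^esub> x)))"

definition finite_dim :: "('k::field, 'a) module \<Rightarrow> bool" where
  "finite_dim A \<longleftrightarrow>
     (\<exists>S. finite S \<and> S \<subseteq> carrier A \<and>
        (\<forall>x\<in>carrier A. \<exists>c. x = (\<Oplus>\<^bsub>A\<^esub>s\<in>S. c s \<odot>\<^bsub>A\<^esub> s)))"

definition lin_dependent :: "('k::field, 'a) module \<Rightarrow> 'a \<Rightarrow> 'a \<Rightarrow> bool" where
  "lin_dependent A x y \<longleftrightarrow>
     (\<exists>a b. (a \<noteq> 0 \<or> b \<noteq> 0) \<and> a \<odot>\<^bsub>A\<^esub> x \<oplus>\<^bsub>A\<^esub> b \<odot>\<^bsub>A\<^esub> y = \<zero>\<^bsub>A\<^esub>)"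

text \<open>
  The locale \<^locale>\<open>module\<close> requires commutative scalars, hence a separate notion for modules
  over a noncommutative ring.  Here the scalars of the record are the elements of the ring.
\<close>

definition left_module :: "('a, 'r) ring_scheme \<Rightarrow> ('a, 'm, 's) module_scheme \<Rightarrow> bool" where
  "left_module A M \<longleftrightarrow> ring A \<and> abelian_group M \<and>
     (\<forall>a\<in>carrier A. \<forall>x\<in>carrier M. a \<odot>\<^bsub>M\<^esub> x \<in> carrier M) \<and>
     (\<forall>a\<in>carrier A. \<forall>b\<in>carrier A. \<forall>x\<in>carrier M.
        (a \<oplus>\<^bsub>A\<^esub> b) \<odot>\<^bsub>M\<^esub> x = a \<odot>\<^bsub>M\<^esub> x \<oplus>\<^bsub>M\<^esub> b \<odot>\<^bsub>M\<^esub> x) \<and>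
     (\<forall>a\<in>carrier A. \<forall>x\<in>carrier M. \<forall>y\<in>carrier M.
        a \<odot>\<^bsub>M\<^esub> (x \<oplus>\<^bsub>M\<^esub> y) = a \<odot>\<^bsub>M\<^esub> x \<oplus>\<^bsub>M\<^esub> a \<odot>\<^bsub>M\<^esub> y) \<and>
     (\<forall>a\<in>carrier A. \<forall>b\<in>carrier A. \<forall>x\<in>carrier M.
        (a \<otimes>\<^bsub>A\<^esub> b) \<odot>\<^bsub>M\<^esub> x = a \<odot>\<^bsub>M\<^esub> (b \<odot>\<^bsub>M\<^esub> x)) \<and>
     (\<forall>x\<in>carrier M. \<one>\<^bsub>A\<^esub> \<odot>\<^bsub>M\<^esub> x = x)"

definition left_module_hom ::
  "('a, 'r) ring_scheme \<Rightarrow> ('a, 'm, 's) module_scheme \<Rightarrow> ('a, 'n, 't) module_scheme \<Rightarrow> ('m \<Rightarrow> 'n) set"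
  where
  "left_module_hom A M N = {h \<in> carrier M \<rightarrow> carrier N.
     (\<forall>x\<in>carrier M. \<forall>y\<in>carrier M. h (x \<oplus>\<^bsub>M\<^esub> y) = h x \<oplus>\<^bsub>N\<^esub> h y) \<and>
     (\<forall>a\<in>carrier A. \<forall>x\<in>carrier M. h (a \<odot>\<^bsub>M\<^esub> x) = a \<odot>\<^bsub>N\<^esub> h x)}"

definition regular_module :: "('a, 'r) ring_scheme \<Rightarrow> ('a, 'a) module" where
  "regular_module A =
     \<lparr>carrier = carrier A, mult = mult A, one = one A, zero = zero A, add = add A,
      smult = mult A\<rparr>"

text \<open>
  HOL cannot quantify over the modules of all types inside a definition; the test modules \<open>M\<close> and
  \<open>N\<close> have the element type of the algebra.  As this includes the inclusions of left ideals into
  the algebra, Baer's criterion shows that nothing is lost.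
\<close>

definition self_injective :: "('a, 'r) ring_scheme \<Rightarrow> bool" where
  "self_injective A \<longleftrightarrow>
     (\<forall>(M :: ('a, 'a) module) (N :: ('a, 'a) module) g f.
        left_module A M \<and> left_module A N \<and>
        g \<in> left_module_hom A M N \<and> inj_on g (carrier M) \<and>
        f \<in> left_module_hom A M (regular_module A) \<longrightarrow>
        (\<exists>h \<in> left_module_hom A N (regular_module A). \<forall>x\<in>carrier M. h (g x) = f x))"

text \<open>The inherited fields \<open>mult\<close> and \<open>one\<close> of a bimodule carry no meaning.\<close>

record ('k, 'm, 'a) bimodule = "('k, 'm) module" +
  lact :: "'a \<Rightarrow> 'm \<Rightarrow> 'm"
  ract :: "'m \<Rightarrow> 'a \<Rightarrow> 'm"

definition regular_bimodule :: "('k::field, 'a) module \<Rightarrow> ('k, 'a, 'a) bimodule" where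
  "regular_bimodule A = module.extend A (bimodule.fields (mult A) (mult A))"

definition twist :: "('k::field, 'm, 'a) bimodule \<Rightarrow> ('a \<Rightarrow> 'a) \<Rightarrow> ('k, 'm, 'a) bimodule" where
  "twist M \<sigma> = M\<lparr>ract := (\<lambda>x b. ract M x (\<sigma> b))\<rparr>"

text \<open>\<open>D = Hom\<^sub>k(-, k)\<close>, with \<open>(a f b)(x) = f(b x a)\<close>.\<close>

definition dual_bimodule :: "('k::field, 'm, 'a) bimodule \<Rightarrow> ('k, 'm \<Rightarrow> 'k, 'a) bimodule" where
  "dual_bimodule M =
     \<lparr>carrier = {f \<in> extensional (carrier M).
         (\<forall>x\<in>carrier M. \<forall>y\<in>carrier M. f (x \<oplus>\<^bsub>M\<^esub> y) = f x + f y) \<and>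
         (\<forall>c. \<forall>x\<in>carrier M. f (c \<odot>\<^bsub>M\<^esub> x) = c * f x)},
      mult = undefined, one = undefined,
      zero = (\<lambda>x\<in>carrier M. 0),
      add = (\<lambda>f g. \<lambda>x\<in>carrier M. f x + g x),
      smult = (\<lambda>c f. \<lambda>x\<in>carrier M. c * f x),
      lact = (\<lambda>a f. \<lambda>x\<in>carrier M. f (ract M x a)),
      ract = (\<lambda>f b. \<lambda>x\<in>carrier M. f (lact M b x))\<rparr>"

definition trivial_extension ::
  "('k::field, 'a) module \<Rightarrow> ('k, 'm, 'a) bimodule \<Rightarrow> ('k, 'a \<times> 'm) module" where
  "trivial_extension A M =
     \<lparr>carrier = carrier A \<times> carrier M,
      mult = (\<lambda>(a, x) (b, y). (a \<otimes>\<^bsub>A\<^esub> b, lact M a y \<oplus>\<^bsub>M\<^esub> ract M x b)),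
      one = (\<one>\<^bsub>A\<^esub>, \<zero>\<^bsub>M\<^esub>),
      zero = (\<zero>\<^bsub>A\<^esub>, \<zero>\<^bsub>M\<^esub>),
      add = (\<lambda>(a, x) (b, y). (a \<oplus>\<^bsub>A\<^esub> b, x \<oplus>\<^bsub>M\<^esub> y)),
      smult = (\<lambda>c (a, x). (c \<odot>\<^bsub>A\<^esub> a, c \<odot>\<^bsub>M\<^esub> x))\<rparr>"

text \<open>
  In \<open>\<Lambda> \<ltimes> D\<Lambda>\<^sup>\<sigma>\<close> the bimodule \<open>D\<Lambda>\<^sup>\<sigma>\<close> is read as \<open>D(\<Lambda>\<^sup>\<sigma>)\<close>, the dual of the twisted regular
  bimodule; via \<open>f \<mapsto> f \<circ> \<sigma>\<close> it is isomorphic to \<open>D\<Lambda>\<close> twisted by \<open>\<sigma>\<^sup>-\<^sup>1\<close>, so that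
  \<open>p\<^sup>* \<in> D\<Lambda>\<close> corresponds to \<open>p\<^sup>* \<circ> \<sigma>\<^sup>-\<^sup>1\<close> in \<open>D(\<Lambda>\<^sup>\<sigma>)\<close>.  With the reading
  \<open>(D\<Lambda>)\<^sup>\<sigma>\<close> the relations below would have to contain \<open>\<sigma>\<close> in place of \<open>\<sigma>\<^sup>-\<^sup>1\<close>: for
  \<open>\<Lambda> = k[x]/(x\<^sup>3)\<close> and \<open>\<sigma>(x) = q x\<close> the two algebras are isomorphic only if \<open>q\<^sup>2 = 1\<close>.
\<close>

definition twisted_trivial_extension ::
  "('k::field, 'a) module \<Rightarrow> ('a \<Rightarrow> 'a) \<Rightarrow> ('k, 'a \<times> ('a \<Rightarrow> 'k)) module" where
  "twisted_trivial_extension A \<sigma> =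
     trivial_extension A (dual_bimodule (twist (regular_bimodule A) \<sigma>))"


section \<open>Path algebras\<close>

text \<open>
  A path from \<open>u\<close> to \<open>v\<close> is a triple \<open>(u, es, v)\<close>, where \<open>es\<close> lists the arrows in the order in which
  they are traversed.  Paths are composed from right to left, so the product \<open>q p\<close> traverses \<open>p\<close>
  first.
\<close>

type_synonym ('v, 'e) qpath = "'v \<times> 'e list \<times> 'v"

definition paths :: "('v, 'e) pre_digraph \<Rightarrow> ('v, 'e) qpath set" where
  "paths Q = {(u, es, v). pre_digraph.awalk Q u es v}"

definition psrc :: "('v, 'e) qpath \<Rightarrow> 'v" where
  "psrc p = fst p"

definition ptgt :: "('v, 'e) qpath \<Rightarrow> 'v" where
  "ptgt p = snd (snd p)"

definition plen :: "('v, 'e) qpath \<Rightarrow> nat" where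
  "plen p = length (fst (snd p))"

definition pcomp :: "('v, 'e) qpath \<Rightarrow> ('v, 'e) qpath \<Rightarrow> ('v, 'e) qpath" where
  "pcomp q p = (psrc p, fst (snd p) @ fst (snd q), ptgt q)"

definition vertex_path :: "'v \<Rightarrow> ('v, 'e) qpath" where
  "vertex_path i = (i, [], i)"

definition arrow_path :: "('v, 'e) pre_digraph \<Rightarrow> 'e \<Rightarrow> ('v, 'e) qpath" where
  "arrow_path Q e = (tail Q e, [e], head Q e)"

definition path_alg :: "('v, 'e) pre_digraph \<Rightarrow> ('k::field, ('v, 'e) qpath \<Rightarrow> 'k) module" where
  "path_alg Q =
     \<lparr>carrier = {f. finite {p. f p \<noteq> 0} \<and> {p. f p \<noteq> 0} \<subseteq> paths Q},
      mult = (\<lambda>f g r. \<Sum>(q, p) \<in> {(q, p). q \<in> paths Q \<and> p \<in> paths Q \<and> ptgt p = psrc q \<and> pcomp q p = r}.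
                 f q * g p),
      one = (\<lambda>r. if r \<in> vertex_path ` verts Q then 1 else 0),
      zero = (\<lambda>r. 0),
      add = (\<lambda>f g r. f r + g r),
      smult = (\<lambda>c f r. c * f r)\<rparr>"

definition path_elt :: "('v, 'e) qpath \<Rightarrow> ('v, 'e) qpath \<Rightarrow> 'k::field" where
  "path_elt p = (\<lambda>r. if r = p then 1 else 0)"


section \<open>Bound quivers\<close>

definition bound_quiver ::
  "('v, 'e) pre_digraph \<Rightarrow> (('v, 'e) qpath \<Rightarrow> 'k::field) set \<Rightarrow> bool" where
  "bound_quiver Q \<rho> \<longleftrightarrow> fin_digraph Q \<and> \<rho> \<subseteq> carrier (path_alg Q) \<and>
     (\<forall>r\<in>\<rho>. \<forall>p. r p \<noteq> 0 \<longrightarrow> 2 \<le> plen p)"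

definition homogeneous_relations :: "(('v, 'e) qpath \<Rightarrow> 'k::field) set \<Rightarrow> bool" where
  "homogeneous_relations \<rho> \<longleftrightarrow> (\<forall>r\<in>\<rho>. \<forall>p q. r p \<noteq> 0 \<and> r q \<noteq> 0 \<longrightarrow> plen p = plen q)"

definition bound_alg ::
  "('v, 'e) pre_digraph \<Rightarrow> (('v, 'e) qpath \<Rightarrow> 'k::field) set \<Rightarrow> ('k, (('v, 'e) qpath \<Rightarrow> 'k) set) module"
  where
  "bound_alg Q \<rho> = quot_alg (path_alg Q) (Idl\<^bsub>path_alg Q\<^esub> \<rho>)"

definition path_class ::
  "('v, 'e) pre_digraph \<Rightarrow> (('v, 'e) qpath \<Rightarrow> 'k::field) set \<Rightarrow> ('v, 'e) qpath \<Rightarrow> (('v, 'e) qpath \<Rightarrow> 'k) set"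
  where
  "path_class Q \<rho> p = (Idl\<^bsub>path_alg Q\<^esub> \<rho>) +>\<^bsub>path_alg Q\<^esub> path_elt p"

definition bound_path ::
  "('v, 'e) pre_digraph \<Rightarrow> (('v, 'e) qpath \<Rightarrow> 'k::field) set \<Rightarrow> ('v, 'e) qpath \<Rightarrow> bool" where
  "bound_path Q \<rho> p \<longleftrightarrow> p \<in> paths Q \<and> path_class Q \<rho> p \<noteq> \<zero>\<^bsub>bound_alg Q \<rho>\<^esub>"

definition maximal_bound_path ::
  "('v, 'e) pre_digraph \<Rightarrow> (('v, 'e) qpath \<Rightarrow> 'k::field) set \<Rightarrow> ('v, 'e) qpath \<Rightarrow> bool" where
  "maximal_bound_path Q \<rho> p \<longleftrightarrow> bound_path Q \<rho> p \<and>
     (\<forall>q\<in>paths Q. \<forall>r\<in>paths Q. psrc q = ptgt p \<and> ptgt r = psrc p \<and>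
        bound_path Q \<rho> (pcomp q (pcomp p r)) \<longrightarrow> pcomp q (pcomp p r) = p)"

definition stable_bound_quiver ::
  "('v, 'e) pre_digraph \<Rightarrow> (('v, 'e) qpath \<Rightarrow> 'k::field) set \<Rightarrow> ('v \<Rightarrow> 'v) \<Rightarrow> nat \<Rightarrow> bool" where
  "stable_bound_quiver Q \<rho> \<tau> l \<longleftrightarrow>
     bound_quiver Q \<rho> \<and> homogeneous_relations \<rho> \<and>
     bij_betw \<tau> (verts Q) (verts Q) \<and>
     (\<forall>p. maximal_bound_path Q \<rho> p \<longrightarrow> plen p = l) \<and>
     (\<forall>i\<in>verts Q.
        (\<exists>p. maximal_bound_path Q \<rho> p \<and> psrc p = \<tau> i \<and> ptgt p = i) \<and>
        (\<forall>j\<in>verts Q. j \<noteq> i \<longrightarrow>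
           \<not> (\<exists>p. bound_path Q \<rho> p \<and> plen p = l \<and> psrc p = \<tau> i \<and> ptgt p = j))) \<and>
     (\<forall>p q. maximal_bound_path Q \<rho> p \<and> maximal_bound_path Q \<rho> q \<and> psrc p = psrc q \<longrightarrow>
        lin_dependent (bound_alg Q \<rho>) (path_class Q \<rho> p) (path_class Q \<rho> q))"

definition graded_part ::
  "('v, 'e) pre_digraph \<Rightarrow> (('v, 'e) qpath \<Rightarrow> 'k::field) set \<Rightarrow> nat \<Rightarrow> (('v, 'e) qpath \<Rightarrow> 'k) set set"
  where
  "graded_part Q \<rho> t =
     {(Idl\<^bsub>path_alg Q\<^esub> \<rho>) +>\<^bsub>path_alg Q\<^esub> f | f.
        f \<in> carrier (path_alg Q) \<and> (\<forall>p. f p \<noteq> 0 \<longrightarrow> plen p = t)}"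

text \<open>
  The algebra is generated in degrees \<open>0\<close> and \<open>1\<close> over the semisimple \<open>\<Lambda>\<^sub>0\<close>; for such a
  finite-dimensional algebra the \<open>t\<close>-th power of the radical is the sum of the parts of degree at
  least \<open>t\<close>, so Loewy length \<open>l + 1\<close> means that the nonzero degrees are exactly \<open>0, \<dots>, l\<close>.
\<close>

definition graded_self_injective ::
  "('v, 'e) pre_digraph \<Rightarrow> (('v, 'e) qpath \<Rightarrow> 'k::field) set \<Rightarrow> nat \<Rightarrow> bool" where
  "graded_self_injective Q \<rho> l \<longleftrightarrow>
     finite_dim (bound_alg Q \<rho>) \<and> self_injective (bound_alg Q \<rho>) \<and>
     (\<forall>t. graded_part Q \<rho> t \<noteq> {\<zero>\<^bsub>bound_alg Q \<rho>\<^esub>} \<longleftrightarrow> t \<le> l)"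

definition graded_automorphism ::
  "('v, 'e) pre_digraph \<Rightarrow> (('v, 'e) qpath \<Rightarrow> 'k::field) set \<Rightarrow>
     ((('v, 'e) qpath \<Rightarrow> 'k) set \<Rightarrow> (('v, 'e) qpath \<Rightarrow> 'k) set) \<Rightarrow> bool" where
  "graded_automorphism Q \<rho> \<sigma> \<longleftrightarrow>
     \<sigma> \<in> alg_iso (bound_alg Q \<rho>) (bound_alg Q \<rho>) \<and>
     (\<forall>t. \<sigma> ` graded_part Q \<rho> t \<subseteq> graded_part Q \<rho> t)"

text \<open>
  Degree preservation allows \<open>\<sigma>\<close> to permute the idempotents \<open>e\<^sub>i\<close>.  That \<open>\<sigma>\<close> fixes them has to be
  required separately wherever the new arrows are to run from \<open>i\<close> to \<open>\<tau> i\<close>.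
\<close>

text \<open>
  A linear combination \<open>f\<close> of the paths in \<open>B\<close> represents its coset in the quotient, so the images
  of the paths in \<open>B\<close> form a basis iff every coset contains exactly one \<open>f\<close> supported in \<open>B\<close>.
\<close>

definition bound_path_basis ::
  "('v, 'e) pre_digraph \<Rightarrow> (('v, 'e) qpath \<Rightarrow> 'k::field) set \<Rightarrow> ('v, 'e) qpath set \<Rightarrow> bool" where
  "bound_path_basis Q \<rho> B \<longleftrightarrow> (\<forall>p\<in>B. bound_path Q \<rho> p) \<and>
     (\<forall>x\<in>carrier (bound_alg Q \<rho>). \<exists>!f. f \<in> x \<and> (\<forall>p. f p \<noteq> 0 \<longrightarrow> p \<in> B))"

definition dual_basis_elt ::
  "('v, 'e) pre_digraph \<Rightarrow> (('v, 'e) qpath \<Rightarrow> 'k::field) set \<Rightarrow> ('v, 'e) qpath set \<Rightarrow>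
     ('v, 'e) qpath \<Rightarrow> (('v, 'e) qpath \<Rightarrow> 'k) set \<Rightarrow> 'k" where
  "dual_basis_elt Q \<rho> B b =
     (\<lambda>x\<in>carrier (bound_alg Q \<rho>). (THE f. f \<in> x \<and> (\<forall>p. f p \<noteq> 0 \<longrightarrow> p \<in> B)) b)"


section \<open>The Nakayama automorphism in degree one\<close>

text \<open>\<open>peirce Q \<rho> j t i\<close> is \<open>e\<^sub>j \<Lambda>\<^sub>t e\<^sub>i\<close>.\<close>

definition peirce_map ::
  "('v, 'e) pre_digraph \<Rightarrow> (('v, 'e) qpath \<Rightarrow> 'k::field) set \<Rightarrow> 'v \<Rightarrow> 'v \<Rightarrow>
     (('v, 'e) qpath \<Rightarrow> 'k) set \<Rightarrow> (('v, 'e) qpath \<Rightarrow> 'k) set" where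
  "peirce_map Q \<rho> j i x =
     path_class Q \<rho> (vertex_path j) \<otimes>\<^bsub>bound_alg Q \<rho>\<^esub> x
       \<otimes>\<^bsub>bound_alg Q \<rho>\<^esub> path_class Q \<rho> (vertex_path i)"

definition peirce ::
  "('v, 'e) pre_digraph \<Rightarrow> (('v, 'e) qpath \<Rightarrow> 'k::field) set \<Rightarrow> 'v \<Rightarrow> nat \<Rightarrow> 'v \<Rightarrow>
     (('v, 'e) qpath \<Rightarrow> 'k) set set" where
  "peirce Q \<rho> j t i = peirce_map Q \<rho> j i ` graded_part Q \<rho> t"

text \<open>
  In the following, \<open>pm i\<close> is the chosen maximal bound path from \<open>\<tau> i\<close> to \<open>i\<close>.
\<close>

definition eta ::
  "('v, 'e) pre_digraph \<Rightarrow> (('v, 'e) qpath \<Rightarrow> 'k::field) set \<Rightarrow> ('v \<Rightarrow> ('v, 'e) qpath) \<Rightarrow> 'v \<Rightarrow>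
     (('v, 'e) qpath \<Rightarrow> 'k) set \<Rightarrow> 'k" where
  "eta Q \<rho> pm i z = (THE c. z = c \<odot>\<^bsub>bound_alg Q \<rho>\<^esub> path_class Q \<rho> (pm i))"

definition nu_component ::
  "('v, 'e) pre_digraph \<Rightarrow> (('v, 'e) qpath \<Rightarrow> 'k::field) set \<Rightarrow> ('v \<Rightarrow> 'v) \<Rightarrow> nat \<Rightarrow>
     ('v \<Rightarrow> ('v, 'e) qpath) \<Rightarrow> 'v \<Rightarrow> 'v \<Rightarrow> (('v, 'e) qpath \<Rightarrow> 'k) set \<Rightarrow> (('v, 'e) qpath \<Rightarrow> 'k) set"
  where
  "nu_component Q \<rho> \<tau> l pm j i x =
     (THE y. y \<in> peirce Q \<rho> (\<tau> j) 1 (\<tau> i) \<and>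
        (\<forall>q\<in>peirce Q \<rho> i (l - 1) (\<tau> j).
           eta Q \<rho> pm j (x \<otimes>\<^bsub>bound_alg Q \<rho>\<^esub> q) = eta Q \<rho> pm i (q \<otimes>\<^bsub>bound_alg Q \<rho>\<^esub> y)))"

definition nu ::
  "('v, 'e) pre_digraph \<Rightarrow> (('v, 'e) qpath \<Rightarrow> 'k::field) set \<Rightarrow> ('v \<Rightarrow> 'v) \<Rightarrow> nat \<Rightarrow>
     ('v \<Rightarrow> ('v, 'e) qpath) \<Rightarrow> (('v, 'e) qpath \<Rightarrow> 'k) set \<Rightarrow> (('v, 'e) qpath \<Rightarrow> 'k) set" where
  "nu Q \<rho> \<tau> l pm x =
     (\<Oplus>\<^bsub>bound_alg Q \<rho>\<^esub>j \<in> verts Q. \<Oplus>\<^bsub>bound_alg Q \<rho>\<^esub>i \<in> verts Q.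
        nu_component Q \<rho> \<tau> l pm j i (peirce_map Q \<rho> j i x))"


section \<open>The extended quiver and its relations\<close>

text \<open>\<open>Inl \<beta>\<close> is the old arrow \<open>\<beta>\<close> and \<open>Inr i\<close> is the new arrow \<open>\<alpha>\<^sub>i\<close>.\<close>

definition ext_quiver :: "('v, 'e) pre_digraph \<Rightarrow> ('v \<Rightarrow> 'v) \<Rightarrow> ('v, 'e + 'v) pre_digraph" where
  "ext_quiver Q \<tau> =
     \<lparr>verts = verts Q, arcs = Inl ` arcs Q \<union> Inr ` verts Q,
      tail = case_sum (tail Q) (\<lambda>i. i), head = case_sum (head Q) \<tau>\<rparr>"

text \<open>The inclusion of \<open>kQ\<close> into the path algebra of the extended quiver.\<close>

definition embed ::
  "(('v, 'e) qpath \<Rightarrow> 'k::field) \<Rightarrow> ('v, 'e + 'v) qpath \<Rightarrow> 'k" where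
  "embed f = (\<lambda>(u, es, v). if set es \<subseteq> range Inl then f (u, map projl es, v) else 0)"

text \<open>
  Relations have length at least two, so \<open>\<Lambda>\<^sub>1\<close> is identified with the span of the arrows in \<open>kQ\<close>.
\<close>

definition arrow_rep ::
  "(('v, 'e) qpath \<Rightarrow> 'k::field) set \<Rightarrow> ('v, 'e) qpath \<Rightarrow> 'k" where
  "arrow_rep x = (THE f. f \<in> x \<and> (\<forall>p. f p \<noteq> 0 \<longrightarrow> plen p = 1))"

definition ext_relations ::
  "('v, 'e) pre_digraph \<Rightarrow> (('v, 'e) qpath \<Rightarrow> 'k::field) set \<Rightarrow> ('v \<Rightarrow> 'v) \<Rightarrow> nat \<Rightarrow>
     ('v \<Rightarrow> ('v, 'e) qpath) \<Rightarrow> ((('v, 'e) qpath \<Rightarrow> 'k) set \<Rightarrow> (('v, 'e) qpath \<Rightarrow> 'k) set) \<Rightarrow>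
     (('v, 'e + 'v) qpath \<Rightarrow> 'k) set" where
  "ext_relations Q \<rho> \<tau> l pm \<sigma> =
     (let R = path_alg (ext_quiver Q \<tau>);
          \<alpha> = (\<lambda>i. path_elt (arrow_path (ext_quiver Q \<tau>) (Inr i)));
          \<sigma>' = inv_into (carrier (bound_alg Q \<rho>)) \<sigma>
      in embed ` \<rho> \<union>
         {\<alpha> (\<tau> i) \<otimes>\<^bsub>R\<^esub> \<alpha> i | i. i \<in> verts Q} \<union>
         {\<alpha> (head Q \<beta>) \<otimes>\<^bsub>R\<^esub> path_elt (arrow_path (ext_quiver Q \<tau>) (Inl \<beta>))
            \<ominus>\<^bsub>R\<^esub> embed (arrow_rep (nu Q \<rho> \<tau> l pm (\<sigma>' (path_class Q \<rho> (arrow_path Q \<beta>)))))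
                  \<otimes>\<^bsub>R\<^esub> \<alpha> (tail Q \<beta>) | \<beta>. \<beta> \<in> arcs Q})"

end

theory Submission
  imports Defs
begin

text \<open>
  Write \<open>\<alpha> = \<Sum>\<^sub>i \<alpha>\<^sub>i\<close> and \<open>\<phi> = \<Sum>\<^sub>i p\<^sub>i\<^sup>*\<close>.  Self-injectivity makes the form
  \<open>(x, y) \<mapsto> \<phi>(x y)\<close> on \<open>\<Lambda>\<close> nondegenerate on both sides, so every linear function on \<open>\<Lambda>\<close> is
  \<open>\<phi>(_ y)\<close> for some \<open>y\<close>, unique in \<open>\<Lambda>\<close>; in degree one this gives \<open>\<nu>\<close> with \<open>\<phi>(b z) = \<phi>(z \<nu>(b))\<close>.
  The arrows determine a homomorphism \<open>\<Psi>\<close> from the extended path algebra to the trivial extension,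
  which kills the relations because \<open>\<sigma>\<^sup>-\<^sup>1\<close> turns them into the equation for \<open>\<nu>\<close>.
  Modulo the relations \<open>\<alpha>\<close> commutes past \<open>kQ\<close> and \<open>\<alpha>\<^sup>2 = 0\<close>, so every element has the form
  \<open>u + v \<alpha>\<close> with \<open>u, v \<in> kQ\<close>, and \<open>\<Psi>(u + v \<alpha>) = (u, \<sigma>(x) \<mapsto> \<phi>(x v))\<close>.  Nondegeneracy shows that
  \<open>\<Psi>(u + v \<alpha>) = 0\<close> forces \<open>u = v = 0\<close> in \<open>\<Lambda>\<close>, and representability of linear functions shows that
  \<open>\<Psi>\<close> is surjective.
\<close>

section \<open>Algebras over a field\<close>

text \<open>The dual of the twisted bimodule has the actions
  \<open>(a f)(x) = f(x \<sigma>(a))\<close> and \<open>(f b)(x) = f(b x)\<close>, and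
  \<open>\<alpha>\<^sub>i\<close> goes to \<open>f\<^sub>i = p\<^sub>i\<^sup>* \<circ>
  \<sigma>\<^sup>-\<^sup>1\<close>. For an arrow \<open>\<beta> = \<sigma>(b)\<close> from
  \<open>i\<close> to \<open>j\<close> and \<open>x = \<sigma>(z)\<close> this gives
  \<open>(f\<^sub>j \<beta>)(x) = p\<^sub>j\<^sup>*(b z) = p\<^sub>i\<^sup>*(z \<nu>(b)) = (\<nu>(b)
  f\<^sub>i)(x)\<close>, the origin of \<open>\<nu> \<sigma>\<^sup>-\<^sup>1\<close> in the
  relations. The obstacle is nondegeneracy. Stability speaks about paths and the top degree; that an
  arbitrary nonzero element can be multiplied into the top degree has to be extracted from
  injectivity. As this is a condition on left modules, the two sides need different arguments. Both
  are used: left nondegeneracy represents linear functions, right nondegeneracy makes the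
  representing element unique. Elements of \<open>\<Lambda>\<close> are carried by representatives
  in \<open>kQ\<close>, where taking a homogeneous component is restricting the support. Dimensions
  are never compared, and \<open>\<nu>\<close> is not extended beyond degree one.\<close>

locale k_algebra = ring A for A :: "('k::field, 'a) module" (structure) +
  assumes smult_closed [simp]: "x \<in> carrier A \<Longrightarrow> c \<odot> x \<in> carrier A"
    and smult_l_distr: "x \<in> carrier A \<Longrightarrow> (b + c) \<odot> x = b \<odot> x \<oplus> c \<odot> x"
    and smult_r_distr: "x \<in> carrier A \<Longrightarrow> y \<in> carrier A \<Longrightarrow> c \<odot> (x \<oplus> y) = c \<odot> x \<oplus> c \<odot> y"
    and smult_assoc: "x \<in> carrier A \<Longrightarrow> (b * c) \<odot> x = b \<odot> (c \<odot> x)"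
    and smult_one [simp]: "x \<in> carrier A \<Longrightarrow> 1 \<odot> x = x"
    and smult_mult_l: "x \<in> carrier A \<Longrightarrow> y \<in> carrier A \<Longrightarrow> (c \<odot> x) \<otimes> y = c \<odot> (x \<otimes> y)"
    and smult_mult_r: "x \<in> carrier A \<Longrightarrow> y \<in> carrier A \<Longrightarrow> x \<otimes> (c \<odot> y) = c \<odot> (x \<otimes> y)"
begin

lemma smult_zero_l [simp]: "x \<in> carrier A \<Longrightarrow> 0 \<odot> x = \<zero>"
  using smult_l_distr[of x 0 0] by (simp add: add.r_cancel_one')

lemma smult_zero_r [simp]: "c \<odot> \<zero> = \<zero>"
  using smult_r_distr[of \<zero> \<zero> c] by (simp add: add.r_cancel_one')

lemma smult_minus_one: "x \<in> carrier A \<Longrightarrow> (- 1) \<odot> x = \<ominus> x"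
  using smult_l_distr[of x "- 1" 1] by (simp add: minus_equality)

lemma smult_finsum:
  assumes "finite F" "f \<in> F \<rightarrow> carrier A"
  shows "c \<odot> finsum A f F = (\<Oplus>i\<in>F. c \<odot> f i)"
  using assms by (induction F) (auto simp: smult_r_distr Pi_iff)

lemma smult_cancel:
  assumes "b \<odot> x = c \<odot> x" "x \<in> carrier A" "x \<noteq> \<zero>"
  shows "b = c"
proof (rule ccontr)
  assume "b \<noteq> c"
  have "(b - c) \<odot> x = b \<odot> x \<oplus> (- 1) \<odot> (c \<odot> x)"
    using assms(2) smult_l_distr[of x b "- c"] by (simp flip: smult_assoc)
  also have "\<dots> = \<zero>" using assms by (simp add: smult_minus_one r_neg)
  finally have "(1 / (b - c)) \<odot> ((b - c) \<odot> x) = \<zero>" by simp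
  then show False using assms \<open>b \<noteq> c\<close> by (simp flip: smult_assoc)
qed

text \<open>Scalars act as ring elements,
  \<open>c \<odot> x = (c \<odot> \<one>) \<otimes> x\<close>, so dividing by a ring ideal is
  dividing by a subspace.\<close>

lemma ideal_smult:
  assumes "ideal J A" "x \<in> J"
  shows "c \<odot> x \<in> J"
proof -
  interpret ideal J A by fact
  have "(c \<odot> \<one>) \<otimes> x \<in> J" using assms(2) by (intro I_l_closed) auto
  then show ?thesis using assms(2) by (simp add: smult_mult_l a_Hcarr)
qed

text \<open>Closure under negation comes from absorption, as multiplication by
  \<open>\<ominus> \<one>\<close>.\<close>

lemma idealI_smult:
  assumes "J \<subseteq> carrier A" "\<zero> \<in> J"
    and "\<And>x y. x \<in> J \<Longrightarrow> y \<in> J \<Longrightarrow> x \<oplus> y \<in> J"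
    and "\<And>x y. x \<in> carrier A \<Longrightarrow> y \<in> J \<Longrightarrow> x \<otimes> y \<in> J"
    and "\<And>x y. x \<in> carrier A \<Longrightarrow> y \<in> J \<Longrightarrow> y \<otimes> x \<in> J"
  shows "ideal J A"
proof (rule idealI)
  show "ring A" by (rule ring_axioms)
  show "subgroup J (add_monoid A)"
  proof (rule add.subgroupI)
    show "\<ominus> a \<in> J" if "a \<in> J" for a
    proof -
      have "(\<ominus> \<one>) \<otimes> a \<in> J" by (rule assms(4)) (use that in auto)
      moreover have "a \<in> carrier A" using that assms(1) by auto
      ultimately show ?thesis by (simp add: l_minus)
    qed
    show "J \<subseteq> carrier A" "J \<noteq> {}" using assms(1,2) by auto
    show "\<And>x y. x \<in> J \<Longrightarrow> y \<in> J \<Longrightarrow> x \<oplus> y \<in> J"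
      by (rule assms(3))
  qed
  show "x \<otimes> a \<in> J" "a \<otimes> x \<in> J" if "a \<in> J" "x \<in> carrier A" for a x
    using assms(4,5) that by auto
qed

end

definition alg_hom :: "('k::field, 'a) module \<Rightarrow> ('k, 'b) module \<Rightarrow> ('a \<Rightarrow> 'b) set" where
  "alg_hom A B = {h \<in> ring_hom A B. \<forall>c. \<forall>x\<in>carrier A. h (c \<odot>\<^bsub>A\<^esub> x) = c \<odot>\<^bsub>B\<^esub> h x}"

lemma quot_alg_simps:
  "carrier (quot_alg A J) = a_rcosets\<^bsub>A\<^esub> J"
  "mult (quot_alg A J) = rcoset_mult A J"
  "one (quot_alg A J) = J +>\<^bsub>A\<^esub> \<one>\<^bsub>A\<^esub>"
  "zero (quot_alg A J) = J"
  "add (quot_alg A J) = set_add A"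
  "smult (quot_alg A J) = (\<lambda>c X. \<Union>x\<in>X. J +>\<^bsub>A\<^esub> (c \<odot>\<^bsub>A\<^esub> x))"
  by (simp_all add: quot_alg_def ring.defs module.defs FactRing_def)

context k_algebra
begin

context
  fixes J assumes J: "ideal J A"
begin

lemma quot_alg_carrier: "carrier (quot_alg A J) = (\<lambda>x. J +> x) ` carrier A"
  by (auto simp: quot_alg_simps A_RCOSETS_def')

lemma quot_alg_ring: "ring (quot_alg A J)"
proof -
  interpret ideal J A by (rule J)
  interpret q: ring "A Quot J" by (rule quotient_is_ring)
  have [simp]: "carrier (quot_alg A J) = carrier (A Quot J)" "add (quot_alg A J) = add (A Quot J)"
    "mult (quot_alg A J) = mult (A Quot J)" "one (quot_alg A J) = one (A Quot J)"
    "zero (quot_alg A J) = zero (A Quot J)"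
    by (simp_all add: quot_alg_simps FactRing_def)
  have "\<exists>y\<in>carrier (A Quot J). y \<oplus>\<^bsub>A Quot J\<^esub> x = \<zero>\<^bsub>A Quot J\<^esub>" if "x \<in> carrier (A Quot J)" for x
    using q.l_neg[OF that] q.a_inv_closed[OF that] by blast
  then show ?thesis
    by (intro ringI abelian_groupI monoidI) (simp_all add: q.m_assoc q.a_ac q.l_distr q.r_distr)
qed

text \<open>Scalar multiplication in \<open>quot_alg\<close> is a union over all representatives.
  Since \<open>J\<close> absorbs scalars, every term of the union is the same coset, and the union
  collapses to it.\<close>

lemma quot_alg_proj_smult:
  assumes "x \<in> carrier A"
  shows "c \<odot>\<^bsub>quot_alg A J\<^esub> (J +> x) = J +> (c \<odot> x)"
proof -
  interpret ideal J A by (rule J)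
  have "J +> (c \<odot> y) = J +> (c \<odot> x)" if y: "y \<in> J +> x" for y
  proof -
    obtain j where j: "j \<in> J" "y = j \<oplus> x" using y by (auto simp: a_r_coset_def')
    then have "c \<odot> y = c \<odot> j \<oplus> c \<odot> x" using assms by (simp add: smult_r_distr a_Hcarr)
    moreover have "c \<odot> j \<in> J" using ideal_smult[OF J j(1)] .
    ultimately have "c \<odot> y \<in> J +> (c \<odot> x)" 
      using a_rcosI[OF _ a_subset, of "c \<odot> j" "c \<odot> x"] assms by simp
    then show ?thesis using a_repr_independence' assms smult_closed by metis
  qed
  then have "(\<Union>y\<in>J +> x. J +> (c \<odot> y)) = (\<Union>y\<in>J +> x. J +> (c \<odot> x))"
    by (intro SUP_cong) simp_all
  moreover have "J +> x \<noteq> {}" using a_rcos_self[OF assms] by auto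
  ultimately show ?thesis by (simp add: quot_alg_simps)
qed

lemma quot_alg_proj_hom: "(\<lambda>x. J +> x) \<in> ring_hom A (quot_alg A J)"
proof -
  interpret ideal J A by (rule J)
  show ?thesis
    using rcos_ring_hom unfolding ring_hom_def quot_alg_def
    by (simp add: ring.defs module.defs)
qed

lemma quot_alg_proj:
  "(\<lambda>x. J +> x) \<in> alg_hom A (quot_alg A J)"
  using quot_alg_proj_hom quot_alg_proj_smult by (simp add: alg_hom_def)

lemma quot_alg_k_algebra: "k_algebra (quot_alg A J)"
proof -
  interpret q: ring "quot_alg A J" by (rule quot_alg_ring)
  note [simp] = quot_alg_proj_smult
  have add: "(J +> x) \<oplus>\<^bsub>quot_alg A J\<^esub> (J +> y) = J +> (x \<oplus> y)"
    if "x \<in> carrier A" "y \<in> carrier A" for x y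
    using ring_hom_add[OF quot_alg_proj_hom] that by simp
  have mult: "(J +> x) \<otimes>\<^bsub>quot_alg A J\<^esub> (J +> y) = J +> (x \<otimes> y)"
    if "x \<in> carrier A" "y \<in> carrier A" for x y
    using ring_hom_mult[OF quot_alg_proj_hom] that by simp
  have cases: "\<exists>x\<in>carrier A. X = J +> x" if "X \<in> carrier (quot_alg A J)" for X
    using that by (simp add: quot_alg_carrier image_iff)
  have closed: "J +> x \<in> carrier (quot_alg A J)" if "x \<in> carrier A" for x
    using that by (simp add: quot_alg_carrier)
  show ?thesis
  proof (unfold_locales, goal_cases)
    case (1 X c)
    then show ?case using cases[of X] by (metis closed quot_alg_proj_smult smult_closed)
  next
    case (2 X b c)
    then show ?case using cases[of X] by (metis add quot_alg_proj_smult smult_closed smult_l_distr)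
  next
    case (3 X Y c)
    then obtain x y where "x \<in> carrier A" "y \<in> carrier A" "X = J +> x" "Y = J +> y"
      using cases by metis
    then show ?case by (simp add: add smult_r_distr)
  next
    case (4 X b c)
    then show ?case using cases[of X] by (metis quot_alg_proj_smult smult_closed smult_assoc)
  next
    case (5 X)
    then show ?case using cases[of X] by (metis quot_alg_proj_smult smult_one)
  next
    case (6 X Y c)
    then obtain x y where "x \<in> carrier A" "y \<in> carrier A" "X = J +> x" "Y = J +> y"
      using cases by metis
    then show ?case by (simp add: mult smult_mult_l)
  next
    case (7 X Y c)
    then obtain x y where "x \<in> carrier A" "y \<in> carrier A" "X = J +> x" "Y = J +> y"
      using cases by metis
    then show ?case by (simp add: mult smult_mult_r)
  qed
qed

end

text \<open>First isomorphism theorem. The values on cosets belong to the conclusion because the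
  final statement prescribes the images of vertices and arrows.\<close>

lemma quot_alg_iso:
  assumes "k_algebra B" "h \<in> alg_hom A B" "h ` carrier A = carrier B"
    and "\<And>x. x \<in> carrier A \<Longrightarrow> h x = \<zero>\<^bsub>B\<^esub> \<longleftrightarrow> x \<in> J" "ideal J A"
  shows "\<exists>\<Phi> \<in> alg_iso (quot_alg A J) B. \<forall>x\<in>carrier A. \<Phi> (J +> x) = h x"
proof -
  interpret B: k_algebra B by fact
  interpret h: ring_hom_ring A B h
    using assms(2) by (intro ring_hom_ringI2) (auto simp: alg_hom_def ring_axioms B.ring_axioms)
  interpret ideal J A by fact
  have ker: "a_kernel A B h = J"
    using assms(4) a_subset unfolding a_kernel_def' by blast
  define \<Phi> where "\<Phi> = (\<lambda>X. the_elem (h ` X))"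
  have iso: "\<Phi> \<in> ring_iso (A Quot J) B"
    using h.FactRing_iso_set[OF assms(3)] by (simp add: ker \<Phi>_def)
  have val: "\<Phi> (J +> x) = h x" if "x \<in> carrier A" for x
    using h.the_elem_simp[OF that] by (simp add: ker \<Phi>_def)
  have "\<Phi> \<in> ring_iso (quot_alg A J) B"
    using iso unfolding ring_iso_def ring_hom_def quot_alg_def
    by (simp add: ring.defs module.defs)
  moreover have "\<Phi> (c \<odot>\<^bsub>quot_alg A J\<^esub> X) = c \<odot>\<^bsub>B\<^esub> \<Phi> X" if X: "X \<in> carrier (quot_alg A J)" for c X
    using X assms(2) by (auto simp: quot_alg_carrier[OF \<open>ideal J A\<close>]
        quot_alg_proj_smult[OF \<open>ideal J A\<close>] val alg_hom_def)
  ultimately show ?thesis using val unfolding alg_iso_def by blast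
qed

end

section \<open>The path algebra\<close>

lemma pcomp_simps [simp]:
  "psrc (pcomp q p) = psrc p" "ptgt (pcomp q p) = ptgt q" "plen (pcomp q p) = plen p + plen q"
  by (simp_all add: psrc_def ptgt_def plen_def pcomp_def)

lemma vertex_path_simps [simp]:
  "psrc (vertex_path i) = i" "ptgt (vertex_path i) = i" "plen (vertex_path i) = 0"
  by (simp_all add: psrc_def ptgt_def plen_def vertex_path_def)

lemma arrow_path_simps [simp]:
  "psrc (arrow_path Q e) = tail Q e" "ptgt (arrow_path Q e) = head Q e" "plen (arrow_path Q e) = 1"
  by (simp_all add: psrc_def ptgt_def plen_def arrow_path_def)

lemma pcomp_assoc: "pcomp (pcomp r q) p = pcomp r (pcomp q p)"
  by (simp add: pcomp_def psrc_def ptgt_def)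

lemma pcomp_vertex_path:
  "ptgt p = i \<Longrightarrow> pcomp (vertex_path i) p = p" "psrc p = i \<Longrightarrow> pcomp p (vertex_path i) = p"
  by (auto simp: pcomp_def psrc_def ptgt_def vertex_path_def)

lemma path_elt_self [simp]: "path_elt p p = 1"
  by (simp add: path_elt_def)

locale quiver_algebra = fin_digraph Q for Q :: "('v, 'e) pre_digraph" +
  fixes R :: "('k::field, ('v, 'e) qpath \<Rightarrow> 'k) module" (structure)
  assumes R_eq: "R = path_alg Q"
begin

lemma carrier_iff: "f \<in> carrier R \<longleftrightarrow> finite {p. f p \<noteq> 0} \<and> {p. f p \<noteq> 0} \<subseteq> paths Q"
  by (simp add: R_eq path_alg_def)

lemma add_eq: "f \<oplus> g = (\<lambda>r. f r + g r)"
  by (simp add: R_eq path_alg_def)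

lemma zero_eq: "\<zero> = (\<lambda>r. 0)"
  by (simp add: R_eq path_alg_def)

lemma one_eq: "\<one> = (\<lambda>r. if r \<in> vertex_path ` verts Q then 1 else 0)"
  by (simp add: R_eq path_alg_def)

lemma smult_eq: "c \<odot> f = (\<lambda>r. c * f r)"
  by (simp add: R_eq path_alg_def)

definition splits :: "('v, 'e) qpath \<Rightarrow> (('v, 'e) qpath \<times> ('v, 'e) qpath) set" where
  "splits r = {(q, p). q \<in> paths Q \<and> p \<in> paths Q \<and> ptgt p = psrc q \<and> pcomp q p = r}"

lemma mult_apply: "(f \<otimes> g) r = (\<Sum>(q, p) \<in> splits r. f q * g p)"
  by (simp add: R_eq path_alg_def splits_def)

lemma paths_iff: "(u, es, v) \<in> paths Q \<longleftrightarrow> awalk u es v"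
  by (simp add: paths_def)

lemma paths_verts: 
  assumes "p \<in> paths Q"
  shows "psrc p \<in> verts Q" "ptgt p \<in> verts Q"
  using assms by (cases p; auto simp: paths_iff psrc_def ptgt_def awalk_hd_in_verts awalk_last_in_verts)+

lemma vertex_path_in [simp]: "i \<in> verts Q \<Longrightarrow> vertex_path i \<in> paths Q"
  by (simp add: vertex_path_def paths_iff awalk_Nil_iff)

lemma arrow_path_in [simp]: "e \<in> arcs Q \<Longrightarrow> arrow_path Q e \<in> paths Q"
  by (simp add: arrow_path_def paths_iff arc_implies_awalk)

lemma pcomp_in [simp]:
  "q \<in> paths Q \<Longrightarrow> p \<in> paths Q \<Longrightarrow> ptgt p = psrc q \<Longrightarrow> pcomp q p \<in> paths Q"
  by (cases p; cases q) (auto simp: paths_iff pcomp_def psrc_def ptgt_def intro: awalk_appendI)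

lemma plen_0_vertex_path: "p \<in> paths Q \<Longrightarrow> plen p = 0 \<Longrightarrow> p = vertex_path (psrc p)"
  by (cases p) (auto simp: paths_iff plen_def vertex_path_def psrc_def awalk_Nil_iff)

lemma path_last_arrow:
  assumes "p \<in> paths Q" "plen p \<noteq> 0"
  obtains a p' where "a \<in> arcs Q" "p' \<in> paths Q" "ptgt p' = tail Q a" "p = pcomp (arrow_path Q a) p'"
proof -
  obtain u es v where p: "p = (u, es, v)" by (cases p)
  with assms obtain fs a where "es = fs @ [a]" by (cases es rule: rev_cases) (auto simp: plen_def)
  with p assms that[of a "(u, fs, tail Q a)"] show thesis
    by (auto simp: paths_iff awalk_append_iff awalk_Cons_iff awalk_Nil_iff pcomp_def psrc_def
        ptgt_def arrow_path_def)
qed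

lemma path_first_arrow:
  assumes "p \<in> paths Q" "plen p \<noteq> 0"
  obtains a p' where "a \<in> arcs Q" "p' \<in> paths Q" "psrc p' = head Q a" "p = pcomp p' (arrow_path Q a)"
proof -
  obtain u es v where p: "p = (u, es, v)" by (cases p)
  with assms obtain fs a where "es = a # fs" by (cases es) (auto simp: plen_def)
  with p assms that[of a "(head Q a, fs, v)"] show thesis
    by (auto simp: paths_iff awalk_Cons_iff pcomp_def psrc_def ptgt_def arrow_path_def)
qed

text \<open>Arrows are added at the end of the path, that is as left factors: the form in which a
  multiplicative rule is pushed through a product.\<close>

lemma path_induct [consumes 1, case_names vertex arrow]:
  assumes "p \<in> paths Q"
    and "\<And>i. i \<in> verts Q \<Longrightarrow> P (vertex_path i)"
    and "\<And>a p. a \<in> arcs Q \<Longrightarrow> p \<in> paths Q \<Longrightarrow> ptgt p = tail Q a \<Longrightarrow> P p \<Longrightarrow> P (pcomp (arrow_path Q a) p)"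
  shows "P p"
  using assms(1)
proof (induction "plen p" arbitrary: p)
  case 0
  then show ?case using plen_0_vertex_path[of p] assms(2) paths_verts by metis
next
  case (Suc n)
  then obtain a p' where "a \<in> arcs Q" "p' \<in> paths Q" "ptgt p' = tail Q a"
    "p = pcomp (arrow_path Q a) p'" using path_last_arrow[of p] by (metis nat.distinct(1))
  with Suc assms(3) show ?case by simp
qed

text \<open>A factorisation is determined by the position of the cut and the vertex there. Over an
  infinite index set the sum defining the product would be zero by convention.\<close>

lemma finite_splits: "finite (splits r)"
proof (rule finite_subset)
  let ?es = "fst (snd r)"
  let ?g = "\<lambda>(n, w). ((w, drop n ?es, snd (snd r)), (fst r, take n ?es, w))"
  show "splits r \<subseteq> ?g ` ({..length ?es} \<times> verts Q)"
  proof
    fix x assume "x \<in> splits r"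
    then obtain q p where x: "x = (q, p)" "q \<in> paths Q" "p \<in> paths Q" "ptgt p = psrc q" "pcomp q p = r"
      by (auto simp: splits_def)
    then have "x = ?g (plen p, psrc q)" "plen p \<le> length ?es"
      by (cases q; cases p; auto simp: pcomp_def psrc_def ptgt_def plen_def)+
    then show "x \<in> ?g ` ({..length ?es} \<times> verts Q)" using x paths_verts by blast
  qed
  show "finite (?g ` ({..length ?es} \<times> verts Q))" by simp
qed

lemma mult_add_l: "(f \<oplus> g) \<otimes> h = (f \<otimes> h) \<oplus> (g \<otimes> h)"
  by (simp add: fun_eq_iff mult_apply add_eq case_prod_unfold sum.distrib distrib_right)

lemma mult_add_r: "h \<otimes> (f \<oplus> g) = (h \<otimes> f) \<oplus> (h \<otimes> g)"
  by (simp add: fun_eq_iff mult_apply add_eq case_prod_unfold sum.distrib distrib_left)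

lemma mult_smult_l: "(c \<odot> f) \<otimes> h = c \<odot> (f \<otimes> h)"
  by (simp add: fun_eq_iff mult_apply smult_eq case_prod_unfold sum_distrib_left mult.assoc)

lemma mult_smult_r: "h \<otimes> (c \<odot> f) = c \<odot> (h \<otimes> f)"
  by (simp add: fun_eq_iff mult_apply smult_eq case_prod_unfold sum_distrib_left mult.left_commute)

lemma mult_zero: "\<zero> \<otimes> f = \<zero>" "f \<otimes> \<zero> = \<zero>"
  by (simp_all add: fun_eq_iff mult_apply zero_eq case_prod_unfold)

lemma path_elt_mult:
  assumes "q \<in> paths Q" "p \<in> paths Q"
  shows "path_elt q \<otimes> path_elt p = (if ptgt p = psrc q then path_elt (pcomp q p) else \<zero>)"
proof
  fix r
  have "(path_elt q \<otimes> path_elt p) r = (\<Sum>x\<in>splits r. if x = (q, p) then 1 else 0)"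
    unfolding mult_apply by (rule sum.cong) (simp_all add: path_elt_def case_prod_unfold prod_eq_iff)
  also have "\<dots> = (if (q, p) \<in> splits r then 1 else 0)" by (simp add: finite_splits)
  also have "\<dots> = (if ptgt p = psrc q then path_elt (pcomp q p) else \<zero>) r"
    using assms by (auto simp: splits_def path_elt_def zero_eq)
  finally show "(path_elt q \<otimes> path_elt p) r = \<dots>" .
qed

lemma zero_in: "\<zero> \<in> carrier R"
  by (simp add: carrier_iff zero_eq)

lemma add_in: "f \<in> carrier R \<Longrightarrow> g \<in> carrier R \<Longrightarrow> f \<oplus> g \<in> carrier R"
proof -
  assume *: "f \<in> carrier R" "g \<in> carrier R"
  have "{p. (f \<oplus> g) p \<noteq> 0} \<subseteq> {p. f p \<noteq> 0} \<union> {p. g p \<noteq> 0}"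
    unfolding add_eq by (rule subsetI) (use add_0 in force)
  then show ?thesis using * unfolding carrier_iff by (meson Un_least finite_Un finite_subset order_trans)
qed

lemma smult_in: "f \<in> carrier R \<Longrightarrow> c \<odot> f \<in> carrier R"
  unfolding carrier_iff smult_eq by (auto intro: finite_subset[of _ "{p. f p \<noteq> 0}"])

lemma path_elt_in [simp]: "p \<in> paths Q \<Longrightarrow> path_elt p \<in> carrier R"
  by (auto simp: carrier_iff path_elt_def)

text \<open>The induction runs over a finite set containing the support and splits off one path at a
  time. It reduces linear statements on \<open>kQ\<close> to paths; bilinear and trilinear ones
  follow by nesting it.\<close>

lemma span_induct [consumes 1, case_names zero add smult path]:
  assumes "f \<in> carrier R" "P \<zero>"
    and add: "\<And>f g. f \<in> carrier R \<Longrightarrow> g \<in> carrier R \<Longrightarrow> P f \<Longrightarrow> P g \<Longrightarrow> P (f \<oplus> g)"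
    and smult: "\<And>c f. f \<in> carrier R \<Longrightarrow> P f \<Longrightarrow> P (c \<odot> f)"
    and path: "\<And>p. p \<in> paths Q \<Longrightarrow> P (path_elt p)"
  shows "P f"
proof -
  have "P f" if "finite F" "{p. f p \<noteq> 0} \<subseteq> F" "f \<in> carrier R" for F f
    using that
  proof (induction F arbitrary: f)
    case empty
    then have "f = \<zero>" by (auto simp: zero_eq)
    then show ?case using assms(2) by simp
  next
    case (insert p F)
    let ?g = "f(p := 0)"
    have g: "?g \<in> carrier R" using insert.prems(2)
      unfolding carrier_iff by (auto intro: finite_subset[of _ "{p. f p \<noteq> 0}"])
    show ?case
    proof (cases "f p = 0")
      case True
      then have "?g = f" by auto
      then show ?thesis using insert.prems insert.IH[of f] True by blast
    next
      case False
      then have p: "p \<in> paths Q" using insert.prems(2) by (auto simp: carrier_iff)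
      have "{q. ?g q \<noteq> 0} \<subseteq> F" using insert.prems(1) by auto
      then have "P (f p \<odot> path_elt p \<oplus> ?g)" using p g
        by (intro add smult path insert.IH smult_in path_elt_in)
      moreover have "f p \<odot> path_elt p \<oplus> ?g = f"
        by (auto simp: add_eq smult_eq path_elt_def)
      ultimately show ?thesis by simp
    qed
  qed
  then show ?thesis using assms(1) by (auto simp: carrier_iff)
qed

lemma mult_in: 
  assumes "f \<in> carrier R" "g \<in> carrier R"
  shows "f \<otimes> g \<in> carrier R"
  using assms(1)
proof (induction f rule: span_induct)
  case (path p)
  show ?case using assms(2)
  proof (induction g rule: span_induct)
    case (path q)
    with \<open>p \<in> paths Q\<close> show ?case by (auto simp: path_elt_mult zero_in)
  qed (auto simp: mult_zero mult_add_r mult_smult_r zero_in add_in smult_in)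
qed (auto simp: mult_zero mult_add_l mult_smult_l zero_in add_in smult_in)

lemma assoc:
  assumes "f \<in> carrier R" "g \<in> carrier R" "h \<in> carrier R"
  shows "(f \<otimes> g) \<otimes> h = f \<otimes> (g \<otimes> h)"
  using assms(1)
proof (induction f rule: span_induct)
  case (path p)
  show ?case using assms(2)
  proof (induction g rule: span_induct)
    case (path q)
    show ?case using assms(3)
    proof (induction h rule: span_induct)
      case (path r)
      then show ?case using \<open>p \<in> paths Q\<close> \<open>q \<in> paths Q\<close>
        by (auto simp: path_elt_mult mult_zero pcomp_assoc)
    qed (auto simp: mult_zero mult_add_r mult_smult_r)
  qed (auto simp: mult_zero mult_add_r mult_smult_r mult_add_l mult_smult_l)
qed (auto simp: mult_zero mult_add_l mult_smult_l)

lemma one_in: "\<one> \<in> carrier R"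
  by (auto simp: carrier_iff one_eq)

lemma one_mult: "f \<in> carrier R \<Longrightarrow> \<one> \<otimes> f = f"
proof (induction f rule: span_induct)
  case (path p)
  show ?case
  proof
    fix r
    \<comment> \<open>Among the factorisations of \<open>r\<close> only the one through the trivial
      path at the end of \<open>p\<close> contributes.\<close>
    have "\<one> q * path_elt p p' = (if (q, p') = (vertex_path (ptgt p), p) then 1 else 0)" if "(q, p') \<in> splits r" for q p'
      using that path paths_verts[of p]
      by (auto simp add: path_elt_def one_eq splits_def image_iff simp del: split_paired_All split_paired_Ex)
    then have "(\<one> \<otimes> path_elt p) r = (\<Sum>x\<in>splits r. if x = (vertex_path (ptgt p), p) then 1 else 0)"
      unfolding mult_apply by (intro sum.cong refl) (simp only: split_paired_all prod.case)
    also have "\<dots> = (if (vertex_path (ptgt p), p) \<in> splits r then 1 else 0)" by (simp add: finite_splits)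
    also have "\<dots> = path_elt p r" using path paths_verts[of p]
      by (auto simp: splits_def path_elt_def pcomp_vertex_path)
    finally show "(\<one> \<otimes> path_elt p) r = path_elt p r" .
  qed
qed (auto simp: mult_zero mult_add_r mult_smult_r)

lemma mult_one: "f \<in> carrier R \<Longrightarrow> f \<otimes> \<one> = f"
proof (induction f rule: span_induct)
  case (path p)
  show ?case
  proof
    fix r
    have "path_elt p q * \<one> p' = (if (q, p') = (p, vertex_path (psrc p)) then 1 else 0)" if "(q, p') \<in> splits r" for q p'
      using that path paths_verts[of p]
      by (auto simp add: path_elt_def one_eq splits_def image_iff simp del: split_paired_All split_paired_Ex)
    then have "(path_elt p \<otimes> \<one>) r = (\<Sum>x\<in>splits r. if x = (p, vertex_path (psrc p)) then 1 else 0)"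
      unfolding mult_apply by (intro sum.cong refl) (simp only: split_paired_all prod.case)
    also have "\<dots> = (if (p, vertex_path (psrc p)) \<in> splits r then 1 else 0)" by (simp add: finite_splits)
    also have "\<dots> = path_elt p r" using path paths_verts[of p]
      by (auto simp: splits_def path_elt_def pcomp_vertex_path)
    finally show "(path_elt p \<otimes> \<one>) r = path_elt p r" .
  qed
qed (auto simp: mult_zero mult_add_l mult_smult_l)

lemma path_alg_k_algebra: "k_algebra R"
proof -
  have neg: "\<exists>g\<in>carrier R. g \<oplus> f = \<zero>" if "f \<in> carrier R" for f
    by (rule bexI[of _ "(- 1) \<odot> f"], simp add: add_eq smult_eq zero_eq, rule smult_in[OF that])
  have "ring R"
    by (intro ringI abelian_groupI monoidI)
      (auto simp: mult_in add_in one_in zero_in assoc one_mult mult_one mult_add_l mult_add_r neg,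
        auto simp: add_eq zero_eq add_ac)
  then show ?thesis
    by (intro k_algebra.intro k_algebra_axioms.intro)
      (auto simp: smult_in mult_smult_l mult_smult_r, auto simp: add_eq smult_eq algebra_simps)
qed

end

sublocale quiver_algebra \<subseteq> k_algebra R
  by (rule path_alg_k_algebra)

context quiver_algebra
begin

text \<open>Absorbing paths is enough because paths span. Together with minimality of the generated
  ideal this is the standard way to prove a property of all of \<open>I\<close>: the elements having
  it form an ideal that contains the relations.\<close>

lemma ideal_pathI:
  assumes "J \<subseteq> carrier R" "\<zero> \<in> J"
    and add: "\<And>x y. x \<in> J \<Longrightarrow> y \<in> J \<Longrightarrow> x \<oplus> y \<in> J"
    and smult: "\<And>c x. x \<in> J \<Longrightarrow> c \<odot> x \<in> J"
    and l: "\<And>p x. p \<in> paths Q \<Longrightarrow> x \<in> J \<Longrightarrow> path_elt p \<otimes> x \<in> J"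
    and r: "\<And>p x. p \<in> paths Q \<Longrightarrow> x \<in> J \<Longrightarrow> x \<otimes> path_elt p \<in> J"
  shows "ideal J R"
proof (rule idealI_smult)
  show "f \<otimes> x \<in> J" if "f \<in> carrier R" "x \<in> J" for f x
    using that(1) by (induction f rule: span_induct)
      (use that(2) assms in \<open>simp_all add: mult_zero mult_add_l mult_smult_l\<close>)
  show "x \<otimes> f \<in> J" if "f \<in> carrier R" "x \<in> J" for f x
    using that(1) by (induction f rule: span_induct)
      (use that(2) assms in \<open>simp_all add: mult_zero mult_add_r mult_smult_r\<close>)
qed (use assms(1,2) add in simp_all)

section \<open>Linear extension from paths and the universal property of the path algebra\<close>

definition lin_ext :: "('k, 'b) module \<Rightarrow> (('v, 'e) qpath \<Rightarrow> 'b) \<Rightarrow> (('v, 'e) qpath \<Rightarrow> 'k) \<Rightarrow> 'b" where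
  "lin_ext A m f = (\<Oplus>\<^bsub>A\<^esub>p\<in>{p. f p \<noteq> 0}. f p \<odot>\<^bsub>A\<^esub> m p)"

context
  fixes A :: "('k, 'b) module" and m
  assumes A: "k_algebra A" and m: "\<And>p. p \<in> paths Q \<Longrightarrow> m p \<in> carrier A"
begin

interpretation A: k_algebra A by (rule A)

text \<open>Supports of different functions differ; enlarging the index set lets their extensions be
  compared as sums over one common set.\<close>

lemma lin_ext_superset:
  assumes "finite F" "F \<subseteq> paths Q" "{p. f p \<noteq> 0} \<subseteq> F"
  shows "lin_ext A m f = (\<Oplus>\<^bsub>A\<^esub>p\<in>F. f p \<odot>\<^bsub>A\<^esub> m p)"
  unfolding lin_ext_def
  by (rule A.add.finprod_mono_neutral_cong_left) (use assms m in auto)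

lemma lin_ext_path_elt:
  assumes "p \<in> paths Q"
  shows "lin_ext A m (path_elt p) = m p"
  using assms m by (subst lin_ext_superset[of "{p}"]) (auto simp: path_elt_def)

lemma lin_ext_in: "f \<in> carrier R \<Longrightarrow> lin_ext A m f \<in> carrier A"
  unfolding lin_ext_def carrier_iff using m by (intro A.finsum_closed) auto

lemma lin_ext_add:
  assumes "f \<in> carrier R" "g \<in> carrier R"
  shows "lin_ext A m (f \<oplus> g) = lin_ext A m f \<oplus>\<^bsub>A\<^esub> lin_ext A m g"
proof -
  let ?F = "{p. f p \<noteq> 0} \<union> {p. g p \<noteq> 0}"
  have F: "finite ?F" "?F \<subseteq> paths Q" using assms by (simp_all add: carrier_iff)
  have m': "m p \<in> carrier A" if "p \<in> ?F" for p using that F(2) m by blast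
  have "lin_ext A m (f \<oplus> g) = (\<Oplus>\<^bsub>A\<^esub>p\<in>?F. f p \<odot>\<^bsub>A\<^esub> m p \<oplus>\<^bsub>A\<^esub> g p \<odot>\<^bsub>A\<^esub> m p)"
  proof (subst lin_ext_superset[OF F])
    show "{p. (f \<oplus> g) p \<noteq> 0} \<subseteq> ?F" by (rule subsetI, rule ccontr) (simp add: add_eq)
    show "(\<Oplus>\<^bsub>A\<^esub>p\<in>?F. (f \<oplus> g) p \<odot>\<^bsub>A\<^esub> m p)
      = (\<Oplus>\<^bsub>A\<^esub>p\<in>?F. f p \<odot>\<^bsub>A\<^esub> m p \<oplus>\<^bsub>A\<^esub> g p \<odot>\<^bsub>A\<^esub> m p)"
      by (rule A.finsum_cong') (use m' in \<open>simp_all add: add_eq A.smult_l_distr Pi_iff\<close>)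
  qed
  also have "\<dots> = lin_ext A m f \<oplus>\<^bsub>A\<^esub> lin_ext A m g"
    using m' by (subst A.finsum_addf) (simp_all add: lin_ext_superset[OF F] Pi_iff)
  finally show ?thesis .
qed

lemma lin_ext_smult:
  assumes "f \<in> carrier R"
  shows "lin_ext A m (c \<odot> f) = c \<odot>\<^bsub>A\<^esub> lin_ext A m f"
proof -
  let ?F = "{p. f p \<noteq> 0}"
  have F: "finite ?F" "?F \<subseteq> paths Q" using assms by (simp_all add: carrier_iff)
  have m': "m p \<in> carrier A" if "p \<in> ?F" for p using that F(2) m by blast
  have "lin_ext A m (c \<odot> f) = (\<Oplus>\<^bsub>A\<^esub>p\<in>?F. c \<odot>\<^bsub>A\<^esub> (f p \<odot>\<^bsub>A\<^esub> m p))"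
  proof (subst lin_ext_superset[OF F])
    show "{p. (c \<odot> f) p \<noteq> 0} \<subseteq> ?F" by (rule subsetI) (simp add: smult_eq)
    show "(\<Oplus>\<^bsub>A\<^esub>p\<in>?F. (c \<odot> f) p \<odot>\<^bsub>A\<^esub> m p) = (\<Oplus>\<^bsub>A\<^esub>p\<in>?F. c \<odot>\<^bsub>A\<^esub> (f p \<odot>\<^bsub>A\<^esub> m p))"
      by (rule A.finsum_cong') (use m' in \<open>simp_all add: smult_eq A.smult_assoc Pi_iff\<close>)
  qed
  then show ?thesis using F(1) m' by (simp add: A.smult_finsum lin_ext_def Pi_iff)
qed

end

lemma alg_homI:
  assumes A: "k_algebra A"
    and h: "\<And>f. f \<in> carrier R \<Longrightarrow> h f \<in> carrier A"
    and add: "\<And>f g. f \<in> carrier R \<Longrightarrow> g \<in> carrier R \<Longrightarrow> h (f \<oplus> g) = h f \<oplus>\<^bsub>A\<^esub> h g"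
    and smult: "\<And>c f. f \<in> carrier R \<Longrightarrow> h (c \<odot> f) = c \<odot>\<^bsub>A\<^esub> h f"
    and mult: "\<And>q p. q \<in> paths Q \<Longrightarrow> p \<in> paths Q \<Longrightarrow>
      h (path_elt q \<otimes> path_elt p) = h (path_elt q) \<otimes>\<^bsub>A\<^esub> h (path_elt p)"
    and one: "h \<one> = \<one>\<^bsub>A\<^esub>"
  shows "h \<in> alg_hom R A"
proof -
  interpret A: k_algebra A by (rule A)
  have zero: "h \<zero> = \<zero>\<^bsub>A\<^esub>" using smult[of \<zero> 0] h by simp
  have "h (f \<otimes> g) = h f \<otimes>\<^bsub>A\<^esub> h g" if f: "f \<in> carrier R" and g: "g \<in> carrier R" for f g
    using f
  proof (induction f rule: span_induct)
    case (path q)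
    show ?case using g
    proof (induction g rule: span_induct)
      case (path p)
      then show ?case using \<open>q \<in> paths Q\<close> mult by simp
    qed (use path in \<open>simp_all add: zero h add smult mult_zero mult_add_r mult_smult_r A.r_distr A.smult_mult_r\<close>)
  qed (use g in \<open>simp_all add: zero h add smult mult_zero mult_add_l mult_smult_l A.l_distr A.smult_mult_l\<close>)
  then show ?thesis using h add one smult by (simp add: alg_hom_def ring_hom_def)
qed

text \<open>A path goes to the product of the images of its arrows. Orthogonality of the
  \<open>E i\<close> makes products of non-composable paths vanish, and their sum being
  \<open>\<one>\<close> makes the map unital.\<close>

proposition path_alg_universal:
  assumes A: "k_algebra A"
    and E: "\<And>i. i \<in> verts Q \<Longrightarrow> E i \<in> carrier A"
    and X: "\<And>a. a \<in> arcs Q \<Longrightarrow> X a \<in> carrier A"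
    and idem: "\<And>i. i \<in> verts Q \<Longrightarrow> E i \<otimes>\<^bsub>A\<^esub> E i = E i"
    and orth: "\<And>i j. i \<in> verts Q \<Longrightarrow> j \<in> verts Q \<Longrightarrow> i \<noteq> j \<Longrightarrow> E i \<otimes>\<^bsub>A\<^esub> E j = \<zero>\<^bsub>A\<^esub>"
    and sum: "(\<Oplus>\<^bsub>A\<^esub>i\<in>verts Q. E i) = \<one>\<^bsub>A\<^esub>"
    and hd: "\<And>a. a \<in> arcs Q \<Longrightarrow> E (head Q a) \<otimes>\<^bsub>A\<^esub> X a = X a"
    and tl: "\<And>a. a \<in> arcs Q \<Longrightarrow> X a \<otimes>\<^bsub>A\<^esub> E (tail Q a) = X a"
  shows "\<exists>h\<in>alg_hom R A. (\<forall>i\<in>verts Q. h (path_elt (vertex_path i)) = E i) \<and>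
    (\<forall>a\<in>arcs Q. h (path_elt (arrow_path Q a)) = X a)"
proof -
  interpret A: k_algebra A by (rule A)
  \<comment> \<open>The list is in order of traversal while products are read from right to left, so
    each further arrow is multiplied on the left. The start value \<open>E (psrc p)\<close> gives
    trivial paths their idempotent.\<close>
  define m where "m p = foldl (\<lambda>x a. X a \<otimes>\<^bsub>A\<^esub> x) (E (psrc p)) (fst (snd p))" for p
  have m_vertex [simp]: "m (vertex_path i) = E i" for i
    by (simp add: m_def vertex_path_def psrc_def)
  have m_arrow [simp]: "m (pcomp (arrow_path Q a) p) = X a \<otimes>\<^bsub>A\<^esub> m p" for a p
    by (simp add: m_def pcomp_def psrc_def arrow_path_def)
  have m_in: "m p \<in> carrier A" if "p \<in> paths Q" for p
    using that by (induction p rule: path_induct) (simp_all add: E X)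
  have m_tgt: "E (ptgt p) \<otimes>\<^bsub>A\<^esub> m p = m p" if "p \<in> paths Q" for p
    using that by (induction p rule: path_induct)
      (simp_all add: idem hd E X m_in flip: A.m_assoc)
  have m_src: "m p \<otimes>\<^bsub>A\<^esub> E (psrc p) = m p" if "p \<in> paths Q" for p
    using that by (induction p rule: path_induct)
      (simp_all add: idem E X m_in A.m_assoc paths_verts)
  have m_comp: "m (pcomp q p) = m q \<otimes>\<^bsub>A\<^esub> m p" if "q \<in> paths Q" "p \<in> paths Q" "ptgt p = psrc q" for q p
    using that
  proof (induction q rule: path_induct)
    case (vertex i)
    then show ?case using m_tgt[of p] by (simp add: pcomp_vertex_path)
  next
    case (arrow a q)
    then show ?case by (simp add: pcomp_assoc A.m_assoc X m_in)
  qed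
  \<comment> \<open>The idempotents at the end of \<open>p\<close> and the start of \<open>q\<close>
    can be inserted between the two factors, where they annihilate each other.\<close>
  have m_orth: "m q \<otimes>\<^bsub>A\<^esub> m p = \<zero>\<^bsub>A\<^esub>" if "q \<in> paths Q" "p \<in> paths Q" "ptgt p \<noteq> psrc q" for q p
  proof -
    have v: "psrc q \<in> verts Q" "ptgt p \<in> verts Q" using that paths_verts by blast+
    have "m q \<otimes>\<^bsub>A\<^esub> m p = (m q \<otimes>\<^bsub>A\<^esub> E (psrc q)) \<otimes>\<^bsub>A\<^esub> (E (ptgt p) \<otimes>\<^bsub>A\<^esub> m p)"
      using that by (simp add: m_src m_tgt)
    also have "\<dots> = m q \<otimes>\<^bsub>A\<^esub> ((E (psrc q) \<otimes>\<^bsub>A\<^esub> E (ptgt p)) \<otimes>\<^bsub>A\<^esub> m p)"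
      using that v by (simp add: m_in E A.m_assoc)
    also have "\<dots> = \<zero>\<^bsub>A\<^esub>" using that v orth[of "psrc q" "ptgt p"] by (simp add: m_in)
    finally show ?thesis .
  qed
  let ?h = "lin_ext A m"
  note h_path = lin_ext_path_elt[OF A m_in]
  have one: "?h \<one> = \<one>\<^bsub>A\<^esub>"
  proof -
    have inj: "inj_on vertex_path (verts Q)"
      by (auto simp: inj_on_def vertex_path_def)
    have "?h \<one> = (\<Oplus>\<^bsub>A\<^esub>p\<in>vertex_path ` verts Q. \<one> p \<odot>\<^bsub>A\<^esub> m p)"
      by (rule lin_ext_superset[OF A m_in]) (auto simp: one_eq)
    also have "\<dots> = (\<Oplus>\<^bsub>A\<^esub>i\<in>verts Q. \<one> (vertex_path i) \<odot>\<^bsub>A\<^esub> m (vertex_path i))"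
      by (rule A.add.finprod_reindex) (auto simp: E inj)
    also have "\<dots> = (\<Oplus>\<^bsub>A\<^esub>i\<in>verts Q. E i)"
      by (rule A.finsum_cong') (auto simp: E one_eq)
    finally show ?thesis using sum by simp
  qed
  have "?h \<in> alg_hom R A"
  proof (rule alg_homI[OF A])
    show "?h (path_elt q \<otimes> path_elt p) = ?h (path_elt q) \<otimes>\<^bsub>A\<^esub> ?h (path_elt p)"
      if "q \<in> paths Q" "p \<in> paths Q" for q p
      using that lin_ext_smult[OF A m_in zero_closed, where c = 0] lin_ext_in[OF A m_in zero_closed]
      by (simp add: path_elt_mult h_path m_comp m_orth)
  qed (use one in \<open>simp_all add: lin_ext_in[OF A m_in] lin_ext_add[OF A m_in] lin_ext_smult[OF A m_in]\<close>)
  moreover have "?h (path_elt (arrow_path Q a)) = X a" if "a \<in> arcs Q" for a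
  proof -
    have "m (arrow_path Q a) = X a \<otimes>\<^bsub>A\<^esub> E (tail Q a)"
      by (simp add: m_def arrow_path_def psrc_def)
    then show ?thesis using that by (simp add: h_path tl)
  qed
  ultimately show ?thesis by (intro bexI[of _ ?h]) (simp_all add: h_path)
qed

section \<open>Homogeneous components\<close>

text \<open>The projection of \<open>kQ\<close> onto
  \<open>e\<^sub>j (kQ)\<^sub>t e\<^sub>i\<close>. Membership in this space is expressed throughout
  as \<open>hcomp j t i f = f\<close>.\<close>

definition hcomp :: "'v \<Rightarrow> nat \<Rightarrow> 'v \<Rightarrow> (('v, 'e) qpath \<Rightarrow> 'k) \<Rightarrow> (('v, 'e) qpath \<Rightarrow> 'k)" where
  "hcomp j t i f = (\<lambda>p. if ptgt p = j \<and> plen p = t \<and> psrc p = i then f p else 0)"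

lemma hcomp_in [simp]: "f \<in> carrier R \<Longrightarrow> hcomp j t i f \<in> carrier R"
  unfolding carrier_iff hcomp_def by (auto intro: finite_subset[of _ "{p. f p \<noteq> 0}"])

lemma hcomp_add: "hcomp j t i (f \<oplus> g) = hcomp j t i f \<oplus> hcomp j t i g"
  by (auto simp: hcomp_def add_eq)

lemma hcomp_smult: "hcomp j t i (c \<odot> f) = c \<odot> hcomp j t i f"
  by (auto simp: hcomp_def smult_eq)

lemma hcomp_zero [simp]: "hcomp j t i \<zero> = \<zero>"
  by (auto simp: hcomp_def zero_eq)

lemma hcomp_path_elt:
  "hcomp j t i (path_elt p) = (if ptgt p = j \<and> plen p = t \<and> psrc p = i then path_elt p else \<zero>)"
  by (auto simp: hcomp_def path_elt_def zero_eq)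

lemma hcomp_comp: "hcomp j t i (hcomp j' t' i' f) = (if j = j' \<and> t = t' \<and> i = i' then hcomp j t i f else \<zero>)"
  by (auto simp: hcomp_def zero_eq)

text \<open>The guard \<open>plen p \<le> t\<close> matters: with truncated subtraction a component
  of degree 0 would otherwise appear in the other cases.\<close>

lemma hcomp_mult_l:
  assumes "p \<in> paths Q" "f \<in> carrier R"
  shows "hcomp j t i (path_elt p \<otimes> f) =
    (if ptgt p = j \<and> plen p \<le> t then path_elt p \<otimes> hcomp (psrc p) (t - plen p) i f else \<zero>)"
  using assms(2)
  by (induction f rule: span_induct)
    (use assms(1) in \<open>auto simp: mult_zero mult_add_r mult_smult_r hcomp_add hcomp_smult hcomp_path_elt path_elt_mult\<close>)

lemma hcomp_mult_r:
  assumes "p \<in> paths Q" "f \<in> carrier R"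
  shows "hcomp j t i (f \<otimes> path_elt p) =
    (if psrc p = i \<and> plen p \<le> t then hcomp j (t - plen p) (ptgt p) f \<otimes> path_elt p else \<zero>)"
  using assms(2)
  by (induction f rule: span_induct)
    (use assms(1) in \<open>auto simp: mult_zero mult_add_l mult_smult_l hcomp_add hcomp_smult hcomp_path_elt path_elt_mult\<close>)

lemma vertex_mult:
  assumes "j \<in> verts Q" "f \<in> carrier R"
  shows "path_elt (vertex_path j) \<otimes> f = (\<lambda>p. if ptgt p = j then f p else 0)"
  using assms(2)
proof (induction f rule: span_induct)
  case (path p)
  show ?case
    unfolding path_elt_mult[OF vertex_path_in[OF assms(1)] path]
    by (rule ext) (simp add: pcomp_vertex_path zero_eq path_elt_def)
next
  case zero
  show ?case unfolding mult_zero by (simp add: zero_eq fun_eq_iff)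
next
  case (add f g)
  then show ?case by (simp add: mult_add_r, simp add: add_eq fun_eq_iff)
next
  case (smult c f)
  then show ?case by (simp add: mult_smult_r, simp add: smult_eq fun_eq_iff)
qed

lemma mult_vertex:
  assumes "j \<in> verts Q" "f \<in> carrier R"
  shows "f \<otimes> path_elt (vertex_path j) = (\<lambda>p. if psrc p = j then f p else 0)"
  using assms(2)
proof (induction f rule: span_induct)
  case (path p)
  show ?case
    unfolding path_elt_mult[OF path vertex_path_in[OF assms(1)]]
    by (rule ext) (simp add: pcomp_vertex_path zero_eq path_elt_def)
next
  case zero
  show ?case unfolding mult_zero by (simp add: zero_eq fun_eq_iff)
next
  case (add f g)
  then show ?case by (simp add: mult_add_l, simp add: add_eq fun_eq_iff)
next
  case (smult c f)
  then show ?case by (simp add: mult_smult_l, simp add: smult_eq fun_eq_iff)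
qed

text \<open>Only finitely many triples of end, degree and start occur in the support, and
  \<open>f\<close> is the sum of the corresponding components. A component with an end outside the
  vertex set is zero, so only vertices have to be considered.\<close>

lemma hcomp_induct:
  assumes "f \<in> carrier R" "P \<zero>"
    and add: "\<And>f g. f \<in> carrier R \<Longrightarrow> g \<in> carrier R \<Longrightarrow> P f \<Longrightarrow> P g \<Longrightarrow> P (f \<oplus> g)"
    and hcomp: "\<And>j t i. j \<in> verts Q \<Longrightarrow> i \<in> verts Q \<Longrightarrow> P (hcomp j t i f)"
  shows "P f"
proof -
  let ?T = "\<lambda>p. (ptgt p, plen p, psrc p)"
  have "P (\<lambda>p. if ?T p \<in> F then f p else 0)"
    if "finite F" for F
    using that
  proof (induction F)
    case empty
    then show ?case using assms(2) by (simp add: zero_eq)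
  next
    case (insert x F)
    obtain j t i where x: "x = (j, t, i)" by (cases x)
    let ?g = "\<lambda>p. if ?T p \<in> F then f p else 0"
    have g: "?g \<in> carrier R" using assms(1)
      unfolding carrier_iff by (auto intro: finite_subset[of _ "{p. f p \<noteq> 0}"])
    have eq: "(\<lambda>p. if ?T p \<in> insert x F then f p else 0) = hcomp j t i f \<oplus> ?g"
      using insert.hyps x by (auto simp: hcomp_def add_eq)
    have "P (hcomp j t i f)"
    proof (cases "j \<in> verts Q \<and> i \<in> verts Q")
      case False
      then have "hcomp j t i f = \<zero>"
        using assms(1) paths_verts by (auto simp: hcomp_def zero_eq carrier_iff fun_eq_iff)
      then show ?thesis using assms(2) by simp
    qed (use hcomp in auto)
    then show ?case unfolding eq by (rule add[OF hcomp_in[OF assms(1)] g _ insert.IH])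
  qed
  from this[of "?T ` {p. f p \<noteq> 0}"] assms(1)
  have "P (\<lambda>p. if ?T p \<in> ?T ` {p. f p \<noteq> 0} then f p else 0)" by (simp add: carrier_iff)
  also have "(\<lambda>p. if ?T p \<in> ?T ` {p. f p \<noteq> 0} then f p else 0) = f"
  proof
    show "(if ?T p \<in> ?T ` {p. f p \<noteq> 0} then f p else 0) = f p" for p
      by (cases "f p = 0") (simp_all add: rev_image_eqI)
  qed
  finally show ?thesis .
qed

end

section \<open>Self-injective rings\<close>

text \<open>Prepares the domain \<open>R a\<close> of the map that is extended in
  \<open>self_injective_right_factor\<close>; the regular module is the case
  \<open>a = \<one>\<close>.\<close>

lemma (in ring) left_ideal_module:
  assumes "a \<in> carrier R"
  shows "left_module R \<lparr>carrier = (\<lambda>x. x \<otimes> a) ` carrier R, mult = mult R, one = one R,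
    zero = zero R, add = add R, smult = mult R\<rparr>" (is "left_module R ?M")
proof -
  have in_M: "\<exists>x\<in>carrier R. y = x \<otimes> a" if "y \<in> carrier ?M" for y
    using that by auto
  have M_in: "x \<otimes> a \<in> carrier ?M" if "x \<in> carrier R" for x
    using that by simp
  have sub: "y \<in> carrier R" if "y \<in> carrier ?M" for y
    using in_M[OF that] assms by auto
  have add: "x \<oplus> y \<in> carrier ?M" if "x \<in> carrier ?M" "y \<in> carrier ?M" for x y
    using in_M[OF that(1)] in_M[OF that(2)] M_in assms by (metis add.m_closed l_distr)
  have mult: "x \<otimes> y \<in> carrier ?M" if "x \<in> carrier R" "y \<in> carrier ?M" for x y
    using in_M[OF that(2)] that(1) M_in assms by (metis m_assoc m_closed)
  have zero: "\<zero> \<in> carrier ?M"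
    using M_in[of \<zero>] assms by simp
  have neg: "\<exists>y\<in>carrier ?M. y \<oplus> x = \<zero>" if "x \<in> carrier ?M" for x
    using mult[of "\<ominus> \<one>" x] that sub[OF that] by (metis a_inv_closed l_minus l_neg l_one one_closed)
  have "abelian_group ?M"
    by (rule abelian_groupI)
      (use add zero neg sub in \<open>simp_all add: a_ac\<close>)
  then show ?thesis
    unfolding left_module_def using ring_axioms sub mult by (simp add: l_distr r_distr m_assoc)
qed

lemma (in ring) regular_left_module: "left_module R (regular_module R)"
proof -
  have "(\<lambda>x. x \<otimes> \<one>) ` carrier R = carrier R" by (simp cong: image_cong)
  then show ?thesis using left_ideal_module[of \<one>] by (simp add: regular_module_def)
qed

text \<open>The homomorphism \<open>R a \<rightarrow> R\<close>, \<open>x a \<mapsto> x b\<close>, extends to \<open>R\<close>, hence is a right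
  multiplication.\<close>

lemma (in ring) self_injective_right_factor:
  assumes inj: "self_injective R" and a: "a \<in> carrier R" and b: "b \<in> carrier R"
    and ann: "\<And>x. x \<in> carrier R \<Longrightarrow> x \<otimes> a = \<zero> \<Longrightarrow> x \<otimes> b = \<zero>"
  shows "\<exists>z\<in>carrier R. b = a \<otimes> z"
proof -
  define M where "M = \<lparr>carrier = (\<lambda>x. x \<otimes> a) ` carrier R, mult = mult R, one = one R,
    zero = zero R, add = add R, smult = mult R\<rparr>"
  have M: "left_module R M"
    unfolding M_def by (rule left_ideal_module[OF a])
  \<comment> \<open>A coefficient \<open>x\<close> with \<open>y = x \<otimes> a\<close> is not
    unique; \<open>ann\<close> makes the value independent of the choice.\<close>
  define f where "f y = (SOME x. x \<in> carrier R \<and> y = x \<otimes> a) \<otimes> b" for y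
  have f: "f (x \<otimes> a) = x \<otimes> b" if x: "x \<in> carrier R" for x
  proof -
    define x' where "x' = (SOME x'. x' \<in> carrier R \<and> x \<otimes> a = x' \<otimes> a)"
    have "x' \<in> carrier R \<and> x \<otimes> a = x' \<otimes> a"
      unfolding x'_def by (rule someI[of _ x]) (simp add: x)
    then have x': "x' \<in> carrier R" "x \<otimes> a = x' \<otimes> a" by auto
    then have "(x' \<ominus> x) \<otimes> a = \<zero>"
      using x a by (simp add: a_minus_def l_distr l_minus r_neg)
    then have "(x' \<ominus> x) \<otimes> b = \<zero>" using ann x x' by simp
    then have "x' \<otimes> b \<ominus> x \<otimes> b = \<zero>"
      using x x' b by (simp add: a_minus_def l_distr l_minus)
    then have "x' \<otimes> b = x \<otimes> b" 
      using x x'(1) b minus_equality[of "x' \<otimes> b" "\<ominus> (x \<otimes> b)"] by (simp add: a_minus_def)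
    then show ?thesis by (simp add: f_def x'_def)
  qed
  have "f \<in> left_module_hom R M (regular_module R)"
  proof -
    have "f (x \<otimes> a \<oplus> y \<otimes> a) = f (x \<otimes> a) \<oplus> f (y \<otimes> a)" if "x \<in> carrier R" "y \<in> carrier R" for x y
      using that f[of "x \<oplus> y"] a b by (simp add: f l_distr)
    moreover have "f (x \<otimes> (y \<otimes> a)) = x \<otimes> f (y \<otimes> a)" if "x \<in> carrier R" "y \<in> carrier R" for x y
      using that f[of "x \<otimes> y"] a b by (simp add: f m_assoc)
    ultimately show ?thesis
      using b by (auto simp: left_module_hom_def M_def regular_module_def f)
  qed
  moreover have "id \<in> left_module_hom R M (regular_module R)"
    using a by (auto simp: left_module_hom_def M_def regular_module_def)
  moreover have "inj_on id (carrier M)" by simp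
  ultimately have "\<exists>h\<in>left_module_hom R (regular_module R) (regular_module R). \<forall>x\<in>carrier M. h (id x) = f x"
    using inj M regular_left_module unfolding self_injective_def by blast
  then obtain h where h: "h \<in> left_module_hom R (regular_module R) (regular_module R)"
    and hf: "\<And>x. x \<in> carrier M \<Longrightarrow> h x = f x"
    by auto
  have h_in: "h \<one> \<in> carrier R" and h_mult: "h (x \<otimes> y) = x \<otimes> h y"
    if "x \<in> carrier R" "y \<in> carrier R" for x y
    using h that by (auto simp: left_module_hom_def regular_module_def)
  have "\<one> \<otimes> a \<in> carrier M" unfolding M_def partial_object.select_convs by (rule imageI) simp
  then have "h a = b" using hf[of a] f[of \<one>] a b by simp
  then have "b = a \<otimes> h \<one>" using h_mult[OF a, of \<one>] a by simp
  then show ?thesis using h_in[OF a a] by blast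
qed

section \<open>Bound quiver algebras\<close>

locale bound_quiver_algebra = quiver_algebra Q R
  for Q :: "('v, 'e) pre_digraph" and R :: "('k::field, ('v, 'e) qpath \<Rightarrow> 'k) module" (structure) +
  fixes \<rho> :: "(('v, 'e) qpath \<Rightarrow> 'k) set"
  assumes bound_quiver: "bound_quiver Q \<rho>"
begin

definition I :: "(('v, 'e) qpath \<Rightarrow> 'k) set" where "I = Idl \<rho>"

definition L :: "('k, (('v, 'e) qpath \<Rightarrow> 'k) set) module" where "L = bound_alg Q \<rho>"

text \<open>The bridge between \<open>\<Lambda>\<close> and \<open>kQ\<close>: an identity in
  \<open>\<Lambda>\<close> becomes membership of a difference of representatives in
  \<open>I\<close>.\<close>

definition proj :: "(('v, 'e) qpath \<Rightarrow> 'k) \<Rightarrow> (('v, 'e) qpath \<Rightarrow> 'k) set" where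
  "proj f = I +> f"

lemma L_quot: "L = quot_alg R I"
  by (simp only: L_def bound_alg_def I_def flip: R_eq)

lemma rel_in: "\<rho> \<subseteq> carrier R"
  using bound_quiver by (simp add: bound_quiver_def R_eq)

lemma I_ideal: "ideal I R"
  unfolding I_def by (rule genideal_ideal[OF rel_in])

lemma rel_subset: "\<rho> \<subseteq> I"
  unfolding I_def by (rule genideal_self[OF rel_in])

lemma I_minimal: "ideal J R \<Longrightarrow> \<rho> \<subseteq> J \<Longrightarrow> I \<subseteq> J"
  unfolding I_def by (rule genideal_minimal)

sublocale I: ideal I R by (rule I_ideal)

sublocale L: k_algebra L
  unfolding L_quot by (rule quot_alg_k_algebra[OF I_ideal])

lemma proj_alg_hom: "proj \<in> alg_hom R L"
proof -
  have "proj = (\<lambda>x. I +> x)" by (simp add: fun_eq_iff proj_def)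
  then show ?thesis using quot_alg_proj[OF I_ideal] by (simp add: L_quot)
qed

lemma proj_in [simp]: "f \<in> carrier R \<Longrightarrow> proj f \<in> carrier L"
  and proj_add: "f \<in> carrier R \<Longrightarrow> g \<in> carrier R \<Longrightarrow> proj (f \<oplus> g) = proj f \<oplus>\<^bsub>L\<^esub> proj g"
  and proj_mult: "f \<in> carrier R \<Longrightarrow> g \<in> carrier R \<Longrightarrow> proj (f \<otimes> g) = proj f \<otimes>\<^bsub>L\<^esub> proj g"
  and proj_one: "proj \<one> = \<one>\<^bsub>L\<^esub>"
  and proj_smult: "f \<in> carrier R \<Longrightarrow> proj (c \<odot> f) = c \<odot>\<^bsub>L\<^esub> proj f"
  using proj_alg_hom by (auto simp: alg_hom_def ring_hom_def)

lemma L_zero: "\<zero>\<^bsub>L\<^esub> = I"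
  by (simp add: L_quot quot_alg_simps)

lemma proj_zero [simp]: "proj \<zero> = \<zero>\<^bsub>L\<^esub>"
  by (simp add: L_zero proj_def I.a_subset)

lemma carrier_L: "carrier L = proj ` carrier R"
  by (simp add: L_quot quot_alg_carrier[OF I_ideal] proj_def[abs_def])

lemma proj_eq_iff: "f \<in> carrier R \<Longrightarrow> g \<in> carrier R \<Longrightarrow> proj f = proj g \<longleftrightarrow> f \<ominus> g \<in> I"
  using quotient_eq_iff_same_a_r_cos[OF I_ideal] by (simp add: proj_def)

lemma proj_eq_zero_iff: "f \<in> carrier R \<Longrightarrow> proj f = \<zero>\<^bsub>L\<^esub> \<longleftrightarrow> f \<in> I"
  using proj_eq_iff[of f \<zero>] by (simp add: a_minus_def)

lemma proj_mem_iff: "f \<in> carrier R \<Longrightarrow> g \<in> proj f \<longleftrightarrow> g \<in> carrier R \<and> proj g = proj f"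
  by (metis I.a_Hcarr I.a_repr_independence' I.a_repr_independenceD I.a_elemrcos_carrier proj_def)

lemma proj_finsum:
  assumes "finite F" "f \<in> F \<rightarrow> carrier R"
  shows "proj (finsum R f F) = (\<Oplus>\<^bsub>L\<^esub>i\<in>F. proj (f i))"
  using assms by (induction F) (auto simp: proj_add Pi_iff)

lemma path_class_eq: "path_class Q \<rho> p = proj (path_elt p)"
  by (simp only: path_class_def proj_def I_def flip: R_eq)

lemma bound_path_iff: "bound_path Q \<rho> p \<longleftrightarrow> p \<in> paths Q \<and> path_elt p \<notin> I"
  unfolding bound_path_def path_class_eq L_def[symmetric] using proj_eq_zero_iff[of "path_elt p"] by auto

lemma I_smult: "f \<in> I \<Longrightarrow> c \<odot> f \<in> I"
  by (rule ideal_smult[OF I_ideal])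

lemma I_smult_iff: "f \<in> carrier R \<Longrightarrow> c \<noteq> 0 \<Longrightarrow> c \<odot> f \<in> I \<longleftrightarrow> f \<in> I"
  using I_smult[of f c] I_smult[of "c \<odot> f" "1 / c"] by (auto simp flip: smult_assoc)

text \<open>Multiplication never lowers the degree, so the elements without components below degree
  2 form an ideal, and it contains the relations. Hence an element of \<open>\<Lambda>\<close> has
  at most one representative supported on arrows.\<close>

lemma I_comp_less_2:
  assumes "f \<in> I" "t < 2"
  shows "hcomp j t i f = \<zero>"
proof -
  let ?J = "{f \<in> carrier R. \<forall>j i. \<forall>t<2. hcomp j t i f = \<zero>}"
  have "ideal ?J R"
    by (rule ideal_pathI) (simp_all add: hcomp_add hcomp_smult hcomp_mult_l hcomp_mult_r mult_zero)
  moreover have "\<rho> \<subseteq> ?J"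
  proof
    fix r assume r: "r \<in> \<rho>"
    then have "2 \<le> plen p" if "r p \<noteq> 0" for p using that bound_quiver unfolding bound_quiver_def by blast
    then have "hcomp j t i r = \<zero>" if "t < 2" for j t i
      using that by (force simp: hcomp_def zero_eq fun_eq_iff)
    then show "r \<in> ?J" using r rel_in by auto
  qed
  ultimately have "I \<subseteq> ?J" by (rule I_minimal)
  then show ?thesis using assms by auto
qed

lemma I_plen:
  assumes "f \<in> I" "f p \<noteq> 0"
  shows "2 \<le> plen p"
proof (rule ccontr)
  assume "\<not> 2 \<le> plen p"
  then have "hcomp (ptgt p) (plen p) (psrc p) f p = 0"
    using I_comp_less_2[OF assms(1)] by (simp add: zero_eq)
  then show False using assms(2) by (simp add: hcomp_def)
qed

lemma graded_part_eq: "graded_part Q \<rho> t = {proj f | f. f \<in> carrier R \<and> (\<forall>p. f p \<noteq> 0 \<longrightarrow> plen p = t)}"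
  by (simp only: graded_part_def proj_def I_def flip: R_eq)

end

locale homogeneous_quiver_algebra = bound_quiver_algebra +
  assumes homogeneous: "homogeneous_relations \<rho>"
begin

text \<open>A component of a path times \<open>f\<close> is the path times a component of
  \<open>f\<close>, so the elements with all components in \<open>I\<close> form an ideal. A
  component of a homogeneous relation is either zero or obtained by multiplying with two vertex
  idempotents, hence lies in \<open>I\<close>.\<close>

lemma I_comp:
  assumes "f \<in> I"
  shows "hcomp j t i f \<in> I"
proof -
  let ?J = "{f \<in> carrier R. \<forall>j t i. hcomp j t i f \<in> I}"
  have "ideal ?J R"
    by (rule ideal_pathI)
      (simp_all add: hcomp_add hcomp_smult hcomp_mult_l hcomp_mult_r I_smult I.a_closed I.zero_closed
        I.I_l_closed I.I_r_closed)
  moreover have "\<rho> \<subseteq> ?J"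
  proof
    fix r assume r: "r \<in> \<rho>"
    have rR: "r \<in> carrier R" using r rel_in by auto
    have "hcomp j t i r \<in> I" for j t i
    proof (cases "j \<in> verts Q \<and> i \<in> verts Q \<and> (\<forall>p. r p \<noteq> 0 \<longrightarrow> plen p = t)")
      case True
      then have "hcomp j t i r = path_elt (vertex_path j) \<otimes> r \<otimes> path_elt (vertex_path i)"
      proof (intro ext)
        fix p
        have "r p = 0" if "plen p \<noteq> t" using True that by blast
        moreover have "path_elt (vertex_path j) \<otimes> r \<in> carrier R" using rR True by simp
        ultimately show "hcomp j t i r p
          = (path_elt (vertex_path j) \<otimes> r \<otimes> path_elt (vertex_path i)) p"
          using True rR by (simp add: mult_vertex, simp add: vertex_mult hcomp_def)
      qed
      also have "\<dots> \<in> I"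
        using r True rel_subset by (intro I.I_l_closed I.I_r_closed) auto
      finally show ?thesis .
    next
      case False
      have "r p = 0" if "ptgt p = j" "plen p = t" "psrc p = i" for p
      proof (rule ccontr)
        assume p: "r p \<noteq> 0"
        then have "p \<in> paths Q" using rR by (auto simp: carrier_iff)
        then have "j \<in> verts Q" "i \<in> verts Q" using that paths_verts[of p] by simp_all
        moreover have "plen q = t" if "r q \<noteq> 0" for q
          using homogeneous r p that \<open>plen p = t\<close> unfolding homogeneous_relations_def by metis
        ultimately show False using False by blast
      qed
      then have "hcomp j t i r = \<zero>" by (simp add: hcomp_def zero_eq fun_eq_iff)
      then show ?thesis by (simp add: I.zero_closed)
    qed
    then show "r \<in> ?J" using rR by blast
  qed
  ultimately have "I \<subseteq> ?J" by (rule I_minimal)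
  then show ?thesis using assms by auto
qed

lemma I_comp_iff: 
  assumes "f \<in> carrier R"
  shows "f \<in> I \<longleftrightarrow> (\<forall>j\<in>verts Q. \<forall>t. \<forall>i\<in>verts Q. hcomp j t i f \<in> I)"
proof
  assume "\<forall>j\<in>verts Q. \<forall>t. \<forall>i\<in>verts Q. hcomp j t i f \<in> I"
  then show "f \<in> I"
    by (intro hcomp_induct[OF assms, of "\<lambda>f. f \<in> I"]) (auto intro: I.zero_closed I.a_closed)
qed (use I_comp in blast)

end

section \<open>The Frobenius form\<close>

definition functional :: "('k::field, 'a) module \<Rightarrow> ('a \<Rightarrow> 'k) \<Rightarrow> bool" where
  "functional A g \<longleftrightarrow>
     (\<forall>x\<in>carrier A. \<forall>y\<in>carrier A. g (x \<oplus>\<^bsub>A\<^esub> y) = g x + g y) \<and>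
     (\<forall>c. \<forall>x\<in>carrier A. g (c \<odot>\<^bsub>A\<^esub> x) = c * g x)"

lemma functionalI:
  assumes "\<And>x y. x \<in> carrier A \<Longrightarrow> y \<in> carrier A \<Longrightarrow> g (x \<oplus>\<^bsub>A\<^esub> y) = g x + g y"
    and "\<And>c x. x \<in> carrier A \<Longrightarrow> g (c \<odot>\<^bsub>A\<^esub> x) = c * g x"
  shows "functional A g"
  using assms by (simp add: functional_def)

lemma functional_add:
  "functional A g \<Longrightarrow> x \<in> carrier A \<Longrightarrow> y \<in> carrier A \<Longrightarrow> g (x \<oplus>\<^bsub>A\<^esub> y) = g x + g y"
  and functional_smult: "functional A g \<Longrightarrow> x \<in> carrier A \<Longrightarrow> g (c \<odot>\<^bsub>A\<^esub> x) = c * g x"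
  by (simp_all add: functional_def)

context k_algebra
begin

lemma functional_zero: "functional A g \<Longrightarrow> g \<zero> = 0"
  using functional_smult[of A g \<zero> 0] by simp

lemma functional_minus: "functional A g \<Longrightarrow> x \<in> carrier A \<Longrightarrow> y \<in> carrier A \<Longrightarrow> g (x \<ominus> y) = g x - g y"
  by (simp add: a_minus_def functional_add functional_smult flip: smult_minus_one)

text \<open>Linear algebra of finitely many functions: \<open>g\<close> vanishes on the common
  kernel of the functions \<open>\<phi>(_ b)\<close>, hence is a combination of them. Linearity in
  \<open>b\<close> collects the combination into one \<open>y\<close>.\<close>

lemma functional_representable:
  assumes "functional A \<phi>" "finite F" "F \<subseteq> carrier A" "functional A g"
    and "\<And>x. x \<in> carrier A \<Longrightarrow> (\<And>b. b \<in> F \<Longrightarrow> \<phi> (x \<otimes> b) = 0) \<Longrightarrow> g x = 0"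
  shows "\<exists>y\<in>carrier A. \<forall>x\<in>carrier A. g x = \<phi> (x \<otimes> y)"
  using assms(2-5)
proof (induction F arbitrary: g)
  case empty
  then show ?case using functional_zero[OF assms(1)] by (intro bexI[of _ \<zero>]) auto
next
  case (insert b F)
  have b: "b \<in> carrier A" and F: "F \<subseteq> carrier A" using insert.prems(1) by auto
  show ?case
  proof (cases "\<exists>x\<in>carrier A. (\<forall>b\<in>F. \<phi> (x \<otimes> b) = 0) \<and> \<phi> (x \<otimes> b) \<noteq> 0")
    \<comment> \<open>Here \<open>\<phi>(_ b)\<close> already vanishes on the common kernel for
      \<open>F\<close>, so \<open>b\<close> adds no condition.\<close>
    case False
    show ?thesis
    proof (rule insert.IH[OF F insert.prems(2)])
      fix x assume x: "x \<in> carrier A" "\<And>b. b \<in> F \<Longrightarrow> \<phi> (x \<otimes> b) = 0"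
      then have "\<phi> (x \<otimes> b) = 0" using False by blast
      with x(2) show "g x = 0" by (intro insert.prems(3)[OF x(1)]) (elim insertE, simp_all)
    qed
  next
    case True
    then obtain x0 where x0: "x0 \<in> carrier A" "\<And>b. b \<in> F \<Longrightarrow> \<phi> (x0 \<otimes> b) = 0" "\<phi> (x0 \<otimes> b) \<noteq> 0"
      by blast
    \<comment> \<open>With this coefficient the corrected function \<open>g'\<close> vanishes at
      \<open>x0\<close>, which makes it satisfy the hypothesis for \<open>F\<close> alone.\<close>
    define c where "c = g x0 / \<phi> (x0 \<otimes> b)"
    define g' where "g' x = g x - c * \<phi> (x \<otimes> b)" for x
    have g': "functional A g'"
      using insert.prems(2) assms(1) b
      by (intro functionalI) (simp_all add: g'_def functional_add functional_smult l_distr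
          smult_mult_l algebra_simps)
    have "g' x = 0" if x: "x \<in> carrier A" and 0: "\<And>b. b \<in> F \<Longrightarrow> \<phi> (x \<otimes> b) = 0" for x
    proof -
      \<comment> \<open>Subtracting \<open>d \<odot> x0\<close> moves \<open>x\<close> into the
        kernel of \<open>\<phi>(_ b)\<close> without leaving the kernels for
        \<open>F\<close>.\<close>
      define d where "d = \<phi> (x \<otimes> b) / \<phi> (x0 \<otimes> b)"
      let ?x = "x \<ominus> d \<odot> x0"
      have *: "\<phi> (?x \<otimes> b') = \<phi> (x \<otimes> b') - d * \<phi> (x0 \<otimes> b')" if "b' \<in> carrier A" for b'
        using that x x0(1) assms(1)
        by (simp add: a_minus_def l_distr l_minus smult_mult_l functional_add functional_smult
            flip: smult_minus_one)
      have "g ?x = 0"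
      proof (rule insert.prems(3))
        show "\<phi> (?x \<otimes> b') = 0" if "b' \<in> insert b F" for b'
        proof (cases "b' = b")
          case True
          then show ?thesis using *[OF b] x0(3) by (simp add: d_def)
        next
          case False
          then have "b' \<in> F" using that by simp
          then show ?thesis using *[of b'] F 0[of b'] x0(2)[of b'] by (simp add: subset_iff)
        qed
      qed (use x x0 in simp)
      then have "g x = d * g x0"
        using insert.prems(2) x x0(1) by (simp add: functional_minus functional_smult)
      then show ?thesis using x0(3) by (simp add: g'_def c_def d_def)
    qed
    then obtain y where y: "y \<in> carrier A" "\<forall>x\<in>carrier A. g' x = \<phi> (x \<otimes> y)"
      using insert.IH[OF F g'] by metis
    have "g x = \<phi> (x \<otimes> (y \<oplus> c \<odot> b))" if "x \<in> carrier A" for x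
      using that y b assms(1)
      by (simp add: r_distr smult_mult_r functional_add functional_smult bspec[OF y(2), symmetric])
        (simp add: g'_def)
    then show ?thesis using y(1) b by (intro bexI[of _ "y \<oplus> c \<odot> b"]) simp_all
  qed
qed

end

lemma (in quiver_algebra) hcomp_mult_comp_l:
  assumes "f \<in> carrier R" "g \<in> carrier R"
  shows "hcomp j t k (hcomp j' s i f \<otimes> g) =
    (if j = j' \<and> s \<le> t then hcomp j' s i f \<otimes> hcomp i (t - s) k g else \<zero>)"
  using assms(1)
  by (induction f rule: span_induct)
    (use assms(2) in \<open>auto simp: mult_zero mult_add_l mult_smult_l hcomp_add hcomp_smult hcomp_path_elt hcomp_mult_l\<close>)

lemma (in quiver_algebra) hcomp_mult_comp_r:
  assumes "f \<in> carrier R" "g \<in> carrier R"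
  shows "hcomp j t k (g \<otimes> hcomp i s k' f) =
    (if k = k' \<and> s \<le> t then hcomp j (t - s) i g \<otimes> hcomp i s k' f else \<zero>)"
  using assms(1)
  by (induction f rule: span_induct)
    (use assms(2) in \<open>auto simp: mult_zero mult_add_r mult_smult_r hcomp_add hcomp_smult hcomp_path_elt hcomp_mult_r\<close>)

lemma (in quiver_algebra) vertex_mult_comp:
  assumes "j \<in> verts Q" "f \<in> carrier R" "hcomp j t i f = f"
  shows "path_elt (vertex_path j) \<otimes> f = f"
proof
  show "(path_elt (vertex_path j) \<otimes> f) p = f p" for p
    using fun_cong[OF assms(3), of p] assms(1,2) by (simp add: vertex_mult hcomp_def split: if_splits)
qed

lemma (in quiver_algebra) mult_vertex_comp:
  assumes "i \<in> verts Q" "f \<in> carrier R" "hcomp j t i f = f"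
  shows "f \<otimes> path_elt (vertex_path i) = f"
proof
  show "(f \<otimes> path_elt (vertex_path i)) p = f p" for p
    using fun_cong[OF assms(3), of p] assms(1,2) by (simp add: mult_vertex hcomp_def split: if_splits)
qed

text \<open>Stability determines the top degree:
  \<open>e\<^sub>j \<Lambda>\<^sub>l e\<^sub>i\<close> is nonzero only for
  \<open>i = \<tau> j\<close> and then one-dimensional. Self-injectivity provides factorisations,
  and its grading clause bounds the degrees by \<open>l\<close>.\<close>

locale stable_quiver_algebra = homogeneous_quiver_algebra Q R \<rho>
  for Q :: "('v, 'e) pre_digraph" and R :: "('k::field, ('v, 'e) qpath \<Rightarrow> 'k) module" (structure)
    and \<rho> :: "(('v, 'e) qpath \<Rightarrow> 'k) set" +
  fixes \<tau> :: "'v \<Rightarrow> 'v" and l :: nat and B :: "('v, 'e) qpath set" and pm :: "'v \<Rightarrow> ('v, 'e) qpath"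
  assumes l_pos: "l \<ge> 1"
    and stable: "stable_bound_quiver Q \<rho> \<tau> l"
    and self_inj: "graded_self_injective Q \<rho> l"
    and basis: "bound_path_basis Q \<rho> B"
    and pm: "\<And>i. i \<in> verts Q \<Longrightarrow>
      pm i \<in> B \<and> maximal_bound_path Q \<rho> (pm i) \<and> psrc (pm i) = \<tau> i \<and> ptgt (pm i) = i"
begin

lemma tau_bij: "bij_betw \<tau> (verts Q) (verts Q)"
  using stable by (simp add: stable_bound_quiver_def)

lemma tau_in [simp]: "i \<in> verts Q \<Longrightarrow> \<tau> i \<in> verts Q"
  using tau_bij by (auto simp: bij_betw_def)

lemma tau_inj: "i \<in> verts Q \<Longrightarrow> j \<in> verts Q \<Longrightarrow> \<tau> i = \<tau> j \<longleftrightarrow> i = j"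
  using tau_bij by (auto simp: bij_betw_def inj_on_def)

lemma tau_surj: "i \<in> verts Q \<Longrightarrow> \<exists>j\<in>verts Q. i = \<tau> j"
  using tau_bij by (auto simp: bij_betw_def)

lemma pm_simps [simp]:
  assumes "i \<in> verts Q"
  shows "pm i \<in> B" "pm i \<in> paths Q" "path_elt (pm i) \<notin> I" "psrc (pm i) = \<tau> i" "ptgt (pm i) = i"
    "plen (pm i) = l"
proof -
  show "pm i \<in> B" "psrc (pm i) = \<tau> i" "ptgt (pm i) = i" using pm[OF assms] by simp_all
  have "bound_path Q \<rho> (pm i)" using pm[OF assms] unfolding maximal_bound_path_def by blast
  then show "pm i \<in> paths Q" "path_elt (pm i) \<notin> I" by (simp_all add: bound_path_iff)
  show "plen (pm i) = l" using pm[OF assms] stable unfolding stable_bound_quiver_def by blast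
qed

section \<open>The top degree of a stable bound quiver algebra\<close>

lemma long_path: "p \<in> paths Q \<Longrightarrow> l < plen p \<Longrightarrow> path_elt p \<in> I"
proof -
  assume p: "p \<in> paths Q" "l < plen p"
  have "\<not> graded_part Q \<rho> (plen p) \<noteq> {\<zero>\<^bsub>L\<^esub>}"
    using self_inj p(2) unfolding graded_self_injective_def L_def[symmetric] by (metis not_le)
  moreover have "proj (path_elt p) \<in> graded_part Q \<rho> (plen p)"
    unfolding graded_part_eq using path_elt_in[OF p(1)]
    by (intro CollectI exI[of _ "path_elt p"]) (simp add: path_elt_def)
  ultimately show "path_elt p \<in> I" using p(1) by (simp add: proj_eq_zero_iff)
qed

lemma hcomp_high:
  assumes "f \<in> carrier R" "l < t"
  shows "hcomp j t i f \<in> I"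
  using assms(1)
  by (induction f rule: span_induct)
    (use assms(2) in \<open>auto simp: hcomp_add hcomp_smult hcomp_path_elt long_path intro: I.zero_closed I.a_closed I_smult\<close>)

text \<open>A proper extension would be longer than \<open>l\<close>, where the algebra vanishes.
  Needed because linear dependence is postulated for maximal bound paths.\<close>

lemma bound_path_maximal:
  assumes "bound_path Q \<rho> p" "plen p = l"
  shows "maximal_bound_path Q \<rho> p"
  unfolding maximal_bound_path_def
proof (intro conjI ballI impI assms(1))
  fix q r assume qr: "q \<in> paths Q" "r \<in> paths Q"
    and *: "psrc q = ptgt p \<and> ptgt r = psrc p \<and> bound_path Q \<rho> (pcomp q (pcomp p r))"
  then have "plen (pcomp q (pcomp p r)) \<le> l"
    using long_path[of "pcomp q (pcomp p r)"] unfolding bound_path_iff by (meson not_le)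
  then have "plen q = 0" "plen r = 0" using assms(2) by auto
  then have "q = vertex_path (ptgt p)" "r = vertex_path (psrc p)"
    using plen_0_vertex_path qr * by (metis vertex_path_simps(2))+
  then show "pcomp q (pcomp p r) = p" by (simp add: pcomp_vertex_path)
qed

lemma top_path_end:
  assumes "p \<in> paths Q" "plen p = l" "i \<in> verts Q" "psrc p = \<tau> i" "ptgt p \<noteq> i"
  shows "path_elt p \<in> I"
proof (rule ccontr)
  assume "path_elt p \<notin> I"
  then have "bound_path Q \<rho> p" using assms(1) by (simp add: bound_path_iff)
  moreover have "ptgt p \<in> verts Q" using assms(1) paths_verts by blast
  ultimately show False
    using stable assms(2-5) unfolding stable_bound_quiver_def by blast
qed

lemma hcomp_top_end:
  assumes "f \<in> carrier R" "i \<in> verts Q" "j \<noteq> i"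
  shows "hcomp j l (\<tau> i) f \<in> I"
  using assms(1)
  by (induction f rule: span_induct)
    (use assms(2,3) in \<open>auto simp: hcomp_add hcomp_smult hcomp_path_elt top_path_end intro: I.zero_closed I.a_closed I_smult\<close>)

text \<open>The dependence relation \<open>a p + b p\<^sub>i = 0\<close> can be solved for
  \<open>p\<close>: if \<open>a = 0\<close>, then \<open>b p\<^sub>i = 0\<close> with
  \<open>p\<^sub>i\<close> nonzero in \<open>\<Lambda>\<close>, so \<open>b = 0\<close> as
  well.\<close>

lemma top_path_dependent:
  assumes "p \<in> paths Q" "plen p = l" "i \<in> verts Q" "psrc p = \<tau> i"
  shows "\<exists>c. proj (path_elt p) = c \<odot>\<^bsub>L\<^esub> proj (path_elt (pm i))"
proof (cases "path_elt p \<in> I")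
  case True
  then have "proj (path_elt p) = 0 \<odot>\<^bsub>L\<^esub> proj (path_elt (pm i))"
    using assms by (simp add: proj_eq_zero_iff)
  then show ?thesis by blast
next
  case False
  let ?p = "proj (path_elt p)" and ?m = "proj (path_elt (pm i))"
  have "maximal_bound_path Q \<rho> p" using False assms by (intro bound_path_maximal) (simp_all add: bound_path_iff)
  then have "lin_dependent L ?p ?m"
    using stable pm[OF assms(3)] assms(4)
    unfolding stable_bound_quiver_def path_class_eq L_def by metis
  then obtain a b where ab: "a \<noteq> 0 \<or> b \<noteq> 0" "a \<odot>\<^bsub>L\<^esub> ?p \<oplus>\<^bsub>L\<^esub> b \<odot>\<^bsub>L\<^esub> ?m = \<zero>\<^bsub>L\<^esub>"
    unfolding lin_dependent_def by blast
  have in_L: "?p \<in> carrier L" "?m \<in> carrier L" using assms by auto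
  have "a \<noteq> 0"
  proof
    assume "a = 0"
    then have "b \<odot>\<^bsub>L\<^esub> ?m = 0 \<odot>\<^bsub>L\<^esub> ?m" using ab(2) in_L by simp
    moreover have "?m \<noteq> \<zero>\<^bsub>L\<^esub>" using assms by (simp add: proj_eq_zero_iff)
    ultimately have "b = 0" using in_L(2) L.smult_cancel by blast
    then show False using ab(1) \<open>a = 0\<close> by simp
  qed
  have "a \<odot>\<^bsub>L\<^esub> ?p = (- b) \<odot>\<^bsub>L\<^esub> ?m"
  proof -
    have "(- b) \<odot>\<^bsub>L\<^esub> ?m = \<ominus>\<^bsub>L\<^esub> (b \<odot>\<^bsub>L\<^esub> ?m)"
      using in_L by (simp flip: L.smult_minus_one L.smult_assoc)
    then show ?thesis using ab(2) in_L by (simp add: L.minus_equality)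
  qed
  then have "(1 / a) \<odot>\<^bsub>L\<^esub> (a \<odot>\<^bsub>L\<^esub> ?p) = (1 / a) \<odot>\<^bsub>L\<^esub> ((- b) \<odot>\<^bsub>L\<^esub> ?m)" by simp
  then have "?p = (1 / a * (- b)) \<odot>\<^bsub>L\<^esub> ?m"
    using in_L \<open>a \<noteq> 0\<close> by (simp flip: L.smult_assoc)
  then show ?thesis by blast
qed

section \<open>Coordinates in the basis of bound paths and the function
  \<open>\<phi>\<close>\<close>

definition rep :: "(('v, 'e) qpath \<Rightarrow> 'k) \<Rightarrow> (('v, 'e) qpath \<Rightarrow> 'k)" where
  "rep f = (THE g. g \<in> proj f \<and> (\<forall>p. g p \<noteq> 0 \<longrightarrow> p \<in> B))"

lemma rep_ex1:
  assumes "f \<in> carrier R"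
  shows "\<exists>!g. g \<in> proj f \<and> (\<forall>p. g p \<noteq> 0 \<longrightarrow> p \<in> B)"
  using basis proj_in[OF assms] unfolding bound_path_basis_def L_def by blast

lemma rep_props:
  assumes "f \<in> carrier R"
  shows "rep f \<in> carrier R" "proj (rep f) = proj f" "rep f p \<noteq> 0 \<Longrightarrow> p \<in> B"
  using theI'[OF rep_ex1[OF assms]] proj_mem_iff[OF assms] unfolding rep_def[symmetric] by blast+

lemma rep_eqI:
  assumes "f \<in> carrier R" "g \<in> carrier R" "proj g = proj f" "\<And>p. g p \<noteq> 0 \<Longrightarrow> p \<in> B"
  shows "rep f = g"
  unfolding rep_def by (rule the1_equality[OF rep_ex1[OF assms(1)]]) (use assms proj_mem_iff in blast)

lemma rep_add: "f \<in> carrier R \<Longrightarrow> g \<in> carrier R \<Longrightarrow> rep (f \<oplus> g) = rep f \<oplus> rep g"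
proof (rule rep_eqI)
  assume *: "f \<in> carrier R" "g \<in> carrier R"
  show "p \<in> B" if "(rep f \<oplus> rep g) p \<noteq> 0" for p
    using that rep_props(3)[OF *(1), of p] rep_props(3)[OF *(2), of p]
    by (cases "rep f p = 0") (simp_all add: add_eq)
qed (simp_all add: rep_props(1,2) proj_add)

lemma rep_smult: "f \<in> carrier R \<Longrightarrow> rep (c \<odot> f) = c \<odot> rep f"
proof (rule rep_eqI)
  assume *: "f \<in> carrier R"
  show "p \<in> B" if "(c \<odot> rep f) p \<noteq> 0" for p
    using that rep_props(3)[OF *, of p] by (simp add: smult_eq)
qed (simp_all add: rep_props(1,2) proj_smult)

lemma proj_comp_cong:
  assumes "f \<in> carrier R" "g \<in> carrier R" "proj f = proj g"
  shows "proj (hcomp j t i f) = proj (hcomp j t i g)"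
proof -
  have "f \<ominus> g \<in> I" using assms by (simp add: proj_eq_iff)
  then have "hcomp j t i (f \<ominus> g) \<in> I" by (rule I_comp)
  moreover have "hcomp j t i (f \<ominus> g) = hcomp j t i f \<ominus> hcomp j t i g"
    using assms by (simp add: a_minus_def hcomp_add hcomp_smult flip: smult_minus_one)
  ultimately show ?thesis using assms by (simp add: proj_eq_iff)
qed

text \<open>Restricting the support of a combination of paths in \<open>B\<close> cannot leave
  \<open>B\<close>. This uses that the basis consists of paths, which makes it compatible with the
  grading.\<close>

lemma rep_comp: "f \<in> carrier R \<Longrightarrow> rep (hcomp j t i f) = hcomp j t i (rep f)"
proof (rule rep_eqI)
  assume *: "f \<in> carrier R"
  show "p \<in> B" if "hcomp j t i (rep f) p \<noteq> 0" for p
    using that rep_props(3)[OF *, of p] by (cases "rep f p = 0") (simp_all add: hcomp_def split: if_splits)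
  show "proj (hcomp j t i (rep f)) = proj (hcomp j t i f)"
    using * by (intro proj_comp_cong) (simp_all add: rep_props)
qed (simp_all add: rep_props)

text \<open>The dual basis function \<open>p\<^sub>i\<^sup>*\<close> pulled back along the
  projection from \<open>kQ\<close> to \<open>\<Lambda>\<close>.\<close>

definition coord :: "'v \<Rightarrow> (('v, 'e) qpath \<Rightarrow> 'k) \<Rightarrow> 'k" where
  "coord i f = rep f (pm i)"

lemma dual_basis_elt_proj: "f \<in> carrier R \<Longrightarrow> dual_basis_elt Q \<rho> B (pm i) (proj f) = coord i f"
  using proj_in[of f] by (simp add: dual_basis_elt_def coord_def rep_def L_def)

lemma coord_cong: "proj f = proj g \<Longrightarrow> coord i f = coord i g"
  by (simp add: coord_def rep_def)

lemma coord_functional: "functional R (coord i)"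
  by (rule functionalI) (simp_all add: coord_def rep_add rep_smult, simp_all add: add_eq smult_eq)

lemma coord_comp:
  assumes "f \<in> carrier R" "i \<in> verts Q"
  shows "coord i (hcomp i l (\<tau> i) f) = coord i f"
  unfolding coord_def rep_comp[OF assms(1)] using assms(2) by (simp add: hcomp_def)

lemma coord_I: "f \<in> I \<Longrightarrow> coord i f = 0"
  using coord_cong[of f \<zero> i] functional_zero[OF coord_functional[of i]]
  by (simp add: proj_eq_zero_iff[THEN iffD2])

lemma coord_pm: "i \<in> verts Q \<Longrightarrow> coord i (path_elt (pm i)) = 1"
  unfolding coord_def
  by (subst rep_eqI[of _ "path_elt (pm i)"]) (simp_all, simp add: path_elt_def split: if_splits)

text \<open>One-dimensionality makes the component in
  \<open>e\<^sub>i \<Lambda>\<^sub>l e\<^sub>\<tau>\<^sub>i\<close> a multiple of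
  \<open>p\<^sub>i\<close>, and applying \<open>coord\<close> reads off the factor. This links the
  dual basis function with \<open>eta\<close> and shows that \<open>coord i\<close> depends on
  \<open>B\<close> only through \<open>pm i\<close>.\<close>

lemma proj_comp_top:
  assumes "f \<in> carrier R" "i \<in> verts Q"
  shows "proj (hcomp i l (\<tau> i) f) = coord i f \<odot>\<^bsub>L\<^esub> proj (path_elt (pm i))"
  using assms(1)
proof (induction f rule: span_induct)
  case zero
  then show ?case using assms(2) by (simp add: functional_zero[OF coord_functional])
next
  case (add f g)
  then show ?case using assms(2)
    by (simp add: hcomp_add proj_add functional_add[OF coord_functional] L.smult_l_distr)
next
  case (smult c f)
  then show ?case using assms(2)
    by (simp add: hcomp_smult proj_smult functional_smult[OF coord_functional] L.smult_assoc)
next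
  case (path p)
  show ?case
  proof (cases "ptgt p = i \<and> plen p = l \<and> psrc p = \<tau> i")
    case True
    then obtain c where "proj (path_elt p) = c \<odot>\<^bsub>L\<^esub> proj (path_elt (pm i))"
      using top_path_dependent[OF path] assms(2) by blast
    then have c: "proj (path_elt p) = proj (c \<odot> path_elt (pm i))" using assms(2) by (simp add: proj_smult)
    have "coord i (path_elt p) = c"
      unfolding coord_cong[OF c] using assms(2)
      by (simp add: functional_smult[OF coord_functional] coord_pm)
    then show ?thesis using True c assms(2) by (simp add: hcomp_path_elt proj_smult)
  next
    case False
    then have "hcomp i l (\<tau> i) (path_elt p) = \<zero>" by (auto simp: hcomp_path_elt)
    moreover from this have "coord i (path_elt p) = 0"
      using coord_comp[of "path_elt p" i] path assms(2) functional_zero[OF coord_functional[of i]] by simp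
    ultimately show ?thesis using assms(2) by simp
  qed
qed

lemma coord_eq_0_iff:
  assumes "f \<in> carrier R" "i \<in> verts Q"
  shows "coord i f = 0 \<longleftrightarrow> hcomp i l (\<tau> i) f \<in> I"
proof
  assume "coord i f = 0"
  then show "hcomp i l (\<tau> i) f \<in> I"
    using proj_comp_top[OF assms] assms by (simp add: proj_eq_zero_iff)
next
  assume "hcomp i l (\<tau> i) f \<in> I"
  then show "coord i f = 0" using coord_I[of _ i] coord_comp[OF assms] by metis
qed

definition phi :: "(('v, 'e) qpath \<Rightarrow> 'k) \<Rightarrow> 'k" where
  "phi f = (\<Sum>i\<in>verts Q. coord i f)"

lemma phi_functional: "functional R phi"
  by (rule functionalI) (simp_all add: phi_def functional_add[OF coord_functional]
      functional_smult[OF coord_functional] sum.distrib sum_distrib_left)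

lemma phi_I: "f \<in> I \<Longrightarrow> phi f = 0"
  by (simp add: phi_def coord_I)

lemma phi_eq_coord:
  assumes "f \<in> carrier R" "k \<in> verts Q"
    and "\<And>i. i \<in> verts Q \<Longrightarrow> i \<noteq> k \<Longrightarrow> hcomp i l (\<tau> i) f = \<zero>"
  shows "phi f = coord k f"
proof -
  have "coord i f = 0" if "i \<in> verts Q" "i \<noteq> k" for i
    using coord_comp[OF assms(1) that(1)] assms(3)[OF that] functional_zero[OF coord_functional[of i]]
    by simp
  then have "phi f = (\<Sum>i\<in>verts Q. if i = k then coord k f else 0)"
    unfolding phi_def by (intro sum.cong) auto
  then show ?thesis using assms(2) by simp
qed

section \<open>Multiplying nonzero elements into the top degree\<close>

lemma self_injective_factor:
  assumes "f \<in> carrier R" "g \<in> carrier R"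
    and "\<And>x. x \<in> carrier R \<Longrightarrow> x \<otimes> f \<in> I \<Longrightarrow> x \<otimes> g \<in> I"
  shows "\<exists>z\<in>carrier R. proj g = proj (f \<otimes> z)"
proof -
  have "\<exists>z\<in>carrier L. proj g = proj f \<otimes>\<^bsub>L\<^esub> z"
  proof (rule L.self_injective_right_factor)
    show "self_injective L" using self_inj by (simp add: graded_self_injective_def L_def)
    show "x \<otimes>\<^bsub>L\<^esub> proj g = \<zero>\<^bsub>L\<^esub>" if x: "x \<in> carrier L" "x \<otimes>\<^bsub>L\<^esub> proj f = \<zero>\<^bsub>L\<^esub>" for x
    proof -
      obtain y where y: "y \<in> carrier R" "x = proj y" using x(1) by (auto simp: carrier_L)
      then show ?thesis using assms x(2) by (simp add: proj_eq_zero_iff flip: proj_mult)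
    qed
  qed (use assms in auto)
  then show ?thesis using assms(1) by (auto simp: carrier_L proj_mult)
qed

text \<open>A path of positive length starting at \<open>j\<close> has an arrow starting at
  \<open>j\<close> as its rightmost factor and kills \<open>f\<close>; a path starting elsewhere
  meets the wrong idempotent. So left multiplication by \<open>x\<close> sees only the coefficient
  of \<open>x\<close> at the trivial path \<open>e\<^sub>j\<close>.\<close>

lemma mult_l_killed:
  assumes f: "f \<in> carrier R" "hcomp j t i f = f" and j: "j \<in> verts Q"
    and killed: "\<And>a. a \<in> arcs Q \<Longrightarrow> tail Q a = j \<Longrightarrow> path_elt (arrow_path Q a) \<otimes> f \<in> I"
    and x: "x \<in> carrier R"
  shows "proj (x \<otimes> f) = x (vertex_path j) \<odot>\<^bsub>L\<^esub> proj f"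
  using x
proof (induction x rule: span_induct)
  case zero
  then show ?case using f by (simp add: mult_zero, simp add: zero_eq)
next
  case (add g h)
  then show ?case using f
    by (simp add: mult_add_l proj_add) (simp add: add_eq L.smult_l_distr)
next
  case (smult c g)
  then show ?case using f
    by (simp add: mult_smult_l proj_smult) (simp add: smult_eq L.smult_assoc)
next
  case (path p)
  show ?case
  proof (cases "psrc p = j")
    case False
    have "path_elt p \<otimes> f = (path_elt p \<otimes> path_elt (vertex_path j)) \<otimes> f"
      using f j path by (simp add: m_assoc vertex_mult_comp)
    also have "\<dots> = \<zero>" using f j False path by (simp add: path_elt_mult mult_zero)
    finally have "path_elt p \<otimes> f = \<zero>" .
    moreover have "(path_elt p :: _ \<Rightarrow> 'k) (vertex_path j) = 0" using False by (auto simp: path_elt_def)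
    ultimately show ?thesis using f by simp
  next
    case True
    show ?thesis
    proof (cases "plen p = 0")
      case True
      then have p: "p = vertex_path j" using plen_0_vertex_path[OF path] \<open>psrc p = j\<close> by simp
      have "path_elt p \<otimes> f = f" unfolding p by (rule vertex_mult_comp[OF j f])
      moreover have "(path_elt p :: _ \<Rightarrow> 'k) (vertex_path j) = 1" by (simp add: p)
      ultimately show ?thesis using f by simp
    next
      case pos: False
      then obtain a p' where a: "a \<in> arcs Q" "p' \<in> paths Q" "psrc p' = head Q a"
        "p = pcomp p' (arrow_path Q a)" using path_first_arrow[OF path] by metis
      then have "path_elt p = path_elt p' \<otimes> path_elt (arrow_path Q a)"
        by (simp add: path_elt_mult)
      then have "path_elt p \<otimes> f = path_elt p' \<otimes> (path_elt (arrow_path Q a) \<otimes> f)"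
        using a f by (simp add: m_assoc)
      also have "\<dots> \<in> I" using a True by (intro I.I_l_closed killed) auto
      finally have "path_elt p \<otimes> f \<in> I" .
      moreover have "(path_elt p :: _ \<Rightarrow> 'k) (vertex_path j) = 0" using pos by (auto simp: path_elt_def)
      ultimately show ?thesis using f path by (simp add: proj_eq_zero_iff[THEN iffD2])
    qed
  qed
qed


lemma mult_r_killed:
  assumes f: "f \<in> carrier R" "hcomp j t i f = f" and i: "i \<in> verts Q"
    and killed: "\<And>a. a \<in> arcs Q \<Longrightarrow> head Q a = i \<Longrightarrow> f \<otimes> path_elt (arrow_path Q a) \<in> I"
    and x: "x \<in> carrier R"
  shows "proj (f \<otimes> x) = x (vertex_path i) \<odot>\<^bsub>L\<^esub> proj f"
  using x
proof (induction x rule: span_induct)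
  case zero
  then show ?case using f by (simp add: mult_zero, simp add: zero_eq)
next
  case (add g h)
  then show ?case using f
    by (simp add: mult_add_r proj_add) (simp add: add_eq L.smult_l_distr)
next
  case (smult c g)
  then show ?case using f
    by (simp add: mult_smult_r proj_smult) (simp add: smult_eq L.smult_assoc)
next
  case (path p)
  show ?case
  proof (cases "ptgt p = i")
    case False
    have "f \<otimes> path_elt p = f \<otimes> (path_elt (vertex_path i) \<otimes> path_elt p)"
      using f i path by (simp add: mult_vertex_comp flip: m_assoc)
    also have "\<dots> = \<zero>" using f i False path by (simp add: path_elt_mult mult_zero)
    finally have "f \<otimes> path_elt p = \<zero>" .
    moreover have "(path_elt p :: _ \<Rightarrow> 'k) (vertex_path i) = 0" using False by (auto simp: path_elt_def)
    ultimately show ?thesis using f by simp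
  next
    case True
    show ?thesis
    proof (cases "plen p = 0")
      case True
      then have p: "p = vertex_path i"
        using plen_0_vertex_path[OF path] \<open>ptgt p = i\<close> by (metis vertex_path_simps(2))
      have "f \<otimes> path_elt p = f" unfolding p by (rule mult_vertex_comp[OF i f])
      moreover have "(path_elt p :: _ \<Rightarrow> 'k) (vertex_path i) = 1" by (simp add: p)
      ultimately show ?thesis using f by simp
    next
      case pos: False
      then obtain a p' where a: "a \<in> arcs Q" "p' \<in> paths Q" "ptgt p' = tail Q a"
        "p = pcomp (arrow_path Q a) p'" using path_last_arrow[OF path] by metis
      then have "path_elt p = path_elt (arrow_path Q a) \<otimes> path_elt p'"
        by (simp add: path_elt_mult)
      then have "f \<otimes> path_elt p = (f \<otimes> path_elt (arrow_path Q a)) \<otimes> path_elt p'"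
        using a f by (simp add: m_assoc)
      also have "\<dots> \<in> I" using a True by (intro I.I_r_closed killed) auto
      finally have "f \<otimes> path_elt p \<in> I" .
      moreover have "(path_elt p :: _ \<Rightarrow> 'k) (vertex_path i) = 0" using pos by (auto simp: path_elt_def)
      ultimately show ?thesis using f path by (simp add: proj_eq_zero_iff[THEN iffD2])
    qed
  qed
qed

text \<open>Without any assumption that arrows kill \<open>f\<close>: only a multiple of
  \<open>e\<^sub>j\<close> returns \<open>f\<close> to its own degree and ends, so the coefficient
  of \<open>x\<close> at \<open>e\<^sub>j\<close> can be recovered from
  \<open>x \<otimes> f\<close>.\<close>

lemma hcomp_self_mult:
  assumes "f \<in> carrier R" "hcomp j t i f = f" "j \<in> verts Q" "x \<in> carrier R"
  shows "hcomp j t i (x \<otimes> f) = x (vertex_path j) \<odot> f"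
  using assms(4)
proof (induction x rule: span_induct)
  case zero
  then show ?case using assms(1) by (simp add: mult_zero, simp add: zero_eq)
next
  case (add g h)
  then show ?case using assms(1)
    by (simp add: mult_add_l hcomp_add) (simp add: add_eq smult_l_distr distrib_right smult_eq)
next
  case (smult c g)
  then show ?case using assms(1)
    by (simp add: mult_smult_l hcomp_smult) (simp add: smult_eq mult.assoc)
next
  case (path p)
  have hcomp: "hcomp k s i f = (if k = j \<and> s = t then f else \<zero>)" for k s
    using hcomp_comp[of k s i j t i f] assms(2) by (cases "k = j \<and> s = t") auto
  show ?case
  proof (cases "psrc p = j \<and> ptgt p = j \<and> plen p = 0")
    case True
    then have "p = vertex_path j" using plen_0_vertex_path[OF path] by simp
    then show ?thesis using assms by (simp add: vertex_mult_comp)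
  next
    case False
    then have "(path_elt p :: _ \<Rightarrow> 'k) (vertex_path j) = 0" by (auto simp: path_elt_def)
    then show ?thesis using False assms(1) path
      by (auto simp: hcomp_mult_l hcomp mult_zero)
  qed
qed

lemma hcomp_pm: "i \<in> verts Q \<Longrightarrow> hcomp i l (\<tau> i) (path_elt (pm i)) = path_elt (pm i)"
  by (simp add: hcomp_path_elt)

lemma mult_pm:
  assumes "j \<in> verts Q" "x \<in> carrier R"
  shows "proj (x \<otimes> path_elt (pm j)) = x (vertex_path j) \<odot>\<^bsub>L\<^esub> proj (path_elt (pm j))"
proof (rule mult_l_killed[OF _ hcomp_pm])
  fix a assume "a \<in> arcs Q" "tail Q a = j"
  then show "path_elt (arrow_path Q a) \<otimes> path_elt (pm j) \<in> I"
    using assms by (simp add: path_elt_mult long_path)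
qed (use assms in auto)

lemma proj_smult_eq_0:
  assumes "f \<in> carrier R" "f \<notin> I" "c \<odot>\<^bsub>L\<^esub> proj f = \<zero>\<^bsub>L\<^esub>"
  shows "c = 0"
  using assms I_smult_iff[of f c] by (auto simp: proj_eq_zero_iff simp flip: proj_smult)

text \<open>If all arrows kill \<open>f \<in> e\<^sub>j \<Lambda>\<^sub>t e\<^sub>i\<close> from the left, then \<open>f\<close> and the maximal path
  \<open>p\<^sub>j\<close> have the same left annihilator, so self-injectivity gives \<open>f \<in> p\<^sub>j \<Lambda>\<close>, whence \<open>t \<ge> l\<close>.\<close>

lemma extend_left_arrow:
  assumes f: "f \<in> carrier R" "hcomp j t i f = f" "f \<notin> I" and j: "j \<in> verts Q" and t: "t < l"
  shows "\<exists>a\<in>arcs Q. tail Q a = j \<and> path_elt (arrow_path Q a) \<otimes> f \<notin> I"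
proof (rule ccontr)
  assume "\<not> ?thesis"
  then have killed: "proj (x \<otimes> f) = x (vertex_path j) \<odot>\<^bsub>L\<^esub> proj f" if "x \<in> carrier R" for x
    using mult_l_killed[OF f(1,2) j _ that] by blast
  let ?m = "path_elt (pm j) :: _ \<Rightarrow> 'k"
  have "x \<otimes> f \<in> I" if x: "x \<in> carrier R" "x \<otimes> ?m \<in> I" for x
  proof -
    have "proj (x \<otimes> ?m) = \<zero>\<^bsub>L\<^esub>" using x j by (simp add: proj_eq_zero_iff)
    then have "x (vertex_path j) \<odot>\<^bsub>L\<^esub> proj ?m = \<zero>\<^bsub>L\<^esub>" using mult_pm[OF j x(1)] by simp
    then have "x (vertex_path j) = 0" using j by (intro proj_smult_eq_0) auto
    then have "proj (x \<otimes> f) = \<zero>\<^bsub>L\<^esub>" using killed[OF x(1)] f(1) by simp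
    then show ?thesis using x f(1) by (simp add: proj_eq_zero_iff)
  qed
  then obtain z where z: "z \<in> carrier R" "proj f = proj (?m \<otimes> z)"
    using self_injective_factor[of ?m f] f(1) j by auto
  then have "proj f = proj (hcomp j t i (?m \<otimes> z))"
    using proj_comp_cong[of f "?m \<otimes> z" j t i] f j by simp
  also have "hcomp j t i (?m \<otimes> z) = \<zero>"
    using hcomp_mult_l[of "pm j" z j t i] z j t by simp
  finally show False using f by (simp add: proj_eq_zero_iff)
qed

text \<open>Not the mirror image of the left version, since injectivity concerns left modules. If
  \<open>x f = 0\<close> in \<open>\<Lambda>\<close>, the coefficient of \<open>x\<close> at
  \<open>e\<^sub>j\<close> vanishes and so \<open>x p\<^sub>j = 0\<close>; hence
  \<open>p\<^sub>j \<in> f \<Lambda>\<close>. If all arrows killed \<open>f\<close> from the right,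
  \<open>f \<Lambda>\<close> would be spanned by \<open>f\<close> in degree \<open>t < l\<close>,
  although \<open>p\<^sub>j\<close> has degree \<open>l\<close>.\<close>

lemma extend_right_arrow:
  assumes f: "f \<in> carrier R" "hcomp j t i f = f" "f \<notin> I" and j: "j \<in> verts Q" and i: "i \<in> verts Q"
    and t: "t < l"
  shows "\<exists>a\<in>arcs Q. head Q a = i \<and> f \<otimes> path_elt (arrow_path Q a) \<notin> I"
proof (rule ccontr)
  assume "\<not> ?thesis"
  then have killed: "proj (f \<otimes> x) = x (vertex_path i) \<odot>\<^bsub>L\<^esub> proj f" if "x \<in> carrier R" for x
    using mult_r_killed[OF f(1,2) i _ that] by blast
  let ?m = "path_elt (pm j) :: _ \<Rightarrow> 'k"
  have "x \<otimes> ?m \<in> I" if x: "x \<in> carrier R" "x \<otimes> f \<in> I" for x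
  proof -
    have "x (vertex_path j) \<odot> f \<in> I"
      using I_comp[OF x(2), of j t i] hcomp_self_mult[OF f(1,2) j x(1)] by simp
    then have "x (vertex_path j) = 0" using I_smult_iff[OF f(1)] f(3) by blast
    then have "proj (x \<otimes> ?m) = \<zero>\<^bsub>L\<^esub>" using mult_pm[OF j x(1)] j by simp
    then show ?thesis using x j by (simp add: proj_eq_zero_iff)
  qed
  then obtain z where z: "z \<in> carrier R" "proj ?m = proj (f \<otimes> z)"
    using self_injective_factor[of f ?m] f(1) j by auto
  then have m: "proj ?m = z (vertex_path i) \<odot>\<^bsub>L\<^esub> proj f" using killed by simp
  then have "proj ?m = proj (z (vertex_path i) \<odot> f)" using f by (simp add: proj_smult)
  then have "proj (hcomp j t i ?m) = proj (hcomp j t i (z (vertex_path i) \<odot> f))"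
    using j f by (intro proj_comp_cong) auto
  moreover have "hcomp j t i ?m = \<zero>" using j t by (simp add: hcomp_path_elt)
  ultimately have "z (vertex_path i) \<odot>\<^bsub>L\<^esub> proj f = \<zero>\<^bsub>L\<^esub>"
    using f by (simp add: hcomp_smult proj_smult)
  then show False using m j by (simp add: proj_eq_zero_iff)
qed

lemma extend_left:
  assumes "f \<in> carrier R" "hcomp j t i f = f" "f \<notin> I" "j \<in> verts Q" "t \<le> l"
  shows "\<exists>q\<in>paths Q. psrc q = j \<and> plen q = l - t \<and> path_elt q \<otimes> f \<notin> I"
  using assms
proof (induction "l - t" arbitrary: f j t)
  case 0
  then show ?case by (intro bexI[of _ "vertex_path j"]) (simp_all add: vertex_mult_comp)
next
  case (Suc n)
  then have "t < l" by simp
  then obtain a where a: "a \<in> arcs Q" "tail Q a = j" "path_elt (arrow_path Q a) \<otimes> f \<notin> I"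
    using extend_left_arrow Suc.prems by blast
  let ?f = "path_elt (arrow_path Q a) \<otimes> f"
  have "hcomp (head Q a) (Suc t) i ?f = ?f"
    using a Suc.prems by (simp add: hcomp_mult_l)
  moreover have "n = l - Suc t" "?f \<in> carrier R" "head Q a \<in> verts Q" "Suc t \<le> l"
    using Suc.hyps(2) Suc.prems a \<open>t < l\<close> by simp_all
  ultimately obtain q where
    q: "q \<in> paths Q" "psrc q = head Q a" "plen q = l - Suc t" "path_elt q \<otimes> ?f \<notin> I"
    using Suc.hyps(1)[of "Suc t" ?f "head Q a"] a(3) by blast
  have "path_elt (pcomp q (arrow_path Q a)) \<otimes> f = path_elt q \<otimes> ?f"
    using q a Suc.prems path_elt_mult[of q "arrow_path Q a"] by (simp flip: m_assoc)
  then show ?case using q a \<open>t < l\<close>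
    by (intro bexI[of _ "pcomp q (arrow_path Q a)"]) simp_all
qed

lemma extend_right:
  assumes "f \<in> carrier R" "hcomp j t i f = f" "f \<notin> I" "j \<in> verts Q" "i \<in> verts Q" "t \<le> l"
  shows "\<exists>q\<in>paths Q. ptgt q = i \<and> plen q = l - t \<and> f \<otimes> path_elt q \<notin> I"
  using assms
proof (induction "l - t" arbitrary: f i t)
  case 0
  then show ?case by (intro bexI[of _ "vertex_path i"]) (simp_all add: mult_vertex_comp)
next
  case (Suc n)
  then have "t < l" by simp
  then obtain a where a: "a \<in> arcs Q" "head Q a = i" "f \<otimes> path_elt (arrow_path Q a) \<notin> I"
    using extend_right_arrow Suc.prems by blast
  let ?f = "f \<otimes> path_elt (arrow_path Q a)"
  have "hcomp j (Suc t) (tail Q a) ?f = ?f"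
    using a Suc.prems by (simp add: hcomp_mult_r)
  moreover have "n = l - Suc t" "?f \<in> carrier R" "tail Q a \<in> verts Q" "Suc t \<le> l"
    using Suc.hyps(2) Suc.prems a \<open>t < l\<close> by simp_all
  ultimately obtain q where
    q: "q \<in> paths Q" "ptgt q = tail Q a" "plen q = l - Suc t" "?f \<otimes> path_elt q \<notin> I"
    using Suc.hyps(1)[of "Suc t" ?f "tail Q a"] Suc.prems(4) a(3) by blast
  have "f \<otimes> path_elt (pcomp (arrow_path Q a) q) = ?f \<otimes> path_elt q"
    using q a Suc.prems path_elt_mult[of "arrow_path Q a" q] by (simp add: m_assoc)
  then show ?case using q a \<open>t < l\<close>
    by (intro bexI[of _ "pcomp (arrow_path Q a) q"]) simp_all
qed

text \<open>By surjectivity of \<open>\<tau>\<close> the start is some \<open>\<tau> k\<close>, and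
  stability forces the end to be \<open>k\<close>. In that component the coordinate detects nonzero
  elements.\<close>

lemma top_comp_tau:
  assumes "f \<in> carrier R" "hcomp j l i f = f" "f \<notin> I" "j \<in> verts Q" "i \<in> verts Q"
  shows "i = \<tau> j \<and> coord j f \<noteq> 0"
proof -
  obtain k where k: "k \<in> verts Q" "i = \<tau> k" using tau_surj assms(5) by blast
  then have "j = k" using hcomp_top_end[of f k j] assms by metis
  then show ?thesis using k assms by (auto simp: coord_eq_0_iff)
qed

lemma not_in_I_comp:
  assumes "f \<in> carrier R" "f \<notin> I"
  obtains j t i where "j \<in> verts Q" "i \<in> verts Q" "t \<le> l" "hcomp j t i f \<notin> I"
proof -
  obtain j t i where *: "j \<in> verts Q" "i \<in> verts Q" "hcomp j t i f \<notin> I"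
    using assms I_comp_iff by blast
  moreover have "t \<le> l" using hcomp_high[OF assms(1), of t j i] * by (meson not_le)
  ultimately show thesis using that by blast
qed

text \<open>A nonzero component of \<open>f\<close> is extended by a path \<open>q\<close> to a
  nonzero element of the top degree, where \<open>coord\<close> detects it. Multiplying all of
  \<open>f\<close> by \<open>q\<close> adds nothing: the product ends at a single vertex, and only
  one summand of \<open>phi\<close> and one component of \<open>f\<close> contribute.\<close>

theorem phi_nondegenerate_right:
  assumes f: "f \<in> carrier R" and 0: "\<And>g. g \<in> carrier R \<Longrightarrow> phi (g \<otimes> f) = 0"
  shows "f \<in> I"
proof (rule ccontr)
  assume "f \<notin> I"
  then obtain j t i where jti: "j \<in> verts Q" "i \<in> verts Q" "t \<le> l" "hcomp j t i f \<notin> I"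
    using not_in_I_comp f by metis
  then obtain q where q: "q \<in> paths Q" "psrc q = j" "plen q = l - t"
    "path_elt q \<otimes> hcomp j t i f \<notin> I"
    using extend_left[of "hcomp j t i f" j t i] f by (auto simp: hcomp_comp)
  let ?k = "ptgt q"
  have k: "?k \<in> verts Q" using paths_verts q(1) by blast
  have eq: "hcomp ?k l i (path_elt q \<otimes> f) = path_elt q \<otimes> hcomp j t i f"
    using q jti f by (simp add: hcomp_mult_l)
  have "i = \<tau> ?k \<and> coord ?k (hcomp ?k l i (path_elt q \<otimes> f)) \<noteq> 0"
    using q f jti k by (intro top_comp_tau) (simp_all add: eq[symmetric] hcomp_comp)
  then have "coord ?k (path_elt q \<otimes> f) \<noteq> 0"
    using coord_comp[of "path_elt q \<otimes> f" ?k] q f k by auto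
  moreover have "phi (path_elt q \<otimes> f) = coord ?k (path_elt q \<otimes> f)"
    using q f k by (intro phi_eq_coord) (auto simp: hcomp_mult_l)
  ultimately show False using 0 q by simp
qed

theorem phi_nondegenerate_left:
  assumes f: "f \<in> carrier R" and 0: "\<And>g. g \<in> carrier R \<Longrightarrow> phi (f \<otimes> g) = 0"
  shows "f \<in> I"
proof (rule ccontr)
  assume "f \<notin> I"
  then obtain j t i where jti: "j \<in> verts Q" "i \<in> verts Q" "t \<le> l" "hcomp j t i f \<notin> I"
    using not_in_I_comp f by metis
  then obtain q where q: "q \<in> paths Q" "ptgt q = i" "plen q = l - t"
    "hcomp j t i f \<otimes> path_elt q \<notin> I"
    using extend_right[of "hcomp j t i f" j t i] f by (auto simp: hcomp_comp)
  let ?k = "psrc q"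
  have k: "?k \<in> verts Q" using paths_verts q(1) by blast
  have eq: "hcomp j l ?k (f \<otimes> path_elt q) = hcomp j t i f \<otimes> path_elt q"
    using q jti f by (simp add: hcomp_mult_r)
  have tau: "?k = \<tau> j \<and> coord j (hcomp j l ?k (f \<otimes> path_elt q)) \<noteq> 0"
    using q f jti k by (intro top_comp_tau) (simp_all add: eq[symmetric] hcomp_comp)
  then have "coord j (f \<otimes> path_elt q) \<noteq> 0"
    using coord_comp[of "f \<otimes> path_elt q" j] q f jti by auto
  \<comment> \<open>Here it is the start \<open>\<tau> j\<close> of the product that is fixed;
    injectivity of \<open>\<tau>\<close> excludes the other summands.\<close>
  moreover have "phi (f \<otimes> path_elt q) = coord j (f \<otimes> path_elt q)"
    using q f jti tau by (intro phi_eq_coord) (auto simp: hcomp_mult_r tau_inj)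
  ultimately show False using 0 q by simp
qed

lemma finite_short_paths: "finite {p \<in> paths Q. plen p \<le> l}"
proof (rule finite_subset)
  show "{p \<in> paths Q. plen p \<le> l} \<subseteq> verts Q \<times> {es. set es \<subseteq> arcs Q \<and> length es \<le> l} \<times> verts Q"
    using paths_verts by (auto simp: paths_iff plen_def awalk_def psrc_def ptgt_def)
  show "finite (verts Q \<times> {es. set es \<subseteq> arcs Q \<and> length es \<le> l} \<times> verts Q)"
    by (intro finite_cartesian_product finite_lists_length_le) auto
qed

text \<open>Paths of length at most \<open>l\<close> span \<open>\<Lambda>\<close>, and there are
  finitely many. An \<open>x\<close> with \<open>phi (x \<otimes> b) = 0\<close> for all of them is
  zero in \<open>\<Lambda>\<close> by left nondegeneracy, so \<open>g\<close> vanishes on the common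
  kernel.\<close>

theorem phi_representable:
  assumes g: "functional R g" and gI: "\<And>x. x \<in> I \<Longrightarrow> g x = 0"
  shows "\<exists>y\<in>carrier R. \<forall>x\<in>carrier R. g x = phi (x \<otimes> y)"
proof (rule functional_representable[OF phi_functional _ _ g])
  show "finite (path_elt ` {p \<in> paths Q. plen p \<le> l})" using finite_short_paths by simp
  show "path_elt ` {p \<in> paths Q. plen p \<le> l} \<subseteq> carrier R" by (rule image_subsetI) simp
  fix x assume x: "x \<in> carrier R"
    and 0: "\<And>b. b \<in> path_elt ` {p \<in> paths Q. plen p \<le> l} \<Longrightarrow> phi (x \<otimes> b) = 0"
  have "phi (x \<otimes> y) = 0" if "y \<in> carrier R" for y
    using that
  proof (induction y rule: span_induct)
    case (path p)
    show ?case
    proof (cases "plen p \<le> l")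
      case True
      then show ?thesis by (intro 0 imageI) (simp add: path)
    next
      case False
      then show ?thesis using path x by (intro phi_I I.I_l_closed long_path) auto
    qed
  qed (use x in \<open>simp_all add: mult_zero mult_add_r mult_smult_r functional_zero[OF phi_functional]
      functional_add[OF phi_functional] functional_smult[OF phi_functional]\<close>)
  then show "g x = 0" using phi_nondegenerate_left[OF x] gI by blast
qed

section \<open>The Nakayama automorphism\<close>

text \<open>Together with the next two lemmas this confines the pairing of a degree-one factor to a
  partner in degree \<open>l - 1\<close> with matching ends. Here \<open>l_pos\<close> is essential,
  to have \<open>1 + (l - 1) = l\<close> in the naturals.\<close>

lemma coord_mult_comp_l:
  assumes "b \<in> carrier R" "hcomp j 1 i b = b" "z \<in> carrier R" "j \<in> verts Q"
  shows "coord j (b \<otimes> z) = coord j (b \<otimes> hcomp i (l - 1) (\<tau> j) z)"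
proof -
  have "coord j (b \<otimes> z) = coord j (hcomp j l (\<tau> j) (b \<otimes> z))"
    using assms by (simp add: coord_comp)
  also have "hcomp j l (\<tau> j) (b \<otimes> z) = b \<otimes> hcomp i (l - 1) (\<tau> j) z"
    using hcomp_mult_comp_l[OF assms(1,3), of j l "\<tau> j" j 1 i] assms(2) l_pos by simp
  finally show ?thesis .
qed

lemma coord_mult_comp_r:
  assumes "y \<in> carrier R" "z \<in> carrier R" "i \<in> verts Q" "hcomp i (l - 1) j z = z"
  shows "coord i (z \<otimes> hcomp j 1 (\<tau> i) y) = coord i (z \<otimes> y)"
proof -
  have "coord i (z \<otimes> y) = coord i (hcomp i l (\<tau> i) (z \<otimes> y))"
    using assms by (simp add: coord_comp)
  also have "hcomp i l (\<tau> i) (z \<otimes> y) = z \<otimes> hcomp j 1 (\<tau> i) y"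
    using hcomp_mult_comp_l[OF assms(2,1), of i l "\<tau> i" i "l - 1" j] assms(4) l_pos by simp
  finally show ?thesis by simp
qed

lemma coord_mult_comp_r':
  assumes "y \<in> carrier R" "hcomp j 1 (\<tau> i) y = y" "z \<in> carrier R" "i \<in> verts Q"
  shows "coord i (z \<otimes> y) = coord i (hcomp i (l - 1) j z \<otimes> y)"
proof -
  have "coord i (z \<otimes> y) = coord i (hcomp i l (\<tau> i) (z \<otimes> y))"
    using assms by (simp add: coord_comp)
  also have "hcomp i l (\<tau> i) (z \<otimes> y) = hcomp i (l - 1) j z \<otimes> y"
    using hcomp_mult_comp_r[OF assms(1,3), of i l "\<tau> i" j 1 "\<tau> i"] assms(2) l_pos by simp
  finally show ?thesis .
qed

text \<open>The relation \<open>y = \<nu>(b)\<close> for representatives. The equation is demanded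
  for all \<open>z\<close> rather than for those in \<open>e\<^sub>i
  \<Lambda>\<^sub>l\<^sub>-\<^sub>1 e\<^sub>\<tau>\<^sub>j\<close>, as is needed when linear
  functions on all of \<open>\<Lambda>\<close> are compared.\<close>

definition nak :: "'v \<Rightarrow> 'v \<Rightarrow> (('v, 'e) qpath \<Rightarrow> 'k) \<Rightarrow> (('v, 'e) qpath \<Rightarrow> 'k) \<Rightarrow> bool" where
  "nak j i b y \<longleftrightarrow> b \<in> carrier R \<and> hcomp j 1 i b = b \<and> y \<in> carrier R \<and> hcomp (\<tau> j) 1 (\<tau> i) y = y \<and>
     (\<forall>z\<in>carrier R. coord j (b \<otimes> z) = coord i (z \<otimes> y))"

text \<open>Representing \<open>z \<mapsto> coord j (b \<otimes> z)\<close> by \<open>phi\<close>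
  gives some \<open>y\<close>; for degree reasons its component from \<open>\<tau> i\<close> to
  \<open>\<tau> j\<close> in degree one already represents the function.\<close>

lemma nak_exists:
  assumes b: "b \<in> carrier R" "hcomp j 1 i b = b" and ij: "i \<in> verts Q" "j \<in> verts Q"
  shows "\<exists>y. nak j i b y"
proof -
  have "functional R (\<lambda>z. coord j (b \<otimes> z))"
    using b by (intro functionalI) (simp_all add: mult_add_r mult_smult_r functional_add[OF coord_functional]
        functional_smult[OF coord_functional])
  then obtain y where y: "y \<in> carrier R" "\<forall>z\<in>carrier R. coord j (b \<otimes> z) = phi (z \<otimes> y)"
    using phi_representable[of "\<lambda>z. coord j (b \<otimes> z)"] b coord_I I.I_l_closed by metis
  let ?y = "hcomp (\<tau> j) 1 (\<tau> i) y"
  have "coord j (b \<otimes> z) = coord i (z \<otimes> ?y)" if z: "z \<in> carrier R" for z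
  proof -
    let ?z = "hcomp i (l - 1) (\<tau> j) z"
    have zz: "hcomp i (l - 1) (\<tau> j) ?z = ?z" by (simp add: hcomp_comp)
    have "coord j (b \<otimes> z) = coord j (b \<otimes> ?z)" by (rule coord_mult_comp_l[OF b z ij(2)])
    also have "\<dots> = phi (?z \<otimes> y)" using y z by simp
    \<comment> \<open>As \<open>?z\<close> ends at \<open>i\<close>, only the summand of
      \<open>phi\<close> at \<open>i\<close> sees the product.\<close>
    also have "\<dots> = coord i (?z \<otimes> y)"
      using y z ij hcomp_mult_comp_l[OF z y(1)] by (intro phi_eq_coord) auto
    also have "\<dots> = coord i (?z \<otimes> ?y)"
      using y z ij zz by (intro coord_mult_comp_r[symmetric]) auto
    also have "\<dots> = coord i (z \<otimes> ?y)"
      using y z ij by (intro coord_mult_comp_r'[symmetric]) (auto simp: hcomp_comp)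
    finally show ?thesis .
  qed
  then have "nak j i b ?y" using b y by (simp add: nak_def hcomp_comp)
  then show ?thesis by blast
qed


text \<open>The difference is orthogonal to everything under \<open>phi\<close>, hence zero by right
  nondegeneracy. Testing only homogeneous \<open>z\<close> suffices, and this is all that the
  description in \<open>nu_component\<close> provides.\<close>

lemma nak_unique:
  assumes ij: "i \<in> verts Q" "j \<in> verts Q"
    and y: "y \<in> carrier R" "hcomp (\<tau> j) 1 (\<tau> i) y = y"
    and y': "y' \<in> carrier R" "hcomp (\<tau> j) 1 (\<tau> i) y' = y'"
    and eq: "\<And>z. z \<in> carrier R \<Longrightarrow> hcomp i (l - 1) (\<tau> j) z = z \<Longrightarrow> coord i (z \<otimes> y) = coord i (z \<otimes> y')"
  shows "proj y = proj y'"
proof -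
  let ?d = "y \<ominus> y'"
  have d: "?d \<in> carrier R" "hcomp (\<tau> j) 1 (\<tau> i) ?d = ?d"
    using y y' by (simp_all add: a_minus_def hcomp_add hcomp_smult flip: smult_minus_one)
  have "phi (g \<otimes> ?d) = 0" if g: "g \<in> carrier R" for g
  proof -
    have "hcomp m l (\<tau> m) (g \<otimes> ?d) = \<zero>" if "m \<in> verts Q" "m \<noteq> i" for m
      using hcomp_mult_comp_r[OF d(1) g, of m l "\<tau> m" "\<tau> j" 1 "\<tau> i"] d(2) that ij by (simp add: tau_inj)
    then have "phi (g \<otimes> ?d) = coord i (g \<otimes> ?d)"
      using g d ij by (intro phi_eq_coord) auto
    also have "\<dots> = coord i (hcomp i (l - 1) (\<tau> j) g \<otimes> ?d)"
      by (rule coord_mult_comp_r'[OF d g ij(1)])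
    also have "\<dots> = coord i (hcomp i (l - 1) (\<tau> j) g \<otimes> y) - coord i (hcomp i (l - 1) (\<tau> j) g \<otimes> y')"
      using g y(1) y'(1)
      by (simp add: a_minus_def r_distr smult_mult_r functional_add[OF coord_functional]
          functional_smult[OF coord_functional] flip: smult_minus_one)
    also have "\<dots> = 0" using eq[of "hcomp i (l - 1) (\<tau> j) g"] g by (simp add: hcomp_comp)
    finally show ?thesis .
  qed
  then have "?d \<in> I" by (rule phi_nondegenerate_right[OF d(1)])
  then show ?thesis using y y' by (simp add: proj_eq_iff)
qed

lemma vertex_mult_vertex:
  assumes "f \<in> carrier R" "j \<in> verts Q" "i \<in> verts Q" "\<And>p. f p \<noteq> 0 \<Longrightarrow> plen p = t"
  shows "path_elt (vertex_path j) \<otimes> f \<otimes> path_elt (vertex_path i) = hcomp j t i f"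
proof
  fix p
  have "f p = 0" if "plen p \<noteq> t" using assms(4) that by blast
  moreover have "path_elt (vertex_path j) \<otimes> f \<in> carrier R" using assms by simp
  ultimately show "(path_elt (vertex_path j) \<otimes> f \<otimes> path_elt (vertex_path i)) p = hcomp j t i f p"
    using assms(1-3) by (simp add: mult_vertex, simp add: vertex_mult hcomp_def)
qed

lemma peirce_map_proj:
  assumes "f \<in> carrier R" "j \<in> verts Q" "i \<in> verts Q"
  shows "peirce_map Q \<rho> j i (proj f) = proj (path_elt (vertex_path j) \<otimes> f \<otimes> path_elt (vertex_path i))"
  using assms by (simp add: peirce_map_def path_class_eq proj_mult flip: L_def)

lemma peirce_map_comp:
  assumes "f \<in> carrier R" "hcomp j t i f = f" "j' \<in> verts Q" "i' \<in> verts Q"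
  shows "peirce_map Q \<rho> j' i' (proj f) = (if j' = j \<and> i' = i then proj f else \<zero>\<^bsub>L\<^esub>)"
proof -
  have supp: "plen p = t" if "f p \<noteq> 0" for p
    using fun_cong[OF assms(2), of p] that by (simp add: hcomp_def split: if_splits)
  have "hcomp j' t i' f = (if j' = j \<and> i' = i then f else \<zero>)"
    using hcomp_comp[of j' t i' j t i f] assms(2) by auto
  then show ?thesis
    using vertex_mult_vertex[OF assms(1,3,4) supp] by (simp add: peirce_map_proj[OF assms(1,3,4)])
qed

lemma peirce_eq:
  assumes "j \<in> verts Q" "i \<in> verts Q"
  shows "peirce Q \<rho> j t i = {proj f | f. f \<in> carrier R \<and> hcomp j t i f = f}"
proof (intro equalityI subsetI)
  fix x assume "x \<in> peirce Q \<rho> j t i"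
  then obtain f where f: "f \<in> carrier R" "\<forall>p. f p \<noteq> 0 \<longrightarrow> plen p = t" "x = peirce_map Q \<rho> j i (proj f)"
    unfolding peirce_def graded_part_eq by blast
  then have "\<And>p. f p \<noteq> 0 \<Longrightarrow> plen p = t" by blast
  then have "x = proj (hcomp j t i f)"
    using peirce_map_proj[OF f(1) assms] vertex_mult_vertex[OF f(1) assms] f(3) by simp
  then show "x \<in> {proj f | f. f \<in> carrier R \<and> hcomp j t i f = f}"
    using f(1) hcomp_in by (intro CollectI exI[of _ "hcomp j t i f"]) (simp add: hcomp_comp)
next
  fix x assume "x \<in> {proj f | f. f \<in> carrier R \<and> hcomp j t i f = f}"
  then obtain f where f: "f \<in> carrier R" "hcomp j t i f = f" "x = proj f" by blast
  have "plen p = t" if "f p \<noteq> 0" for p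
    using fun_cong[OF f(2), of p] that by (simp add: hcomp_def split: if_splits)
  then have "proj f \<in> graded_part Q \<rho> t" unfolding graded_part_eq using f(1) by blast
  moreover have "x = peirce_map Q \<rho> j i (proj f)" using peirce_map_comp[OF f(1,2) assms] f(3) by simp
  ultimately show "x \<in> peirce Q \<rho> j t i" unfolding peirce_def by blast
qed

lemma eta_proj:
  assumes "f \<in> carrier R" "hcomp i l (\<tau> i) f = f" "i \<in> verts Q"
  shows "eta Q \<rho> pm i (proj f) = coord i f"
  unfolding eta_def path_class_eq L_def[symmetric]
proof (rule the_equality)
  show *: "proj f = coord i f \<odot>\<^bsub>L\<^esub> proj (path_elt (pm i))"
    using proj_comp_top[OF assms(1,3)] assms(2) by simp
  show "c = coord i f" if "proj f = c \<odot>\<^bsub>L\<^esub> proj (path_elt (pm i))" for c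
  proof (rule L.smult_cancel)
    show "c \<odot>\<^bsub>L\<^esub> proj (path_elt (pm i)) = coord i f \<odot>\<^bsub>L\<^esub> proj (path_elt (pm i))"
      using * that by simp
  qed (use assms(3) in \<open>simp_all add: proj_eq_zero_iff\<close>)
qed

text \<open>The products in the defining equation lie in the one-dimensional top components, where
  \<open>eta\<close> agrees with \<open>coord\<close>; then \<open>nak\<close> gives existence and
  \<open>nak_unique\<close> uniqueness for the \<open>THE\<close>.\<close>

lemma nu_component_eq:
  assumes nak: "nak j i b y" and ij: "i \<in> verts Q" "j \<in> verts Q"
  shows "nu_component Q \<rho> \<tau> l pm j i (proj b) = proj y"
proof -
  have b: "b \<in> carrier R" "hcomp j 1 i b = b" and y: "y \<in> carrier R" "hcomp (\<tau> j) 1 (\<tau> i) y = y"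
    and eq: "\<And>z. z \<in> carrier R \<Longrightarrow> coord j (b \<otimes> z) = coord i (z \<otimes> y)"
    using nak by (auto simp: nak_def)
  have etas: "eta Q \<rho> pm j (proj b \<otimes>\<^bsub>L\<^esub> proj z) = coord j (b \<otimes> z)"
    "eta Q \<rho> pm i (proj z \<otimes>\<^bsub>L\<^esub> proj y') = coord i (z \<otimes> y')"
    if "z \<in> carrier R" "hcomp i (l - 1) (\<tau> j) z = z" "y' \<in> carrier R" "hcomp (\<tau> j) 1 (\<tau> i) y' = y'"
    for z y'
  proof -
    have "hcomp j l (\<tau> j) (b \<otimes> z) = b \<otimes> z"
      using hcomp_mult_comp_l[OF b(1) that(1), of j l "\<tau> j" j 1 i] b(2) that(2) l_pos by simp
    then show "eta Q \<rho> pm j (proj b \<otimes>\<^bsub>L\<^esub> proj z) = coord j (b \<otimes> z)"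
      using b that ij eta_proj[of "b \<otimes> z" j] by (simp add: proj_mult)
    have "hcomp i l (\<tau> i) (z \<otimes> y') = z \<otimes> y'"
      using hcomp_mult_comp_l[OF that(1,3), of i l "\<tau> i" i "l - 1" "\<tau> j"] that(2,4) l_pos by simp
    then show "eta Q \<rho> pm i (proj z \<otimes>\<^bsub>L\<^esub> proj y') = coord i (z \<otimes> y')"
      using that ij eta_proj[of "z \<otimes> y'" i] by (simp add: proj_mult)
  qed
  let ?P = "\<lambda>y. y \<in> peirce Q \<rho> (\<tau> j) 1 (\<tau> i) \<and> (\<forall>q\<in>peirce Q \<rho> i (l - 1) (\<tau> j).
    eta Q \<rho> pm j (proj b \<otimes>\<^bsub>L\<^esub> q) = eta Q \<rho> pm i (q \<otimes>\<^bsub>L\<^esub> y))"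
  have "(THE y. ?P y) = proj y"
  proof (rule the_equality)
    show "?P (proj y)"
    proof (intro conjI ballI)
      show "proj y \<in> peirce Q \<rho> (\<tau> j) 1 (\<tau> i)"
        using y ij by (simp add: peirce_eq) blast
      fix q assume "q \<in> peirce Q \<rho> i (l - 1) (\<tau> j)"
      then obtain z where "z \<in> carrier R" "hcomp i (l - 1) (\<tau> j) z = z" "q = proj z"
        using peirce_eq[OF ij(1) tau_in[OF ij(2)]] by blast
      then show "eta Q \<rho> pm j (proj b \<otimes>\<^bsub>L\<^esub> q) = eta Q \<rho> pm i (q \<otimes>\<^bsub>L\<^esub> proj y)"
        using etas(1)[of z, OF _ _ y] etas(2)[of z, OF _ _ y] eq[of z] by simp
    qed
  next
    fix x assume x: "?P x"
    then obtain y' where y': "y' \<in> carrier R" "hcomp (\<tau> j) 1 (\<tau> i) y' = y'" "x = proj y'"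
      using peirce_eq[OF tau_in[OF ij(2)] tau_in[OF ij(1)]] by blast
    have "proj y' = proj y"
    proof (rule nak_unique[OF ij y'(1,2) y])
      fix z assume z: "z \<in> carrier R" "hcomp i (l - 1) (\<tau> j) z = z"
      then have "proj z \<in> peirce Q \<rho> i (l - 1) (\<tau> j)"
        using peirce_eq[OF ij(1) tau_in[OF ij(2)]] by blast
      then have "eta Q \<rho> pm j (proj b \<otimes>\<^bsub>L\<^esub> proj z) = eta Q \<rho> pm i (proj z \<otimes>\<^bsub>L\<^esub> proj y')"
        using x y'(3) by blast
      then have "coord j (b \<otimes> z) = coord i (z \<otimes> y')"
        using etas(1)[OF z y] etas(2)[OF z y'(1,2)] by simp
      then show "coord i (z \<otimes> y') = coord i (z \<otimes> y)" using eq[OF z(1)] by simp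
    qed
    then show "x = proj y" using y'(3) by simp
  qed
  then show ?thesis unfolding nu_component_def L_def .
qed

lemma nak_zero: "nak j i \<zero> \<zero>"
  by (simp add: nak_def mult_zero functional_zero[OF coord_functional])

lemma nu_eq:
  assumes nak: "nak j i b y" and ij: "i \<in> verts Q" "j \<in> verts Q"
  shows "nu Q \<rho> \<tau> l pm (proj b) = proj y"
proof -
  have b: "b \<in> carrier R" "hcomp j 1 i b = b" and y: "y \<in> carrier R"
    using nak by (auto simp: nak_def)
  \<comment> \<open>At the other pairs of vertices the component of \<open>b\<close> is zero; since
    \<open>nu_component\<close> is given by a \<open>THE\<close>, its value there has to be
    justified by \<open>nak_zero\<close>.\<close>
  have c: "nu_component Q \<rho> \<tau> l pm j' i' (peirce_map Q \<rho> j' i' (proj b)) =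
      (if j = j' then if i = i' then proj y else \<zero>\<^bsub>L\<^esub> else \<zero>\<^bsub>L\<^esub>)"
    if "j' \<in> verts Q" "i' \<in> verts Q" for j' i'
    using nu_component_eq[OF nak ij] nu_component_eq[OF nak_zero that(2,1)]
      peirce_map_comp[OF b that] by auto
  have "(\<Oplus>\<^bsub>L\<^esub>i'\<in>verts Q. nu_component Q \<rho> \<tau> l pm j' i' (peirce_map Q \<rho> j' i' (proj b)))
    = (if j = j' then proj y else \<zero>\<^bsub>L\<^esub>)" if "j' \<in> verts Q" for j'
  proof -
    have "(\<Oplus>\<^bsub>L\<^esub>i'\<in>verts Q. nu_component Q \<rho> \<tau> l pm j' i' (peirce_map Q \<rho> j' i' (proj b)))
      = (\<Oplus>\<^bsub>L\<^esub>i'\<in>verts Q. if i = i' then if j = j' then proj y else \<zero>\<^bsub>L\<^esub> else \<zero>\<^bsub>L\<^esub>)"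
      using y by (intro L.finsum_cong') (auto simp: c[OF that])
    also have "\<dots> = (if j = j' then proj y else \<zero>\<^bsub>L\<^esub>)"
      using L.add.finprod_singleton[OF ij(1), of "\<lambda>_. if j = j' then proj y else \<zero>\<^bsub>L\<^esub>"] y by simp
    finally show ?thesis .
  qed
  then have "nu Q \<rho> \<tau> l pm (proj b) = (\<Oplus>\<^bsub>L\<^esub>j'\<in>verts Q. if j = j' then proj y else \<zero>\<^bsub>L\<^esub>)"
    unfolding nu_def L_def[symmetric] using y by (intro L.finsum_cong') auto
  also have "\<dots> = proj y"
    using L.add.finprod_singleton[OF ij(2), of "\<lambda>_. proj y"] y by simp
  finally show ?thesis .
qed

text \<open>Two representatives supported in degree one differ by an element of \<open>I\<close>,
  and \<open>I\<close> lives in degrees at least two.\<close>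

lemma arrow_rep_proj:
  assumes y: "y \<in> carrier R" "\<And>p. y p \<noteq> 0 \<Longrightarrow> plen p = 1"
  shows "arrow_rep (proj y) = y"
  unfolding arrow_rep_def
proof (rule the_equality)
  show "y \<in> proj y \<and> (\<forall>p. y p \<noteq> 0 \<longrightarrow> plen p = 1)" using y by (simp add: proj_mem_iff)
  fix g assume g: "g \<in> proj y \<and> (\<forall>p. g p \<noteq> 0 \<longrightarrow> plen p = 1)"
  then have gR: "g \<in> carrier R" "proj g = proj y" using y(1) by (simp_all add: proj_mem_iff)
  then have d: "g \<ominus> y \<in> I" using y(1) by (simp add: proj_eq_iff)
  have eq: "(g \<ominus> y) p = g p - y p" for p
    using gR y(1) by (simp add: a_minus_def flip: smult_minus_one) (simp add: add_eq smult_eq)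
  show "g = y"
  proof
    fix p
    show "g p = y p"
    proof (cases "plen p = 1")
      case True
      then show ?thesis using I_plen[OF d, of p] eq by auto
    next
      case False
      then have "g p = 0" "y p = 0" using g y(2) by blast+
      then show ?thesis by simp
    qed
  qed
qed

end

section \<open>The twisting automorphism and its inverse on arrows\<close>

locale twisted_stable_quiver_algebra = stable_quiver_algebra Q R \<rho> \<tau> l B pm
  for Q :: "('v, 'e) pre_digraph" and R :: "('k::field, ('v, 'e) qpath \<Rightarrow> 'k) module" (structure)
    and \<rho> :: "(('v, 'e) qpath \<Rightarrow> 'k) set"
    and \<tau> :: "'v \<Rightarrow> 'v" and l :: nat and B :: "('v, 'e) qpath set" and pm :: "'v \<Rightarrow> ('v, 'e) qpath" +
  fixes \<sigma> :: "(('v, 'e) qpath \<Rightarrow> 'k) set \<Rightarrow> (('v, 'e) qpath \<Rightarrow> 'k) set"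
  assumes automorphism: "graded_automorphism Q \<rho> \<sigma>"
    and sigma_vertex: "\<And>i. i \<in> verts Q \<Longrightarrow>
      \<sigma> (path_class Q \<rho> (vertex_path i)) = path_class Q \<rho> (vertex_path i)"
begin

lemma sigma_iso: "\<sigma> \<in> alg_iso L L"
  using automorphism by (simp add: graded_automorphism_def L_def)

lemma sigma_alg_hom: "\<sigma> \<in> alg_hom L L"
  using sigma_iso by (simp add: alg_iso_def alg_hom_def ring_iso_def)

lemma sigma_in [simp]: "x \<in> carrier L \<Longrightarrow> \<sigma> x \<in> carrier L"
  and sigma_add: "x \<in> carrier L \<Longrightarrow> y \<in> carrier L \<Longrightarrow> \<sigma> (x \<oplus>\<^bsub>L\<^esub> y) = \<sigma> x \<oplus>\<^bsub>L\<^esub> \<sigma> y"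
  and sigma_mult: "x \<in> carrier L \<Longrightarrow> y \<in> carrier L \<Longrightarrow> \<sigma> (x \<otimes>\<^bsub>L\<^esub> y) = \<sigma> x \<otimes>\<^bsub>L\<^esub> \<sigma> y"
  and sigma_smult: "x \<in> carrier L \<Longrightarrow> \<sigma> (c \<odot>\<^bsub>L\<^esub> x) = c \<odot>\<^bsub>L\<^esub> \<sigma> x"
  using sigma_alg_hom by (auto simp: alg_hom_def ring_hom_def)

lemma sigma_zero: "\<sigma> \<zero>\<^bsub>L\<^esub> = \<zero>\<^bsub>L\<^esub>"
  using sigma_smult[of "\<zero>\<^bsub>L\<^esub>" 0] by simp

lemma sigma_bij: "bij_betw \<sigma> (carrier L) (carrier L)"
  using sigma_iso by (simp add: alg_iso_def ring_iso_def)

definition sinv :: "(('v, 'e) qpath \<Rightarrow> 'k) set \<Rightarrow> (('v, 'e) qpath \<Rightarrow> 'k) set" where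
  "sinv = inv_into (carrier L) \<sigma>"

lemma sinv_in [simp]: "x \<in> carrier L \<Longrightarrow> sinv x \<in> carrier L"
  unfolding sinv_def by (rule inv_into_into) (use sigma_bij in \<open>simp add: bij_betw_def\<close>)

lemma sigma_sinv [simp]: "x \<in> carrier L \<Longrightarrow> \<sigma> (sinv x) = x"
  unfolding sinv_def by (rule f_inv_into_f) (use sigma_bij in \<open>simp add: bij_betw_def\<close>)

lemma sinv_sigma [simp]: "x \<in> carrier L \<Longrightarrow> sinv (\<sigma> x) = x"
  unfolding sinv_def by (rule inv_into_f_f) (use sigma_bij in \<open>simp_all add: bij_betw_def\<close>)

lemma sigma_vertex': "i \<in> verts Q \<Longrightarrow> \<sigma> (proj (path_elt (vertex_path i))) = proj (path_elt (vertex_path i))"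
  using sigma_vertex[of i] by (simp add: path_class_eq)

text \<open>Fixing the vertex idempotents makes \<open>\<sigma>\<close> commute with
  \<open>peirce_map\<close>; preservation of degrees does the rest.\<close>

lemma sigma_comp_homogeneous:
  assumes f: "f \<in> carrier R" "hcomp j t i f = f" and ji: "j \<in> verts Q" "i \<in> verts Q"
  shows "\<exists>g\<in>carrier R. hcomp j t i g = g \<and> \<sigma> (proj f) = proj g"
proof -
  have "proj f \<in> peirce Q \<rho> j t i" using f peirce_eq[OF ji] by blast
  then obtain x where x: "x \<in> graded_part Q \<rho> t" "proj f = peirce_map Q \<rho> j i x"
    unfolding peirce_def by blast
  have xL: "x \<in> carrier L" using x(1) unfolding graded_part_eq by auto
  have "\<sigma> x \<in> graded_part Q \<rho> t" using automorphism x(1) unfolding graded_automorphism_def by blast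
  moreover have "\<sigma> (proj f) = peirce_map Q \<rho> j i (\<sigma> x)"
    unfolding x(2) peirce_map_def path_class_eq L_def[symmetric]
    using ji xL by (simp add: sigma_mult sigma_vertex')
  ultimately have "\<sigma> (proj f) \<in> peirce Q \<rho> j t i" unfolding peirce_def by blast
  then show ?thesis using peirce_eq[OF ji] by blast
qed

text \<open>Decomposing \<open>f\<close> reduces the claim to homogeneous elements. The inner
  statement quantifies over all representatives \<open>h\<close> of the image, since the images of
  two summands come with representatives of their own.\<close>

lemma sigma_comp:
  assumes "f \<in> carrier R" "h \<in> carrier R" "\<sigma> (proj f) = proj h" "j \<in> verts Q" "i \<in> verts Q"
  shows "\<sigma> (proj (hcomp j t i f)) = proj (hcomp j t i h)"
proof -
  have "\<forall>h\<in>carrier R. \<sigma> (proj f) = proj h \<longrightarrow> \<sigma> (proj (hcomp j t i f)) = proj (hcomp j t i h)"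
    using assms(1)
  proof (rule hcomp_induct)
    show "\<forall>h\<in>carrier R. \<sigma> (proj \<zero>) = proj h \<longrightarrow> \<sigma> (proj (hcomp j t i \<zero>)) = proj (hcomp j t i h)"
    proof (intro ballI impI)
      fix h assume h: "h \<in> carrier R" "\<sigma> (proj \<zero>) = proj h"
      then have "proj (hcomp j t i h) = proj (hcomp j t i \<zero>)"
        by (intro proj_comp_cong) (simp_all add: sigma_zero)
      then show "\<sigma> (proj (hcomp j t i \<zero>)) = proj (hcomp j t i h)" by (simp add: sigma_zero)
    qed
  next
    fix f g
    assume fg: "f \<in> carrier R" "g \<in> carrier R"
      and f: "\<forall>h\<in>carrier R. \<sigma> (proj f) = proj h \<longrightarrow> \<sigma> (proj (hcomp j t i f)) = proj (hcomp j t i h)"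
      and g: "\<forall>h\<in>carrier R. \<sigma> (proj g) = proj h \<longrightarrow> \<sigma> (proj (hcomp j t i g)) = proj (hcomp j t i h)"
    have ex: "\<exists>h\<in>carrier R. \<sigma> (proj f) = proj h" if "f \<in> carrier R" for f
      using sigma_in[OF proj_in[OF that]] by (auto simp: carrier_L)
    obtain f' g' where f': "f' \<in> carrier R" "\<sigma> (proj f) = proj f'"
      and g': "g' \<in> carrier R" "\<sigma> (proj g) = proj g'"
      using ex fg by metis
    show "\<forall>h\<in>carrier R. \<sigma> (proj (f \<oplus> g)) = proj h \<longrightarrow>
      \<sigma> (proj (hcomp j t i (f \<oplus> g))) = proj (hcomp j t i h)"
    proof (intro ballI impI)
      fix h assume h: "h \<in> carrier R" "\<sigma> (proj (f \<oplus> g)) = proj h"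
      have "proj (hcomp j t i h) = proj (hcomp j t i (f' \<oplus> g'))"
        using h(1) f' g' fg by (intro proj_comp_cong) (simp_all add: h(2)[symmetric] proj_add sigma_add)
      then show "\<sigma> (proj (hcomp j t i (f \<oplus> g))) = proj (hcomp j t i h)"
        using f f' g g' fg by (simp add: hcomp_add proj_add sigma_add)
    qed
  next
    fix j' t' i' assume ji': "j' \<in> verts Q" "i' \<in> verts Q"
    obtain g where g: "g \<in> carrier R" "hcomp j' t' i' g = g" "\<sigma> (proj (hcomp j' t' i' f)) = proj g"
      using sigma_comp_homogeneous[of "hcomp j' t' i' f" j' t' i'] assms(1) ji' by (auto simp: hcomp_comp)
    show "\<forall>h\<in>carrier R. \<sigma> (proj (hcomp j' t' i' f)) = proj h \<longrightarrow>
      \<sigma> (proj (hcomp j t i (hcomp j' t' i' f))) = proj (hcomp j t i h)"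
    proof (intro ballI impI)
      fix h assume h: "h \<in> carrier R" "\<sigma> (proj (hcomp j' t' i' f)) = proj h"
      have "proj (hcomp j t i h) = proj (hcomp j t i g)"
        using h g by (intro proj_comp_cong) simp_all
      also have "hcomp j t i g = (if j = j' \<and> t = t' \<and> i = i' then g else \<zero>)"
        using hcomp_comp[of j t i j' t' i' g] g(2) by auto
      finally show "\<sigma> (proj (hcomp j t i (hcomp j' t' i' f))) = proj (hcomp j t i h)"
        using g(3) by (auto simp: hcomp_comp sigma_zero)
    qed
  qed
  then show ?thesis using assms by blast
qed

definition nu_arrow :: "'e \<Rightarrow> ('v, 'e) qpath \<Rightarrow> 'k" where
  "nu_arrow \<beta> = arrow_rep (nu Q \<rho> \<tau> l pm (sinv (proj (path_elt (arrow_path Q \<beta>)))))"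

lemma nu_arrow:
  assumes "\<beta> \<in> arcs Q"
  shows "\<exists>b. sinv (proj (path_elt (arrow_path Q \<beta>))) = proj b \<and> nak (head Q \<beta>) (tail Q \<beta>) b (nu_arrow \<beta>)"
proof -
  let ?\<beta> = "path_elt (arrow_path Q \<beta>)" and ?j = "head Q \<beta>" and ?i = "tail Q \<beta>"
  have v: "?j \<in> verts Q" "?i \<in> verts Q" using assms by auto
  have \<beta>: "?\<beta> \<in> carrier R" using assms by simp
  obtain f where f: "f \<in> carrier R" "sinv (proj ?\<beta>) = proj f"
    using sinv_in[OF proj_in[OF \<beta>]] by (auto simp: carrier_L)
  \<comment> \<open>Any representative of the preimage of \<open>\<beta>\<close> may have further
    components. As \<open>\<sigma>\<close> respects components and the image is the single arrow
    \<open>\<beta>\<close>, this one component also represents the preimage; so the inverse of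
    \<open>\<sigma>\<close> preserves degree and ends here.\<close>
  define b where "b = hcomp ?j 1 ?i f"
  have b: "b \<in> carrier R" "hcomp ?j 1 ?i b = b" using f by (simp_all add: b_def hcomp_comp)
  have "\<sigma> (proj f) = proj ?\<beta>" using sigma_sinv[OF proj_in[OF \<beta>]] f(2) by simp
  then have "\<sigma> (proj b) = proj (hcomp ?j 1 ?i ?\<beta>)"
    unfolding b_def using f(1) \<beta> v by (intro sigma_comp)
  then have "\<sigma> (proj b) = proj ?\<beta>" by (simp add: hcomp_path_elt)
  then have sb: "sinv (proj ?\<beta>) = proj b" using sinv_sigma[OF proj_in[OF b(1)]] by simp
  obtain y where y: "nak ?j ?i b y" using nak_exists[OF b v(2,1)] by blast
  then have yR: "y \<in> carrier R" "hcomp (\<tau> ?j) 1 (\<tau> ?i) y = y" by (auto simp: nak_def)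
  have "plen p = 1" if "y p \<noteq> 0" for p
    using fun_cong[OF yR(2), of p] that by (simp add: hcomp_def split: if_splits)
  then have "nu_arrow \<beta> = y"
    unfolding nu_arrow_def sb nu_eq[OF y v(2,1)] by (intro arrow_rep_proj yR(1))
  then show ?thesis using sb y by blast
qed

end

section \<open>The twisted trivial extension\<close>

lemma trivial_extension_simps:
  "carrier (trivial_extension A M) = carrier A \<times> carrier M"
  "mult (trivial_extension A M) (a, x) (b, y) = (a \<otimes>\<^bsub>A\<^esub> b, lact M a y \<oplus>\<^bsub>M\<^esub> ract M x b)"
  "one (trivial_extension A M) = (\<one>\<^bsub>A\<^esub>, \<zero>\<^bsub>M\<^esub>)"
  "zero (trivial_extension A M) = (\<zero>\<^bsub>A\<^esub>, \<zero>\<^bsub>M\<^esub>)"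
  "add (trivial_extension A M) (a, x) (b, y) = (a \<oplus>\<^bsub>A\<^esub> b, x \<oplus>\<^bsub>M\<^esub> y)"
  "smult (trivial_extension A M) c (a, x) = (c \<odot>\<^bsub>A\<^esub> a, c \<odot>\<^bsub>M\<^esub> x)"
  by (simp_all add: trivial_extension_def)

context k_algebra
begin

definition dual :: "('a \<Rightarrow> 'k) set" where
  "dual = {f \<in> extensional (carrier A). functional A f}"

lemma dual_simps:
  assumes "f \<in> dual"
  shows "x \<in> carrier A \<Longrightarrow> y \<in> carrier A \<Longrightarrow> f (x \<oplus> y) = f x + f y"
    "x \<in> carrier A \<Longrightarrow> f (c \<odot> x) = c * f x" "f \<zero> = 0"
  using assms functional_zero[of f] by (auto simp: dual_def functional_def)

lemma dual_restrictI:
  assumes "\<And>x y. x \<in> carrier A \<Longrightarrow> y \<in> carrier A \<Longrightarrow> f (x \<oplus> y) = f x + f y"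
    and "\<And>c x. x \<in> carrier A \<Longrightarrow> f (c \<odot> x) = c * f x"
  shows "restrict f (carrier A) \<in> dual"
  using assms by (auto simp: dual_def functional_def)

lemma dual_restrict: "f \<in> dual \<Longrightarrow> restrict f (carrier A) = f"
  by (simp add: dual_def extensional_restrict)

context
  fixes \<sigma> assumes \<sigma>: "\<sigma> \<in> alg_hom A A"
begin

abbreviation TE where "TE \<equiv> twisted_trivial_extension A \<sigma>"

lemma T_carrier: "carrier TE = carrier A \<times> dual"
  by (simp add: twisted_trivial_extension_def trivial_extension_simps dual_bimodule_def dual_def
      functional_def twist_def regular_bimodule_def bimodule.defs module.defs)

text \<open>The regular bimodule is twisted on the right and dualising exchanges the sides, so
  \<open>\<sigma>\<close> is applied to the left factor \<open>a\<close>, and the right action of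
  \<open>b\<close> is untwisted.\<close>

lemma T_mult: "a \<in> carrier A \<Longrightarrow> b \<in> carrier A \<Longrightarrow>
  (a, f) \<otimes>\<^bsub>TE\<^esub> (b, g) = (a \<otimes> b, \<lambda>x\<in>carrier A. g (x \<otimes> \<sigma> a) + f (b \<otimes> x))"
  by (simp add: twisted_trivial_extension_def trivial_extension_simps dual_bimodule_def
      twist_def regular_bimodule_def bimodule.defs module.defs cong: restrict_cong)

lemma T_one: "\<one>\<^bsub>TE\<^esub> = (\<one>, \<lambda>x\<in>carrier A. 0)"
  and T_zero: "\<zero>\<^bsub>TE\<^esub> = (\<zero>, \<lambda>x\<in>carrier A. 0)"
  and T_add: "(a, f) \<oplus>\<^bsub>TE\<^esub> (b, g) = (a \<oplus> b, \<lambda>x\<in>carrier A. f x + g x)"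
  and T_smult: "c \<odot>\<^bsub>TE\<^esub> (a, f) = (c \<odot> a, \<lambda>x\<in>carrier A. c * f x)"
  by (simp_all add: twisted_trivial_extension_def trivial_extension_simps dual_bimodule_def
      twist_def regular_bimodule_def bimodule.defs module.defs)

lemma \<sigma>_simps [simp]:
  "x \<in> carrier A \<Longrightarrow> \<sigma> x \<in> carrier A"
  "x \<in> carrier A \<Longrightarrow> y \<in> carrier A \<Longrightarrow> \<sigma> (x \<oplus> y) = \<sigma> x \<oplus> \<sigma> y"
  "x \<in> carrier A \<Longrightarrow> y \<in> carrier A \<Longrightarrow> \<sigma> (x \<otimes> y) = \<sigma> x \<otimes> \<sigma> y"
  "\<sigma> \<one> = \<one>"
  "x \<in> carrier A \<Longrightarrow> \<sigma> (c \<odot> x) = c \<odot> \<sigma> x"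
  using \<sigma> by (auto simp: alg_hom_def ring_hom_def)

lemma T_mult_closed:
  assumes "X \<in> carrier TE" "Y \<in> carrier TE"
  shows "X \<otimes>\<^bsub>TE\<^esub> Y \<in> carrier TE"
proof -
  obtain a f b g where XY: "X = (a, f)" "Y = (b, g)" "a \<in> carrier A" "b \<in> carrier A" "f \<in> dual" "g \<in> dual"
    using assms by (auto simp: T_carrier)
  have "(\<lambda>x\<in>carrier A. g (x \<otimes> \<sigma> a) + f (b \<otimes> x)) \<in> dual"
    using XY by (intro dual_restrictI)
      (simp_all add: l_distr r_distr smult_mult_l smult_mult_r dual_simps distrib_left)
  then show ?thesis using XY by (simp add: T_mult T_carrier)
qed

lemma T_ring: "ring TE"
proof (rule ringI)
  show "abelian_group TE"
  proof (rule abelian_groupI)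
    show "X \<oplus>\<^bsub>TE\<^esub> Y \<in> carrier TE" if "X \<in> carrier TE" "Y \<in> carrier TE" for X Y
      using that by (auto simp: T_carrier T_add dual_simps distrib_left intro!: dual_restrictI)
    show "\<zero>\<^bsub>TE\<^esub> \<in> carrier TE" by (auto simp: T_carrier T_zero intro!: dual_restrictI)
    show "X \<oplus>\<^bsub>TE\<^esub> Y \<oplus>\<^bsub>TE\<^esub> Z = X \<oplus>\<^bsub>TE\<^esub> (Y \<oplus>\<^bsub>TE\<^esub> Z)"
      if "X \<in> carrier TE" "Y \<in> carrier TE" "Z \<in> carrier TE" for X Y Z
      using that by (auto simp: T_carrier T_add a_assoc add.assoc intro!: restrict_ext)
    show "X \<oplus>\<^bsub>TE\<^esub> Y = Y \<oplus>\<^bsub>TE\<^esub> X" if "X \<in> carrier TE" "Y \<in> carrier TE" for X Y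
      using that by (auto simp: T_carrier T_add a_comm add.commute intro!: restrict_ext)
    show "\<zero>\<^bsub>TE\<^esub> \<oplus>\<^bsub>TE\<^esub> X = X" if "X \<in> carrier TE" for X
      using that by (auto simp: T_carrier T_add T_zero dual_restrict cong: restrict_cong)
    show "\<exists>Y\<in>carrier TE. Y \<oplus>\<^bsub>TE\<^esub> X = \<zero>\<^bsub>TE\<^esub>" if X: "X \<in> carrier TE" for X
    proof -
      obtain a f where af: "X = (a, f)" "a \<in> carrier A" "f \<in> dual" using X by (auto simp: T_carrier)
      then have "(\<ominus> a, \<lambda>x\<in>carrier A. - f x) \<in> carrier TE"
        by (auto simp: T_carrier dual_simps intro!: dual_restrictI)
      moreover have "(\<ominus> a, \<lambda>x\<in>carrier A. - f x) \<oplus>\<^bsub>TE\<^esub> X = \<zero>\<^bsub>TE\<^esub>"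
        using af by (auto simp: T_add T_zero l_neg intro!: restrict_ext)
      ultimately show ?thesis by blast
    qed
  qed
  show "Group.monoid TE"
  proof (rule monoidI)
    show "X \<otimes>\<^bsub>TE\<^esub> Y \<otimes>\<^bsub>TE\<^esub> Z = X \<otimes>\<^bsub>TE\<^esub> (Y \<otimes>\<^bsub>TE\<^esub> Z)"
      if "X \<in> carrier TE" "Y \<in> carrier TE" "Z \<in> carrier TE" for X Y Z
      using that by (auto simp: T_carrier T_mult m_assoc add.assoc intro!: restrict_ext)
    show "\<one>\<^bsub>TE\<^esub> \<in> carrier TE" by (auto simp: T_carrier T_one intro!: dual_restrictI)
    show "\<one>\<^bsub>TE\<^esub> \<otimes>\<^bsub>TE\<^esub> X = X" "X \<otimes>\<^bsub>TE\<^esub> \<one>\<^bsub>TE\<^esub> = X" if "X \<in> carrier TE" for X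
      using that by (auto simp: T_carrier T_mult T_one dual_restrict cong: restrict_cong)
  qed (rule T_mult_closed)
  show "(X \<oplus>\<^bsub>TE\<^esub> Y) \<otimes>\<^bsub>TE\<^esub> Z = X \<otimes>\<^bsub>TE\<^esub> Z \<oplus>\<^bsub>TE\<^esub> Y \<otimes>\<^bsub>TE\<^esub> Z"
    "Z \<otimes>\<^bsub>TE\<^esub> (X \<oplus>\<^bsub>TE\<^esub> Y) = Z \<otimes>\<^bsub>TE\<^esub> X \<oplus>\<^bsub>TE\<^esub> Z \<otimes>\<^bsub>TE\<^esub> Y"
    if "X \<in> carrier TE" "Y \<in> carrier TE" "Z \<in> carrier TE" for X Y Z
    using that by (auto simp: T_carrier T_mult T_add l_distr r_distr dual_simps intro!: restrict_ext)
qed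

lemma T_k_algebra: "k_algebra TE"
proof (intro k_algebra.intro T_ring k_algebra_axioms.intro)
  fix X Y b c assume X: "X \<in> carrier TE" and Y: "Y \<in> carrier TE"
  then obtain a f a' g where XY: "X = (a, f)" "Y = (a', g)" "a \<in> carrier A" "a' \<in> carrier A"
    "f \<in> dual" "g \<in> dual" by (auto simp: T_carrier)
  show "c \<odot>\<^bsub>TE\<^esub> X \<in> carrier TE"
    using XY by (auto simp: T_carrier T_smult dual_simps distrib_left intro!: dual_restrictI)
  show "(b + c) \<odot>\<^bsub>TE\<^esub> X = b \<odot>\<^bsub>TE\<^esub> X \<oplus>\<^bsub>TE\<^esub> c \<odot>\<^bsub>TE\<^esub> X"
    using XY by (auto simp: T_add T_smult smult_l_distr distrib_right intro!: restrict_ext)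
  show "c \<odot>\<^bsub>TE\<^esub> (X \<oplus>\<^bsub>TE\<^esub> Y) = c \<odot>\<^bsub>TE\<^esub> X \<oplus>\<^bsub>TE\<^esub> c \<odot>\<^bsub>TE\<^esub> Y"
    using XY by (auto simp: T_add T_smult smult_r_distr distrib_left intro!: restrict_ext)
  show "(b * c) \<odot>\<^bsub>TE\<^esub> X = b \<odot>\<^bsub>TE\<^esub> (c \<odot>\<^bsub>TE\<^esub> X)"
    using XY by (auto simp: T_smult smult_assoc mult.assoc intro!: restrict_ext)
  show "1 \<odot>\<^bsub>TE\<^esub> X = X" using XY by (simp add: T_smult dual_restrict cong: restrict_cong)
  show "(c \<odot>\<^bsub>TE\<^esub> X) \<otimes>\<^bsub>TE\<^esub> Y = c \<odot>\<^bsub>TE\<^esub> (X \<otimes>\<^bsub>TE\<^esub> Y)" "X \<otimes>\<^bsub>TE\<^esub> (c \<odot>\<^bsub>TE\<^esub> Y) = c \<odot>\<^bsub>TE\<^esub> (X \<otimes>\<^bsub>TE\<^esub> Y)"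
    using XY by (auto simp: T_smult T_mult smult_mult_l smult_mult_r dual_simps distrib_left
        intro!: restrict_ext)
qed

end

end

section \<open>The extended quiver\<close>

lemma (in quiver_algebra) mult_support:
  assumes "(f \<otimes> g) r \<noteq> 0"
  shows "\<exists>q p. f q \<noteq> 0 \<and> g p \<noteq> 0 \<and> plen r = plen q + plen p"
proof -
  obtain x where x: "x \<in> splits r" "(case x of (q, p) \<Rightarrow> f q * g p) \<noteq> 0"
    using assms unfolding mult_apply by (rule sum.not_neutral_contains_not_neutral)
  obtain q p where qp: "x = (q, p)" by (rule prod.exhaust)
  with x have "f q \<noteq> 0" "g p \<noteq> 0" "pcomp q p = r" by (simp_all add: splits_def)
  then show ?thesis using pcomp_simps(3)[of q p] by (metis add.commute)
qed

lemma (in quiver_algebra) finsum_apply: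
  assumes "finite F" "f \<in> F \<rightarrow> carrier R"
  shows "finsum R f F p = (\<Sum>i\<in>F. f i p)"
  using assms by (induction F) (auto simp: zero_eq add_eq Pi_iff)

lemma (in quiver_algebra) one_finsum:
  "(\<Oplus>i\<in>verts Q. path_elt (vertex_path i)) = \<one>"
proof
  fix p
  have "(\<Oplus>i\<in>verts Q. path_elt (vertex_path i)) p = (\<Sum>i\<in>verts Q. path_elt (vertex_path i) p)"
    by (rule finsum_apply) auto
  also have "\<dots> = (\<Sum>i\<in>verts Q. if i = psrc p then if p = vertex_path (psrc p) then 1 else 0 else 0)"
    by (intro sum.cong) (auto simp: path_elt_def)
  also have "\<dots> = \<one> p"
    by (auto simp: one_eq)
  finally show "(\<Oplus>i\<in>verts Q. path_elt (vertex_path i)) p = \<one> p" .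
qed

definition embed_path :: "('v, 'e) qpath \<Rightarrow> ('v, 'e + 'v) qpath" where
  "embed_path p = (fst p, map Inl (fst (snd p)), snd (snd p))"

lemma embed_path_simps [simp]:
  "psrc (embed_path p) = psrc p" "ptgt (embed_path p) = ptgt p" "plen (embed_path p) = plen p"
  by (simp_all add: embed_path_def psrc_def ptgt_def plen_def)

lemma embed_path_pcomp: "embed_path (pcomp q p) = pcomp (embed_path q) (embed_path p)"
  by (simp add: embed_path_def pcomp_def psrc_def ptgt_def)

lemma embed_path_vertex: "embed_path (vertex_path i) = vertex_path i"
  by (simp add: embed_path_def vertex_path_def)

lemma embed_path_arrow: "embed_path (arrow_path Q \<beta>) = arrow_path (ext_quiver Q \<tau>) (Inl \<beta>)"
  by (simp add: embed_path_def arrow_path_def ext_quiver_def)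

lemma embed_path_elt: "embed (path_elt p) = path_elt (embed_path p)"
proof
  fix r :: "('a, 'b + 'a) qpath"
  obtain u es v where r: "r = (u, es, v)" by (cases r)
  have *: "map Inl (map projl es) = es" if "set es \<subseteq> range Inl"
    using that by (induction es) auto
  show "embed (path_elt p) r = path_elt (embed_path p) r"
  proof (cases "set es \<subseteq> range Inl")
    case True
    then have "((u, map projl es, v) = p) = (r = embed_path p)"
      using *[OF True] by (cases p) (auto simp: r embed_path_def comp_def)
    then show ?thesis using True by (simp add: r embed_def path_elt_def)
  next
    case False
    then have "r \<noteq> embed_path p" by (auto simp: r embed_path_def)
    then show ?thesis using False by (simp add: r embed_def path_elt_def)
  qed
qed

context twisted_stable_quiver_algebra
begin

abbreviation Qe :: "('v, 'e + 'v) pre_digraph" where "Qe \<equiv> ext_quiver Q \<tau>"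

definition S :: "('k, ('v, 'e + 'v) qpath \<Rightarrow> 'k) module" where "S = path_alg Qe"

definition \<rho>e :: "(('v, 'e + 'v) qpath \<Rightarrow> 'k) set" where
  "\<rho>e = ext_relations Q \<rho> \<tau> l pm \<sigma>"

lemma Qe_simps [simp]: "verts Qe = verts Q" "arcs Qe = Inl ` arcs Q \<union> Inr ` verts Q"
  "tail Qe (Inl \<beta>) = tail Q \<beta>" "head Qe (Inl \<beta>) = head Q \<beta>" "tail Qe (Inr i) = i" "head Qe (Inr i) = \<tau> i"
  by (simp_all add: ext_quiver_def)

lemma Qe_fin_digraph: "fin_digraph Qe"
  by unfold_locales auto

sublocale S: quiver_algebra Qe S
proof -
  interpret Qe: fin_digraph Qe by (rule Qe_fin_digraph)
  show "quiver_algebra Qe S" by unfold_locales (rule S_def)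
qed

lemma embed_path_in [simp]:
  assumes "p \<in> paths Q"
  shows "embed_path p \<in> paths Qe"
  using assms
proof (induction p rule: path_induct)
  case (vertex i)
  then show ?case by (simp add: embed_path_vertex)
next
  case (arrow a p)
  then show ?case by (simp add: embed_path_pcomp embed_path_arrow[of Q a \<tau>])
qed

lemma embed_apply: "embed f (u, es, v) = (if set es \<subseteq> range Inl then f (u, map projl es, v) else 0)"
  by (simp add: embed_def)

lemma embed_zero: "embed \<zero> = \<zero>\<^bsub>S\<^esub>"
  by (auto simp: fun_eq_iff embed_apply zero_eq S.zero_eq)

lemma embed_add: "embed (f \<oplus> g) = embed f \<oplus>\<^bsub>S\<^esub> embed g"
  by (auto simp: fun_eq_iff embed_apply add_eq S.add_eq)

lemma embed_smult: "embed (c \<odot> f) = c \<odot>\<^bsub>S\<^esub> embed f"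
  by (auto simp: fun_eq_iff embed_apply smult_eq S.smult_eq)

lemma embed_in [simp]: "f \<in> carrier R \<Longrightarrow> embed f \<in> carrier S"
  by (induction f rule: span_induct)
    (simp_all add: embed_zero embed_add embed_smult embed_path_elt)

lemma embed_one: "embed \<one> = \<one>\<^bsub>S\<^esub>"
  by (auto simp: fun_eq_iff embed_apply one_eq S.one_eq vertex_path_def)

lemma embed_alg_hom: "embed \<in> alg_hom R S"
proof (rule alg_homI)
  show "k_algebra S" by (rule S.k_algebra_axioms)
  show "embed (path_elt q \<otimes> path_elt p) = embed (path_elt q) \<otimes>\<^bsub>S\<^esub> embed (path_elt p)"
    if "q \<in> paths Q" "p \<in> paths Q" for q p :: "('v, 'e) qpath"
    using that by (simp add: path_elt_mult embed_path_elt S.path_elt_mult embed_path_pcomp embed_zero)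
qed (simp_all add: embed_add embed_smult embed_one)

lemma embed_mult: "f \<in> carrier R \<Longrightarrow> g \<in> carrier R \<Longrightarrow> embed (f \<otimes> g) = embed f \<otimes>\<^bsub>S\<^esub> embed g"
  using embed_alg_hom by (simp add: alg_hom_def ring_hom_def)

lemma embed_support: 
  assumes "embed f p \<noteq> 0"
  shows "\<exists>q. f q \<noteq> 0 \<and> plen p = plen q"
proof -
  obtain u es v where p: "p = (u, es, v)" by (cases p)
  then have "f (u, map projl es, v) \<noteq> 0" using assms by (simp add: embed_apply split: if_splits)
  then show ?thesis using p by (intro exI[of _ "(u, map projl es, v)"]) (simp add: plen_def)
qed

definition alpha :: "'v \<Rightarrow> ('v, 'e + 'v) qpath \<Rightarrow> 'k" where
  "alpha i = path_elt (arrow_path Qe (Inr i))"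

lemma alpha_in [simp]: "i \<in> verts Q \<Longrightarrow> alpha i \<in> carrier S"
  unfolding alpha_def by (intro S.path_elt_in S.arrow_path_in) simp

lemma \<rho>e_eq: "\<rho>e = embed ` \<rho> \<union> {alpha (\<tau> i) \<otimes>\<^bsub>S\<^esub> alpha i | i. i \<in> verts Q} \<union>
  {alpha (head Q \<beta>) \<otimes>\<^bsub>S\<^esub> embed (path_elt (arrow_path Q \<beta>))
     \<ominus>\<^bsub>S\<^esub> embed (nu_arrow \<beta>) \<otimes>\<^bsub>S\<^esub> alpha (tail Q \<beta>) | \<beta>. \<beta> \<in> arcs Q}"
  by (simp only: \<rho>e_def ext_relations_def Let_def alpha_def S_def embed_path_elt
      embed_path_arrow[of Q _ \<tau>] nu_arrow_def sinv_def path_class_eq L_def)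

lemma nu_arrow_props:
  assumes "\<beta> \<in> arcs Q"
  shows "nu_arrow \<beta> \<in> carrier R" "hcomp (\<tau> (head Q \<beta>)) 1 (\<tau> (tail Q \<beta>)) (nu_arrow \<beta>) = nu_arrow \<beta>"
  using nu_arrow[OF assms] by (auto simp: nak_def)

lemma alpha_support: "alpha i p \<noteq> 0 \<Longrightarrow> plen p = 1"
  by (simp add: alpha_def path_elt_def split: if_splits)

text \<open>For the mixed relations this rests on the support of \<open>nu_arrow\<close> consisting
  of single arrows, so that both terms are combinations of paths of length two or more.\<close>

lemma ext_bound_quiver: "bound_quiver Qe \<rho>e"
proof -
  have "r \<in> carrier S \<and> (\<forall>p. r p \<noteq> 0 \<longrightarrow> 2 \<le> plen p)" if r: "r \<in> \<rho>e" for r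
  proof -
    consider f where "f \<in> \<rho>" "r = embed f" | i where "i \<in> verts Q" "r = alpha (\<tau> i) \<otimes>\<^bsub>S\<^esub> alpha i"
      | \<beta> where "\<beta> \<in> arcs Q" "r = alpha (head Q \<beta>) \<otimes>\<^bsub>S\<^esub> embed (path_elt (arrow_path Q \<beta>))
         \<ominus>\<^bsub>S\<^esub> embed (nu_arrow \<beta>) \<otimes>\<^bsub>S\<^esub> alpha (tail Q \<beta>)"
      using r unfolding \<rho>e_eq by blast
    then show ?thesis
    proof cases
      case 1
      have *: "2 \<le> plen p" if "f p \<noteq> 0" for p
        using 1(1) that bound_quiver unfolding bound_quiver_def by blast
      have "2 \<le> plen p" if nz: "embed f p \<noteq> 0" for p
        using embed_support[OF nz] * by auto
      moreover have "f \<in> carrier R" using 1(1) rel_in by blast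
      ultimately show ?thesis using 1(2) by simp
    next
      case 2
      have "2 \<le> plen p" if nz: "r p \<noteq> 0" for p
      proof -
        obtain q p' where *: "alpha (\<tau> i) q \<noteq> 0" "alpha i p' \<noteq> 0" "plen p = plen q + plen p'"
          using S.mult_support[OF nz[unfolded 2]] by blast
        then show ?thesis using alpha_support[OF *(1)] alpha_support[OF *(2)] by simp
      qed
      then show ?thesis using 2 by simp
    next
      case 3
      let ?f = "alpha (head Q \<beta>) \<otimes>\<^bsub>S\<^esub> embed (path_elt (arrow_path Q \<beta>))"
        and ?g = "embed (nu_arrow \<beta>) \<otimes>\<^bsub>S\<^esub> alpha (tail Q \<beta>)"
      have fg: "?f \<in> carrier S" "?g \<in> carrier S" using 3 nu_arrow_props by simp_all
      have nu: "plen p = 1" if "nu_arrow \<beta> p \<noteq> 0" for p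
        using fun_cong[OF nu_arrow_props(2)[OF 3(1)], of p] that by (simp add: hcomp_def split: if_splits)
      have "2 \<le> plen p" if nz: "?f p \<noteq> 0" for p
      proof -
        obtain q p' where *: "alpha (head Q \<beta>) q \<noteq> 0"
          "(embed (path_elt (arrow_path Q \<beta>)) :: _ \<Rightarrow> 'k) p' \<noteq> 0" "plen p = plen q + plen p'"
          using S.mult_support[OF nz] by blast
        have "plen p' = 1"
          using embed_support[OF *(2)] by (auto simp: path_elt_def split: if_splits)
        then show ?thesis using * alpha_support[OF *(1)] by simp
      qed
      moreover have "2 \<le> plen p" if nz: "?g p \<noteq> 0" for p
      proof -
        obtain q p' where *: "embed (nu_arrow \<beta>) q \<noteq> 0" "alpha (tail Q \<beta>) p' \<noteq> 0" "plen p = plen q + plen p'"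
          using S.mult_support[OF nz] by blast
        have "plen q = 1" using embed_support[OF *(1)] nu by metis
        then show ?thesis using * alpha_support[OF *(2)] by simp
      qed
      moreover have "r p = ?f p - ?g p" for p
        using fg unfolding 3
        by (simp add: a_minus_def flip: S.smult_minus_one) (simp add: S.add_eq S.smult_eq)
      ultimately have "2 \<le> plen p" if "r p \<noteq> 0" for p
        using that by (cases "?f p = 0") simp_all
      then show ?thesis using fg 3(2) by simp
    qed
  qed
  then show ?thesis
    unfolding bound_quiver_def S_def[symmetric] using Qe_fin_digraph by blast
qed

sublocale S: bound_quiver_algebra Qe S \<rho>e
  by unfold_locales (rule ext_bound_quiver)

section \<open>Normal forms modulo the extended relations\<close>

definition asum :: "('v, 'e + 'v) qpath \<Rightarrow> 'k" where
  "asum = (\<Oplus>\<^bsub>S\<^esub>i\<in>verts Q. alpha i)"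

lemma asum_in [simp]: "asum \<in> carrier S"
  unfolding asum_def by (rule S.finsum_closed) auto

lemma alpha_vertex:
  assumes "i \<in> verts Q" "j \<in> verts Q"
  shows "alpha i \<otimes>\<^bsub>S\<^esub> path_elt (vertex_path j) = (if i = j then alpha i else \<zero>\<^bsub>S\<^esub>)"
    and "path_elt (vertex_path j) \<otimes>\<^bsub>S\<^esub> alpha i = (if j = \<tau> i then alpha i else \<zero>\<^bsub>S\<^esub>)"
proof -
  have *: "arrow_path Qe (Inr i) \<in> paths Qe" "vertex_path j \<in> paths Qe"
    using assms by (intro S.arrow_path_in S.vertex_path_in; simp)+
  show "alpha i \<otimes>\<^bsub>S\<^esub> path_elt (vertex_path j) = (if i = j then alpha i else \<zero>\<^bsub>S\<^esub>)"
    using * unfolding alpha_def by (auto simp: S.path_elt_mult pcomp_vertex_path)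
  show "path_elt (vertex_path j) \<otimes>\<^bsub>S\<^esub> alpha i = (if j = \<tau> i then alpha i else \<zero>\<^bsub>S\<^esub>)"
    using * unfolding alpha_def by (auto simp: S.path_elt_mult pcomp_vertex_path)
qed

lemma S_vertex_in [simp]: "j \<in> verts Q \<Longrightarrow> path_elt (vertex_path j) \<in> carrier S"
  by (intro S.path_elt_in S.vertex_path_in) simp

text \<open>With \<open>vertex_asum\<close>, the single new arrows are recovered from their sum by
  vertex idempotents, so rules for the sum carry the information of the individual
  relations.\<close>

lemma asum_vertex:
  assumes j: "j \<in> verts Q"
  shows "asum \<otimes>\<^bsub>S\<^esub> path_elt (vertex_path j) = alpha j"
proof -
  have "asum \<otimes>\<^bsub>S\<^esub> path_elt (vertex_path j) = (\<Oplus>\<^bsub>S\<^esub>i\<in>verts Q. alpha i \<otimes>\<^bsub>S\<^esub> path_elt (vertex_path j))"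
    unfolding asum_def using j by (intro S.finsum_ldistr) auto
  also have "\<dots> = (\<Oplus>\<^bsub>S\<^esub>i\<in>verts Q. if j = i then alpha i else \<zero>\<^bsub>S\<^esub>)"
    using j by (intro S.finsum_cong') (auto simp: alpha_vertex)
  also have "\<dots> = alpha j"
    using S.add.finprod_singleton[OF j, of alpha] by auto
  finally show ?thesis .
qed

lemma vertex_asum:
  assumes j: "j \<in> verts Q"
  shows "path_elt (vertex_path (\<tau> j)) \<otimes>\<^bsub>S\<^esub> asum = alpha j"
proof -
  have "path_elt (vertex_path (\<tau> j)) \<otimes>\<^bsub>S\<^esub> asum = (\<Oplus>\<^bsub>S\<^esub>i\<in>verts Q. path_elt (vertex_path (\<tau> j)) \<otimes>\<^bsub>S\<^esub> alpha i)"
    unfolding asum_def using j by (intro S.finsum_rdistr) auto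
  also have "\<dots> = (\<Oplus>\<^bsub>S\<^esub>i\<in>verts Q. if j = i then alpha i else \<zero>\<^bsub>S\<^esub>)"
    using j by (intro S.finsum_cong') (auto simp: alpha_vertex tau_inj)
  also have "\<dots> = alpha j"
    using S.add.finprod_singleton[OF j, of alpha] by auto
  finally show ?thesis .
qed

lemma embed_vertex: "embed (path_elt (vertex_path i)) = path_elt (vertex_path i)"
  by (simp add: embed_path_elt embed_path_vertex)

lemma alpha_alpha_in: "i \<in> verts Q \<Longrightarrow> alpha (\<tau> i) \<otimes>\<^bsub>S\<^esub> alpha i \<in> S.I"
  using S.rel_subset unfolding \<rho>e_eq by blast

text \<open>Inserting the idempotent at \<open>\<tau> i\<close> turns
  \<open>\<alpha> \<alpha>\<^sub>i\<close> into the relation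
  \<open>\<alpha>\<^sub>\<tau>\<^sub>i \<alpha>\<^sub>i\<close>; other pairs of new arrows are not
  composable.\<close>

lemma asum_asum_in: "asum \<otimes>\<^bsub>S\<^esub> asum \<in> S.I"
proof -
  have *: "asum \<otimes>\<^bsub>S\<^esub> alpha i \<in> S.I" if i: "i \<in> verts Q" for i
  proof -
    have "asum \<otimes>\<^bsub>S\<^esub> alpha i = asum \<otimes>\<^bsub>S\<^esub> (path_elt (vertex_path (\<tau> i)) \<otimes>\<^bsub>S\<^esub> alpha i)"
      using i by (simp add: alpha_vertex)
    also have "\<dots> = alpha (\<tau> i) \<otimes>\<^bsub>S\<^esub> alpha i"
      using i by (simp add: asum_vertex flip: S.m_assoc)
    finally show ?thesis using alpha_alpha_in[OF i] by simp
  qed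
  have "(\<Oplus>\<^bsub>S\<^esub>i\<in>F. asum \<otimes>\<^bsub>S\<^esub> alpha i) \<in> S.I" if "finite F" "F \<subseteq> verts Q" for F
    using that
  proof (induction F)
    case (insert i F)
    then have "alpha j \<in> carrier S" if "j \<in> insert i F" for j using that by (intro alpha_in) blast
    with insert show ?case
      by (subst S.finsum_insert) (auto intro!: S.I.a_closed * simp: Pi_iff)
  qed (simp add: S.I.zero_closed)
  moreover have "asum \<otimes>\<^bsub>S\<^esub> asum = (\<Oplus>\<^bsub>S\<^esub>i\<in>verts Q. asum \<otimes>\<^bsub>S\<^esub> alpha i)"
    by (subst (2) asum_def) (intro S.finsum_rdistr, auto)
  ultimately show ?thesis by simp
qed

text \<open>Inserting the idempotents at the end of \<open>\<beta>\<close> and at the start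
  \<open>\<tau> i\<close> of \<open>nu_arrow \<beta>\<close> replaces the sum by single arrows on
  both sides, which leaves exactly the relation attached to \<open>\<beta>\<close>.\<close>

lemma asum_arrow:
  assumes \<beta>: "\<beta> \<in> arcs Q"
  shows "S.proj (asum \<otimes>\<^bsub>S\<^esub> embed (path_elt (arrow_path Q \<beta>))) = S.proj (embed (nu_arrow \<beta>) \<otimes>\<^bsub>S\<^esub> asum)"
proof -
  let ?\<beta> = "path_elt (arrow_path Q \<beta>) :: _ \<Rightarrow> 'k" and ?j = "head Q \<beta>" and ?i = "tail Q \<beta>"
  have v: "?j \<in> verts Q" "?i \<in> verts Q" using \<beta> by simp_all
  have "embed ?\<beta> = embed (path_elt (vertex_path ?j) \<otimes> ?\<beta>)"
    using \<beta> by (simp add: path_elt_mult pcomp_vertex_path)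
  then have "asum \<otimes>\<^bsub>S\<^esub> embed ?\<beta> = asum \<otimes>\<^bsub>S\<^esub> (path_elt (vertex_path ?j) \<otimes>\<^bsub>S\<^esub> embed ?\<beta>)"
    using \<beta> by (simp add: embed_mult embed_vertex)
  then have 1: "asum \<otimes>\<^bsub>S\<^esub> embed ?\<beta> = alpha ?j \<otimes>\<^bsub>S\<^esub> embed ?\<beta>"
    using \<beta> v by (simp add: asum_vertex flip: S.m_assoc)
  have "nu_arrow \<beta> = nu_arrow \<beta> \<otimes> path_elt (vertex_path (\<tau> ?i))"
    using mult_vertex_comp[OF tau_in[OF v(2)] nu_arrow_props[OF \<beta>]] by simp
  then have "embed (nu_arrow \<beta>) \<otimes>\<^bsub>S\<^esub> asum
      = embed (nu_arrow \<beta> \<otimes> path_elt (vertex_path (\<tau> ?i))) \<otimes>\<^bsub>S\<^esub> asum" by simp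
  then have 2: "embed (nu_arrow \<beta>) \<otimes>\<^bsub>S\<^esub> asum = embed (nu_arrow \<beta>) \<otimes>\<^bsub>S\<^esub> alpha ?i"
    using \<beta> v nu_arrow_props[OF \<beta>] by (simp add: embed_mult embed_vertex S.m_assoc vertex_asum)
  have "alpha ?j \<otimes>\<^bsub>S\<^esub> embed ?\<beta> \<ominus>\<^bsub>S\<^esub> embed (nu_arrow \<beta>) \<otimes>\<^bsub>S\<^esub> alpha ?i \<in> S.I"
    using S.rel_subset \<beta> unfolding \<rho>e_eq by blast
  then show ?thesis using 1 2 \<beta> v nu_arrow_props[OF \<beta>] by (simp add: S.proj_eq_iff)
qed

text \<open>The coefficient is built along the arrows of a path from the values
  \<open>nu_arrow\<close>. Only its existence is asserted, so no multiplicative extension of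
  \<open>\<nu>\<close> has to be shown well defined.\<close>

lemma asum_commute:
  assumes "u \<in> carrier R"
  shows "\<exists>v\<in>carrier R. S.proj (asum \<otimes>\<^bsub>S\<^esub> embed u) = S.proj (embed v \<otimes>\<^bsub>S\<^esub> asum)"
  using assms
proof (induction u rule: span_induct)
  case zero
  show ?case by (intro bexI[of _ \<zero>]) (simp_all add: embed_zero)
next
  case (add f g)
  then obtain v w where "v \<in> carrier R" "w \<in> carrier R"
    "S.proj (asum \<otimes>\<^bsub>S\<^esub> embed f) = S.proj (embed v \<otimes>\<^bsub>S\<^esub> asum)"
    "S.proj (asum \<otimes>\<^bsub>S\<^esub> embed g) = S.proj (embed w \<otimes>\<^bsub>S\<^esub> asum)" by blast
  then show ?case using add.hyps
    by (intro bexI[of _ "v \<oplus> w"]) (simp_all add: embed_add S.r_distr S.l_distr S.proj_add)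
next
  case (smult c f)
  then obtain v where "v \<in> carrier R" "S.proj (asum \<otimes>\<^bsub>S\<^esub> embed f) = S.proj (embed v \<otimes>\<^bsub>S\<^esub> asum)" by blast
  then show ?case using smult.hyps
    by (intro bexI[of _ "c \<odot> v"]) (simp_all add: embed_smult S.smult_mult_r S.smult_mult_l S.proj_smult)
next
  case (path p)
  then show ?case
  proof (induction p rule: path_induct)
    case (vertex i)
    then show ?case
      \<comment> \<open>Both products equal the single arrow from \<open>i\<close> to
        \<open>\<tau> i\<close>, whence the shift by \<open>\<tau>\<close> in the witness.\<close>
      by (intro bexI[of _ "path_elt (vertex_path (\<tau> i))"])
        (simp_all add: embed_vertex asum_vertex vertex_asum)
  next
    case (arrow \<beta> p)
    then obtain v where v: "v \<in> carrier R"
      "S.proj (asum \<otimes>\<^bsub>S\<^esub> embed (path_elt p)) = S.proj (embed v \<otimes>\<^bsub>S\<^esub> asum)" by blast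
    let ?\<beta> = "path_elt (arrow_path Q \<beta>) :: _ \<Rightarrow> 'k" and ?n = "nu_arrow \<beta>"
    have n: "?n \<in> carrier R" using arrow nu_arrow_props by simp
    have [simp]: "?\<beta> \<in> carrier R" "path_elt p \<in> carrier R" using arrow by simp_all
    have "path_elt (pcomp (arrow_path Q \<beta>) p) = ?\<beta> \<otimes> path_elt p"
      using arrow by (simp add: path_elt_mult)
    then have "S.proj (asum \<otimes>\<^bsub>S\<^esub> embed (path_elt (pcomp (arrow_path Q \<beta>) p)))
        = S.proj (asum \<otimes>\<^bsub>S\<^esub> embed ?\<beta>) \<otimes>\<^bsub>S.L\<^esub> S.proj (embed (path_elt p))"
      by (simp add: embed_mult S.m_assoc flip: S.proj_mult)
    also have "\<dots> = S.proj (embed ?n \<otimes>\<^bsub>S\<^esub> asum) \<otimes>\<^bsub>S.L\<^esub> S.proj (embed (path_elt p))"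
      using asum_arrow arrow by simp
    also have "\<dots> = S.proj (embed ?n) \<otimes>\<^bsub>S.L\<^esub> S.proj (asum \<otimes>\<^bsub>S\<^esub> embed (path_elt p))"
      using n by (simp add: S.m_assoc flip: S.proj_mult)
    also have "\<dots> = S.proj (embed (?n \<otimes> v) \<otimes>\<^bsub>S\<^esub> asum)"
      using n v by (simp add: embed_mult S.m_assoc S.proj_mult S.L.m_assoc)
    finally show ?case using n v(1) by blast
  qed
qed

definition normal :: "(('v, 'e + 'v) qpath \<Rightarrow> 'k) \<Rightarrow> bool" where
  "normal f \<longleftrightarrow> (\<exists>u\<in>carrier R. \<exists>v\<in>carrier R. S.proj f = S.proj (embed u \<oplus>\<^bsub>S\<^esub> embed v \<otimes>\<^bsub>S\<^esub> asum))"

lemma normalI: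
  "u \<in> carrier R \<Longrightarrow> v \<in> carrier R \<Longrightarrow> S.proj f = S.proj (embed u \<oplus>\<^bsub>S\<^esub> embed v \<otimes>\<^bsub>S\<^esub> asum) \<Longrightarrow> normal f"
  unfolding normal_def by blast

lemma normal_embed_mult:
  assumes "f \<in> carrier S" "normal f" "w \<in> carrier R"
  shows "normal (embed w \<otimes>\<^bsub>S\<^esub> f)"
proof -
  obtain u v where uv: "u \<in> carrier R" "v \<in> carrier R" "S.proj f = S.proj (embed u \<oplus>\<^bsub>S\<^esub> embed v \<otimes>\<^bsub>S\<^esub> asum)"
    using assms(2) unfolding normal_def by blast
  have "S.proj (embed w \<otimes>\<^bsub>S\<^esub> f) = S.proj (embed w) \<otimes>\<^bsub>S.L\<^esub> S.proj f"
    using assms by (simp add: S.proj_mult)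
  also have "\<dots> = S.proj (embed (w \<otimes> u) \<oplus>\<^bsub>S\<^esub> embed (w \<otimes> v) \<otimes>\<^bsub>S\<^esub> asum)"
    using uv assms by (simp add: embed_mult S.r_distr S.m_assoc flip: S.proj_mult)
  finally show ?thesis by (rule normalI[rotated 2]) (use uv assms in simp_all)
qed

text \<open>Commuting gives \<open>\<alpha> (u + v \<alpha>) = u' \<alpha> + v' \<alpha>
  \<alpha>\<close>, and the last term vanishes.\<close>

lemma normal_asum_mult:
  assumes "f \<in> carrier S" "normal f"
  shows "normal (asum \<otimes>\<^bsub>S\<^esub> f)"
proof -
  obtain u v where uv: "u \<in> carrier R" "v \<in> carrier R" "S.proj f = S.proj (embed u \<oplus>\<^bsub>S\<^esub> embed v \<otimes>\<^bsub>S\<^esub> asum)"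
    using assms(2) unfolding normal_def by blast
  obtain u' v' where u': "u' \<in> carrier R" "S.proj (asum \<otimes>\<^bsub>S\<^esub> embed u) = S.proj (embed u' \<otimes>\<^bsub>S\<^esub> asum)"
    and v': "v' \<in> carrier R" "S.proj (asum \<otimes>\<^bsub>S\<^esub> embed v) = S.proj (embed v' \<otimes>\<^bsub>S\<^esub> asum)"
    using asum_commute uv by metis
  have "S.proj (embed v' \<otimes>\<^bsub>S\<^esub> asum) \<otimes>\<^bsub>S.L\<^esub> S.proj asum = S.proj (embed v' \<otimes>\<^bsub>S\<^esub> (asum \<otimes>\<^bsub>S\<^esub> asum))"
    using v' by (simp add: S.m_assoc flip: S.proj_mult)
  also have "\<dots> = \<zero>\<^bsub>S.L\<^esub>"
    using v' by (subst S.proj_eq_zero_iff) (auto intro: S.I.I_l_closed asum_asum_in)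
  finally have 0: "S.proj (embed v' \<otimes>\<^bsub>S\<^esub> asum) \<otimes>\<^bsub>S.L\<^esub> S.proj asum = \<zero>\<^bsub>S.L\<^esub>" .
  have "S.proj (asum \<otimes>\<^bsub>S\<^esub> f) = S.proj asum \<otimes>\<^bsub>S.L\<^esub> S.proj f"
    using assms by (simp add: S.proj_mult)
  also have "\<dots> = S.proj (asum \<otimes>\<^bsub>S\<^esub> embed u) \<oplus>\<^bsub>S.L\<^esub> S.proj (asum \<otimes>\<^bsub>S\<^esub> embed v) \<otimes>\<^bsub>S.L\<^esub> S.proj asum"
    using uv by (simp add: S.r_distr S.m_assoc flip: S.proj_mult S.proj_add)
  also have "\<dots> = S.proj (embed \<zero> \<oplus>\<^bsub>S\<^esub> embed u' \<otimes>\<^bsub>S\<^esub> asum)"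
    using u' v' 0 by (simp add: embed_zero)
  finally show ?thesis by (rule normalI[rotated 2]) (use u' in simp_all)
qed

lemma normal_form:
  assumes "f \<in> carrier S"
  shows "normal f"
  using assms
proof (induction f rule: S.span_induct)
  case zero
  show ?case by (rule normalI[of \<zero> \<zero>]) (simp_all add: embed_zero)
next
  case (add f g)
  then obtain u v u' v' where "u \<in> carrier R" "v \<in> carrier R" "u' \<in> carrier R" "v' \<in> carrier R"
    "S.proj f = S.proj (embed u \<oplus>\<^bsub>S\<^esub> embed v \<otimes>\<^bsub>S\<^esub> asum)"
    "S.proj g = S.proj (embed u' \<oplus>\<^bsub>S\<^esub> embed v' \<otimes>\<^bsub>S\<^esub> asum)"
    unfolding normal_def by blast
  then show ?case using add.hyps
    by (intro normalI[of "u \<oplus> u'" "v \<oplus> v'"])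
      (simp_all add: S.proj_add embed_add S.l_distr S.L.a_ac)
next
  case (smult c f)
  then obtain u v where "u \<in> carrier R" "v \<in> carrier R"
    "S.proj f = S.proj (embed u \<oplus>\<^bsub>S\<^esub> embed v \<otimes>\<^bsub>S\<^esub> asum)"
    unfolding normal_def by blast
  then show ?case using smult.hyps
    by (intro normalI[of "c \<odot> u" "c \<odot> v"])
      (simp_all add: S.proj_smult S.proj_add embed_smult S.smult_mult_l S.L.smult_r_distr)
next
  case (path p)
  then show ?case
  proof (induction p rule: S.path_induct)
    case (vertex i)
    then show ?case
      by (intro normalI[of "path_elt (vertex_path i)" \<zero>])
        (simp_all add: embed_zero embed_vertex)
  next
    case (arrow a p)
    then have eq: "path_elt (pcomp (arrow_path Qe a) p) = path_elt (arrow_path Qe a) \<otimes>\<^bsub>S\<^esub> path_elt p"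
      by (simp add: S.path_elt_mult S.arrow_path_in del: Qe_simps)
    have p: "path_elt p \<in> carrier S" using arrow by simp
    from arrow(1) consider \<beta> where "\<beta> \<in> arcs Q" "a = Inl \<beta>" | i where "i \<in> verts Q" "a = Inr i" by auto
    then show ?case
    proof cases
      case 1
      then show ?thesis
        unfolding eq using normal_embed_mult[OF p arrow(4), of "path_elt (arrow_path Q \<beta>)"]
        by (simp add: embed_path_elt embed_path_arrow[of Q \<beta> \<tau>])
    next
      case 2
      \<comment> \<open>A new arrow is the sum times an idempotent, so left multiplication by it is
        left multiplication by an element of \<open>kQ\<close> followed by that with the
        sum.\<close>
      have "path_elt (arrow_path Qe a) = asum \<otimes>\<^bsub>S\<^esub> embed (path_elt (vertex_path i))"
        using 2 by (simp add: embed_vertex asum_vertex alpha_def)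
      then have "path_elt (arrow_path Qe a) \<otimes>\<^bsub>S\<^esub> path_elt p
          = asum \<otimes>\<^bsub>S\<^esub> (embed (path_elt (vertex_path i)) \<otimes>\<^bsub>S\<^esub> path_elt p)"
        using 2 p by (simp add: S.m_assoc)
      then show ?thesis
        unfolding eq using normal_asum_mult[OF _ normal_embed_mult[OF p arrow(4)]] 2 p by simp
    qed
  qed
qed

text \<open>The relations of \<open>Q\<close> are kept in the extended quiver, so the preimage of
  \<open>S.I\<close> is an ideal containing them. This makes \<open>u + v \<alpha>\<close> vanish as
  soon as \<open>u\<close> and \<open>v\<close> vanish in \<open>\<Lambda>\<close>.\<close>

lemma embed_I: "u \<in> I \<Longrightarrow> embed u \<in> S.I"
proof -
  have "ideal {u \<in> carrier R. embed u \<in> S.I} R"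
    by (rule ideal_pathI) (simp_all add: embed_zero embed_add embed_smult embed_mult S.I.zero_closed
        S.I.a_closed S.I_smult S.I.I_l_closed S.I.I_r_closed)
  moreover have "\<rho> \<subseteq> {u \<in> carrier R. embed u \<in> S.I}"
    using rel_in S.rel_subset unfolding \<rho>e_eq by blast
  ultimately have "I \<subseteq> {u \<in> carrier R. embed u \<in> S.I}" by (rule I_minimal)
  then show "u \<in> I \<Longrightarrow> embed u \<in> S.I" by blast
qed


section \<open>The homomorphism to the twisted trivial extension\<close>

abbreviation T :: "('k, (('v, 'e) qpath \<Rightarrow> 'k) set \<times> ((('v, 'e) qpath \<Rightarrow> 'k) set \<Rightarrow> 'k)) module" where
  "T \<equiv> twisted_trivial_extension L \<sigma>"

lemmas T_carrier = L.T_carrier[OF sigma_alg_hom]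
  and T_mult = L.T_mult[OF sigma_alg_hom]
  and T_one = L.T_one[OF sigma_alg_hom]
  and T_zero = L.T_zero[OF sigma_alg_hom]
  and T_add = L.T_add[OF sigma_alg_hom]
  and T_smult = L.T_smult[OF sigma_alg_hom]

sublocale T: k_algebra T
  by (rule L.T_k_algebra[OF sigma_alg_hom])

definition zeroD :: "(('v, 'e) qpath \<Rightarrow> 'k) set \<Rightarrow> 'k" where
  "zeroD = (\<lambda>x\<in>carrier L. 0)"

text \<open>The image of the new arrow at \<open>i\<close>. Composing with \<open>sinv\<close>
  compensates the twist: at \<open>\<sigma>(g)\<close>, the left action of \<open>a\<close> becomes
  evaluation of \<open>coord i\<close> at \<open>g a\<close>.\<close>

definition dcoord :: "'v \<Rightarrow> (('v, 'e) qpath \<Rightarrow> 'k) set \<Rightarrow> 'k" where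
  "dcoord i = (\<lambda>x\<in>carrier L. dual_basis_elt Q \<rho> B (pm i) (sinv x))"

lemma zeroD_in: "zeroD \<in> L.dual"
  unfolding zeroD_def by (rule L.dual_restrictI) simp_all

text \<open>Linear functions on \<open>\<Lambda>\<close> are always evaluated at arguments written
  in this form, where \<open>dcoord\<close> turns into \<open>coord\<close> and
  \<open>\<sigma>\<close> disappears.\<close>

lemma sigma_proj_exhaust:
  assumes "x \<in> carrier L"
  obtains f where "f \<in> carrier R" "x = \<sigma> (proj f)"
proof -
  have "sinv x \<in> proj ` carrier R" using sinv_in[OF assms] carrier_L by simp
  then obtain f where "f \<in> carrier R" "sinv x = proj f" by blast
  then show thesis using that[of f] sigma_sinv[OF assms] by simp
qed

lemma dcoord_sigma: "f \<in> carrier R \<Longrightarrow> dcoord i (\<sigma> (proj f)) = coord i f"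
  by (simp add: dcoord_def dual_basis_elt_proj)

lemma dcoord_in: "dcoord i \<in> L.dual"
proof -
  have "functional L (dcoord i)"
  proof (rule functionalI)
    fix x y assume "x \<in> carrier L" "y \<in> carrier L"
    then obtain f g where "f \<in> carrier R" "g \<in> carrier R" "x = \<sigma> (proj f)" "y = \<sigma> (proj g)"
      by (metis sigma_proj_exhaust)
    then show "dcoord i (x \<oplus>\<^bsub>L\<^esub> y) = dcoord i x + dcoord i y"
      by (simp add: dcoord_sigma functional_add[OF coord_functional] flip: sigma_add proj_add)
  next
    fix c x assume "x \<in> carrier L"
    then obtain f where "f \<in> carrier R" "x = \<sigma> (proj f)"
      by (metis sigma_proj_exhaust)
    then show "dcoord i (c \<odot>\<^bsub>L\<^esub> x) = c * dcoord i x"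
      by (simp add: dcoord_sigma functional_smult[OF coord_functional] flip: sigma_smult proj_smult)
  qed
  then show ?thesis by (simp add: L.dual_def dcoord_def)
qed

text \<open>In terms of the actions on the dual these say that \<open>p\<^sub>i\<^sup>*\<close> is
  fixed by \<open>e\<^sub>\<tau>\<^sub>i\<close> on the left and by \<open>e\<^sub>i\<close> on the
  right, as the image of an arrow from \<open>i\<close> to \<open>\<tau> i\<close> must be.\<close>

lemma coord_mult_vertex:
  assumes "f \<in> carrier R" "i \<in> verts Q"
  shows "coord i (f \<otimes> path_elt (vertex_path (\<tau> i))) = coord i f"
    and "coord i (path_elt (vertex_path i) \<otimes> f) = coord i f"
proof -
  let ?c = "hcomp i l (\<tau> i) f"
  have c: "?c \<in> carrier R" "hcomp i l (\<tau> i) ?c = ?c" using assms by (simp_all add: hcomp_comp)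
  have "hcomp i l (\<tau> i) (f \<otimes> path_elt (vertex_path (\<tau> i))) = ?c"
    using assms mult_vertex_comp[OF _ c] by (simp add: hcomp_mult_r)
  then show "coord i (f \<otimes> path_elt (vertex_path (\<tau> i))) = coord i f"
    using coord_comp[of "f \<otimes> path_elt (vertex_path (\<tau> i))" i] coord_comp[OF assms] assms by simp
  have "hcomp i l (\<tau> i) (path_elt (vertex_path i) \<otimes> f) = ?c"
    using assms vertex_mult_comp[OF _ c] by (simp add: hcomp_mult_l)
  then show "coord i (path_elt (vertex_path i) \<otimes> f) = coord i f"
    using coord_comp[of "path_elt (vertex_path i) \<otimes> f" i] coord_comp[OF assms] assms by simp
qed

lemma zeroD_apply [simp]: "x \<in> carrier L \<Longrightarrow> zeroD x = 0"
  by (simp add: zeroD_def)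

lemma T_zero_eq: "\<zero>\<^bsub>T\<^esub> = (\<zero>\<^bsub>L\<^esub>, zeroD)"
  unfolding zeroD_def by (rule T_zero)

lemma T_one_eq: "\<one>\<^bsub>T\<^esub> = (\<one>\<^bsub>L\<^esub>, zeroD)"
  unfolding zeroD_def by (rule T_one)

lemma T_mult_zeroD_l:
  assumes "a \<in> carrier L" "b \<in> carrier L"
  shows "(a, zeroD) \<otimes>\<^bsub>T\<^esub> (b, f) = (a \<otimes>\<^bsub>L\<^esub> b, \<lambda>x\<in>carrier L. f (x \<otimes>\<^bsub>L\<^esub> \<sigma> a))"
  using assms by (auto simp: T_mult intro!: restrict_ext)

lemma T_mult_zeroD_r:
  assumes "a \<in> carrier L" "b \<in> carrier L"
  shows "(a, f) \<otimes>\<^bsub>T\<^esub> (b, zeroD) = (a \<otimes>\<^bsub>L\<^esub> b, \<lambda>x\<in>carrier L. f (b \<otimes>\<^bsub>L\<^esub> x))"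
  using assms by (auto simp: T_mult intro!: restrict_ext)

lemma restrict_eq_zeroD: "(\<And>x. x \<in> carrier L \<Longrightarrow> f x = 0) \<Longrightarrow> restrict f (carrier L) = zeroD"
  unfolding zeroD_def by (rule restrict_ext)

lemma T_mult_zeroD:
  assumes "a \<in> carrier L" "b \<in> carrier L"
  shows "(a, zeroD) \<otimes>\<^bsub>T\<^esub> (b, zeroD) = (a \<otimes>\<^bsub>L\<^esub> b, zeroD)"
  unfolding T_mult_zeroD_l[OF assms] using assms by (simp add: restrict_eq_zeroD)

lemma T_add_zeroD_l: "(a, zeroD) \<oplus>\<^bsub>T\<^esub> (b, f) = (a \<oplus>\<^bsub>L\<^esub> b, restrict f (carrier L))"
  unfolding T_add by (auto intro!: restrict_ext)

lemma restrict_zeroD: "restrict zeroD (carrier L) = zeroD"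
  by (rule restrict_eq_zeroD) simp

lemma T_smult_zeroD: "c \<odot>\<^bsub>T\<^esub> (a, zeroD) = (c \<odot>\<^bsub>L\<^esub> a, zeroD)"
  unfolding T_smult by (simp add: restrict_eq_zeroD)

lemma T_finsum_fst:
  assumes "finite F" "f \<in> F \<rightarrow> carrier L"
  shows "(\<Oplus>\<^bsub>T\<^esub>i\<in>F. (f i, zeroD)) = (\<Oplus>\<^bsub>L\<^esub>i\<in>F. f i, zeroD)"
  using assms
proof (induction F)
  case empty
  then show ?case by (simp add: T_zero_eq)
next
  case (insert i F)
  then have f: "f i \<in> carrier L" "f \<in> F \<rightarrow> carrier L" by auto
  then have "(\<Oplus>\<^bsub>T\<^esub>i\<in>insert i F. (f i, zeroD)) = (f i, zeroD) \<oplus>\<^bsub>T\<^esub> (\<Oplus>\<^bsub>T\<^esub>i\<in>F. (f i, zeroD))"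
    using insert.hyps zeroD_in by (intro T.finsum_insert) (auto simp: T_carrier)
  then show ?case using insert f by (simp add: T_add_zeroD_l restrict_zeroD)
qed

lemma T_finsum_snd:
  assumes "finite F" "f \<in> F \<rightarrow> L.dual"
  shows "(\<Oplus>\<^bsub>T\<^esub>i\<in>F. (\<zero>\<^bsub>L\<^esub>, f i)) = (\<zero>\<^bsub>L\<^esub>, \<lambda>x\<in>carrier L. \<Sum>i\<in>F. f i x)"
  using assms
proof (induction F)
  case empty
  show ?case by (simp only: T_zero sum.empty T.finsum_empty)
next
  case (insert i F)
  then have f: "f i \<in> L.dual" "f \<in> F \<rightarrow> L.dual" by auto
  then have "(\<Oplus>\<^bsub>T\<^esub>i\<in>insert i F. (\<zero>\<^bsub>L\<^esub>, f i)) = (\<zero>\<^bsub>L\<^esub>, f i) \<oplus>\<^bsub>T\<^esub> (\<Oplus>\<^bsub>T\<^esub>i\<in>F. (\<zero>\<^bsub>L\<^esub>, f i))"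
    using insert.hyps by (intro T.finsum_insert) (auto simp: T_carrier)
  also have "\<dots> = (\<zero>\<^bsub>L\<^esub> \<oplus>\<^bsub>L\<^esub> \<zero>\<^bsub>L\<^esub>, \<lambda>x\<in>carrier L. f i x + (\<lambda>x\<in>carrier L. \<Sum>i\<in>F. f i x) x)"
    by (simp only: insert.IH[OF f(2)] T_add)
  also have "\<dots> = (\<zero>\<^bsub>L\<^esub>, \<lambda>x\<in>carrier L. \<Sum>i\<in>insert i F. f i x)"
    using insert.hyps by (intro arg_cong2[of _ _ _ _ Pair] restrict_ext) simp_all
  finally show ?case .
qed

abbreviation e :: "'v \<Rightarrow> ('v, 'e) qpath \<Rightarrow> 'k" where "e i \<equiv> path_elt (vertex_path i)"

lemma Psi_exists:
  "\<exists>\<Psi>\<in>alg_hom S T. (\<forall>i\<in>verts Q. \<Psi> (path_elt (vertex_path i)) = (proj (e i), zeroD)) \<and>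
    (\<forall>\<beta>\<in>arcs Q. \<Psi> (embed (path_elt (arrow_path Q \<beta>))) = (proj (path_elt (arrow_path Q \<beta>)), zeroD)) \<and>
    (\<forall>i\<in>verts Q. \<Psi> (alpha i) = (\<zero>\<^bsub>L\<^esub>, dcoord i))"
proof -
  let ?E = "\<lambda>i. (proj (e i), zeroD)"
  let ?X = "\<lambda>a. case a of Inl \<beta> \<Rightarrow> (proj (path_elt (arrow_path Q \<beta>)), zeroD) | Inr i \<Rightarrow> (\<zero>\<^bsub>L\<^esub>, dcoord i)"
  have e_e: "e i \<otimes> e j = (if i = j then e i else \<zero>)" if "i \<in> verts Q" "j \<in> verts Q" for i j
    using that by (auto simp: path_elt_mult pcomp_vertex_path)
  have "\<exists>h\<in>alg_hom S T. (\<forall>i\<in>verts Qe. h (path_elt (vertex_path i)) = ?E i) \<and>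
    (\<forall>a\<in>arcs Qe. h (path_elt (arrow_path Qe a)) = ?X a)"
  proof (rule S.path_alg_universal[OF T.k_algebra_axioms])
    show "?E i \<in> carrier T" if "i \<in> verts Qe" for i
      using that zeroD_in by (simp add: T_carrier)
    show "?X a \<in> carrier T" if "a \<in> arcs Qe" for a
      using that zeroD_in dcoord_in by (auto simp: T_carrier)
    show "?E i \<otimes>\<^bsub>T\<^esub> ?E i = ?E i" if "i \<in> verts Qe" for i
      using that by (simp add: T_mult_zeroD e_e flip: proj_mult)
    show "?E i \<otimes>\<^bsub>T\<^esub> ?E j = \<zero>\<^bsub>T\<^esub>" if "i \<in> verts Qe" "j \<in> verts Qe" "i \<noteq> j" for i j
      using that by (simp add: T_mult_zeroD e_e T_zero_eq flip: proj_mult)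
    have "(\<Oplus>\<^bsub>L\<^esub>i\<in>verts Q. proj (e i)) = \<one>\<^bsub>L\<^esub>"
      using proj_finsum[of "verts Q" e] by (simp add: one_finsum proj_one Pi_iff)
    then show "(\<Oplus>\<^bsub>T\<^esub>i\<in>verts Qe. ?E i) = \<one>\<^bsub>T\<^esub>"
      using T_finsum_fst[of "verts Q" "\<lambda>i. proj (e i)"] by (simp add: T_one_eq Pi_iff)
    have "?E (head Qe a) \<otimes>\<^bsub>T\<^esub> ?X a = ?X a \<and> ?X a \<otimes>\<^bsub>T\<^esub> ?E (tail Qe a) = ?X a" if a: "a \<in> arcs Qe" for a
    proof -
      from a consider \<beta> where "\<beta> \<in> arcs Q" "a = Inl \<beta>" | i where "i \<in> verts Q" "a = Inr i" by auto
      then show ?thesis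
      proof cases
        case 1
        then show ?thesis
          by (simp add: T_mult_zeroD path_elt_mult pcomp_vertex_path flip: proj_mult)
      next
        case 2
        have "dcoord i (x \<otimes>\<^bsub>L\<^esub> \<sigma> (proj (e (\<tau> i)))) = dcoord i x" if x: "x \<in> carrier L" for x
        proof -
          obtain f where "f \<in> carrier R" "x = \<sigma> (proj f)" using sigma_proj_exhaust[OF x] .
          then show ?thesis using 2
            by (simp add: dcoord_sigma coord_mult_vertex flip: sigma_mult proj_mult)
        qed
        then have "(\<lambda>x\<in>carrier L. dcoord i (x \<otimes>\<^bsub>L\<^esub> \<sigma> (proj (e (\<tau> i))))) = dcoord i"
          using L.dual_restrict[OF dcoord_in, of i] by (simp cong: restrict_cong)
        moreover have "dcoord i (proj (e i) \<otimes>\<^bsub>L\<^esub> x) = dcoord i x" if x: "x \<in> carrier L" for x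
        proof -
          obtain f where f: "f \<in> carrier R" "x = \<sigma> (proj f)" using sigma_proj_exhaust[OF x] .
          \<comment> \<open>The right action is untwisted, so the idempotent can enter the argument
            of \<open>\<sigma>\<close> only because \<open>\<sigma>\<close> fixes it.\<close>
          then have "proj (e i) \<otimes>\<^bsub>L\<^esub> x = \<sigma> (proj (e i \<otimes> f))"
            using 2 by (simp add: proj_mult sigma_mult sigma_vertex')
          then show ?thesis using 2 f by (simp add: dcoord_sigma coord_mult_vertex)
        qed
        then have "(\<lambda>x\<in>carrier L. dcoord i (proj (e i) \<otimes>\<^bsub>L\<^esub> x)) = dcoord i"
          using L.dual_restrict[OF dcoord_in, of i] by (simp cong: restrict_cong)
        ultimately show ?thesis using 2 by (simp add: T_mult_zeroD_l T_mult_zeroD_r)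
      qed
    qed
    then show "?E (head Qe a) \<otimes>\<^bsub>T\<^esub> ?X a = ?X a" "?X a \<otimes>\<^bsub>T\<^esub> ?E (tail Qe a) = ?X a"
      if "a \<in> arcs Qe" for a
      using that by blast+
  qed
  then obtain h where h: "h \<in> alg_hom S T" "\<forall>i\<in>verts Qe. h (path_elt (vertex_path i)) = ?E i"
    "\<forall>a\<in>arcs Qe. h (path_elt (arrow_path Qe a)) = ?X a" by blast
  have "h (embed (path_elt (arrow_path Q \<beta>))) = ?X (Inl \<beta>)" if "\<beta> \<in> arcs Q" for \<beta>
    using h(3) that by (simp add: embed_path_elt embed_path_arrow[of Q \<beta> \<tau>])
  moreover have "h (alpha i) = ?X (Inr i)" if "i \<in> verts Q" for i
    using h(3) that by (simp add: alpha_def)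
  ultimately show ?thesis using h(1,2) by (intro bexI[of _ h]) simp_all
qed

definition \<Psi> where
  "\<Psi> = (SOME \<Psi>. \<Psi> \<in> alg_hom S T \<and> (\<forall>i\<in>verts Q. \<Psi> (path_elt (vertex_path i)) = (proj (e i), zeroD)) \<and>
    (\<forall>\<beta>\<in>arcs Q. \<Psi> (embed (path_elt (arrow_path Q \<beta>))) = (proj (path_elt (arrow_path Q \<beta>)), zeroD)) \<and>
    (\<forall>i\<in>verts Q. \<Psi> (alpha i) = (\<zero>\<^bsub>L\<^esub>, dcoord i)))"

lemma Psi_alg_hom: "\<Psi> \<in> alg_hom S T"
  and Psi_vertex: "i \<in> verts Q \<Longrightarrow> \<Psi> (path_elt (vertex_path i)) = (proj (e i), zeroD)"
  and Psi_arrow: "\<beta> \<in> arcs Q \<Longrightarrow>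
    \<Psi> (embed (path_elt (arrow_path Q \<beta>))) = (proj (path_elt (arrow_path Q \<beta>)), zeroD)"
  and Psi_alpha: "i \<in> verts Q \<Longrightarrow> \<Psi> (alpha i) = (\<zero>\<^bsub>L\<^esub>, dcoord i)"
  using someI_ex[OF Psi_exists[unfolded Bex_def]] unfolding \<Psi>_def by blast+

lemma Psi_in [simp]: "f \<in> carrier S \<Longrightarrow> \<Psi> f \<in> carrier T"
  and Psi_add: "f \<in> carrier S \<Longrightarrow> g \<in> carrier S \<Longrightarrow> \<Psi> (f \<oplus>\<^bsub>S\<^esub> g) = \<Psi> f \<oplus>\<^bsub>T\<^esub> \<Psi> g"
  and Psi_mult: "f \<in> carrier S \<Longrightarrow> g \<in> carrier S \<Longrightarrow> \<Psi> (f \<otimes>\<^bsub>S\<^esub> g) = \<Psi> f \<otimes>\<^bsub>T\<^esub> \<Psi> g"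
  and Psi_smult: "f \<in> carrier S \<Longrightarrow> \<Psi> (c \<odot>\<^bsub>S\<^esub> f) = c \<odot>\<^bsub>T\<^esub> \<Psi> f"
  using Psi_alg_hom by (auto simp: alg_hom_def ring_hom_def)

lemma Psi_zero: "\<Psi> \<zero>\<^bsub>S\<^esub> = \<zero>\<^bsub>T\<^esub>"
  using Psi_smult[of "\<zero>\<^bsub>S\<^esub>" 0] by simp

lemma Psi_minus: "f \<in> carrier S \<Longrightarrow> g \<in> carrier S \<Longrightarrow> \<Psi> (f \<ominus>\<^bsub>S\<^esub> g) = \<Psi> f \<ominus>\<^bsub>T\<^esub> \<Psi> g"
  by (simp add: a_minus_def Psi_add Psi_smult flip: S.smult_minus_one T.smult_minus_one)

lemma Psi_finsum:
  assumes "finite F" "f \<in> F \<rightarrow> carrier S"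
  shows "\<Psi> (finsum S f F) = (\<Oplus>\<^bsub>T\<^esub>i\<in>F. \<Psi> (f i))"
  using assms by (induction F) (auto simp: Psi_add Psi_zero Pi_iff)

lemma Psi_embed: "f \<in> carrier R \<Longrightarrow> \<Psi> (embed f) = (proj f, zeroD)"
proof (induction f rule: span_induct)
  case zero
  show ?case by (simp add: embed_zero Psi_zero T_zero_eq)
next
  case (add f g)
  then show ?case
    by (simp add: embed_add Psi_add T_add_zeroD_l restrict_zeroD proj_add)
next
  case (smult c f)
  then show ?case
    by (simp add: embed_smult Psi_smult T_smult_zeroD proj_smult)
next
  case (path p)
  then show ?case
  proof (induction p rule: path_induct)
    case (vertex i)
    then show ?case by (simp add: embed_vertex Psi_vertex)
  next
    case (arrow \<beta> p)
    then have "path_elt (pcomp (arrow_path Q \<beta>) p) = path_elt (arrow_path Q \<beta>) \<otimes> path_elt p"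
      by (simp add: path_elt_mult)
    then show ?case using arrow
      by (simp add: embed_mult Psi_mult Psi_arrow T_mult_zeroD proj_mult)
  qed
qed

lemma Psi_asum: "\<Psi> asum = (\<zero>\<^bsub>L\<^esub>, \<lambda>x\<in>carrier L. \<Sum>i\<in>verts Q. dcoord i x)"
proof -
  have "\<Psi> asum = (\<Oplus>\<^bsub>T\<^esub>i\<in>verts Q. \<Psi> (alpha i))"
    unfolding asum_def by (rule Psi_finsum) auto
  also have "\<dots> = (\<Oplus>\<^bsub>T\<^esub>i\<in>verts Q. (\<zero>\<^bsub>L\<^esub>, dcoord i))"
    by (rule T.finsum_cong') (auto simp: Psi_alpha T_carrier dcoord_in)
  also have "\<dots> = (\<zero>\<^bsub>L\<^esub>, \<lambda>x\<in>carrier L. \<Sum>i\<in>verts Q. dcoord i x)"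
    by (rule T_finsum_snd) (auto simp: dcoord_in)
  finally show ?thesis .
qed

text \<open>The image of \<open>\<alpha>\<close> has first component zero, so \<open>u\<close> alone
  fills the first component; the left action of \<open>v\<close> turns the second into the function
  represented by \<open>v\<close>. Extensionality of \<open>F\<close> is recorded to identify it
  with a given element of the dual.\<close>

lemma Psi_normal:
  assumes "u \<in> carrier R" "v \<in> carrier R"
  obtains F where "\<Psi> (embed u \<oplus>\<^bsub>S\<^esub> embed v \<otimes>\<^bsub>S\<^esub> asum) = (proj u, F)" "F \<in> extensional (carrier L)"
    "\<And>g. g \<in> carrier R \<Longrightarrow> F (\<sigma> (proj g)) = phi (g \<otimes> v)"
proof -
  let ?F = "\<lambda>x\<in>carrier L. \<Sum>i\<in>verts Q. dcoord i (x \<otimes>\<^bsub>L\<^esub> \<sigma> (proj v))"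
  have "\<Psi> (embed u \<oplus>\<^bsub>S\<^esub> embed v \<otimes>\<^bsub>S\<^esub> asum) = (proj u, ?F)"
    using assms
    by (simp add: Psi_add Psi_mult Psi_embed Psi_asum T_mult_zeroD_l T_add_zeroD_l cong: restrict_cong)
  moreover have "?F (\<sigma> (proj g)) = phi (g \<otimes> v)" if "g \<in> carrier R" for g
    using that assms by (simp add: phi_def dcoord_sigma flip: sigma_mult proj_mult)
  ultimately show thesis using that by (metis restrict_extensional)
qed

lemma Psi_relations:
  assumes "r \<in> \<rho>e"
  shows "\<Psi> r = \<zero>\<^bsub>T\<^esub>"
proof -
  consider f where "f \<in> \<rho>" "r = embed f" | i where "i \<in> verts Q" "r = alpha (\<tau> i) \<otimes>\<^bsub>S\<^esub> alpha i"
    | \<beta> where "\<beta> \<in> arcs Q" "r = alpha (head Q \<beta>) \<otimes>\<^bsub>S\<^esub> embed (path_elt (arrow_path Q \<beta>))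
       \<ominus>\<^bsub>S\<^esub> embed (nu_arrow \<beta>) \<otimes>\<^bsub>S\<^esub> alpha (tail Q \<beta>)"
    using assms unfolding \<rho>e_eq by blast
  then show ?thesis
  proof cases
    case 1
    then have "f \<in> I" "f \<in> carrier R" using rel_subset rel_in by blast+
    then show ?thesis using 1 by (simp add: Psi_embed proj_eq_zero_iff[THEN iffD2] T_zero_eq)
  next
    case 2
    \<comment> \<open>The dual has square zero: both terms of the product evaluate a linear function
      at zero.\<close>
    have z: "dcoord j \<zero>\<^bsub>L\<^esub> = 0" for j using L.dual_simps(3)[OF dcoord_in] .
    show ?thesis using 2
      by (simp add: Psi_mult Psi_alpha T_mult T_zero_eq sigma_zero z restrict_eq_zeroD cong: restrict_cong)
  next
    case 3
    let ?\<beta> = "path_elt (arrow_path Q \<beta>) :: _ \<Rightarrow> 'k" and ?j = "head Q \<beta>" and ?i = "tail Q \<beta>"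
    have n: "nu_arrow \<beta> \<in> carrier R" and \<beta>: "?\<beta> \<in> carrier R" and v: "?j \<in> verts Q" "?i \<in> verts Q"
      using 3(1) nu_arrow_props by simp_all
    obtain b where b: "sinv (proj ?\<beta>) = proj b" "nak ?j ?i b (nu_arrow \<beta>)" using nu_arrow[OF 3(1)] by blast
    have bR: "b \<in> carrier R" using b(2) by (simp add: nak_def)
    \<comment> \<open>Writing \<open>\<beta>\<close> as \<open>\<sigma>(b)\<close> brings the
      untwisted right action under \<open>\<sigma>\<close>, as
      \<open>\<beta> \<sigma>(g) = \<sigma>(b g)\<close>. The relation then becomes the defining
      equation of \<open>nak\<close> for \<open>b\<close>.\<close>
    have s\<beta>: "proj ?\<beta> = \<sigma> (proj b)" using sigma_sinv[of "proj ?\<beta>"] b(1) \<beta> by simp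
    have eq: "dcoord ?j (proj ?\<beta> \<otimes>\<^bsub>L\<^esub> x) = dcoord ?i (x \<otimes>\<^bsub>L\<^esub> \<sigma> (proj (nu_arrow \<beta>)))" if x: "x \<in> carrier L" for x
    proof -
      obtain g where g: "g \<in> carrier R" "x = \<sigma> (proj g)" using sigma_proj_exhaust[OF x] .
      have "dcoord ?j (proj ?\<beta> \<otimes>\<^bsub>L\<^esub> x) = coord ?j (b \<otimes> g)"
        unfolding s\<beta> using g bR by (simp add: dcoord_sigma flip: sigma_mult proj_mult)
      also have "\<dots> = coord ?i (g \<otimes> nu_arrow \<beta>)" using b(2) g by (simp add: nak_def)
      also have "\<dots> = dcoord ?i (x \<otimes>\<^bsub>L\<^esub> \<sigma> (proj (nu_arrow \<beta>)))"
        using g n by (simp add: dcoord_sigma flip: sigma_mult proj_mult)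
      finally show ?thesis .
    qed
    have "\<Psi> (alpha ?j \<otimes>\<^bsub>S\<^esub> embed ?\<beta>) = (\<zero>\<^bsub>L\<^esub>, \<lambda>x\<in>carrier L. dcoord ?j (proj ?\<beta> \<otimes>\<^bsub>L\<^esub> x))"
      using v \<beta> by (simp add: Psi_mult Psi_alpha Psi_embed T_mult_zeroD_r)
    also have "\<dots> = (\<zero>\<^bsub>L\<^esub>, \<lambda>x\<in>carrier L. dcoord ?i (x \<otimes>\<^bsub>L\<^esub> \<sigma> (proj (nu_arrow \<beta>))))"
      using eq by (simp cong: restrict_cong)
    also have "\<dots> = \<Psi> (embed (nu_arrow \<beta>) \<otimes>\<^bsub>S\<^esub> alpha ?i)"
      using v n by (simp add: Psi_mult Psi_alpha Psi_embed T_mult_zeroD_l)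
    finally have "\<Psi> (alpha ?j \<otimes>\<^bsub>S\<^esub> embed ?\<beta>) = \<Psi> (embed (nu_arrow \<beta>) \<otimes>\<^bsub>S\<^esub> alpha ?i)" .
    then show ?thesis unfolding 3(2) using v n \<beta>
      Psi_minus[of "alpha ?j \<otimes>\<^bsub>S\<^esub> embed ?\<beta>" "embed (nu_arrow \<beta>) \<otimes>\<^bsub>S\<^esub> alpha ?i"]
      Psi_in[of "embed (nu_arrow \<beta>) \<otimes>\<^bsub>S\<^esub> alpha ?i"]
      T.r_neg[of "\<Psi> (embed (nu_arrow \<beta>) \<otimes>\<^bsub>S\<^esub> alpha ?i)"]
    by (simp only: a_minus_def[of T] S.m_closed embed_in alpha_in)
  qed
qed

lemma Psi_I: "f \<in> S.I \<Longrightarrow> \<Psi> f = \<zero>\<^bsub>T\<^esub>"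
proof -
  have "ideal {f \<in> carrier S. \<Psi> f = \<zero>\<^bsub>T\<^esub>} S"
    by (rule S.ideal_pathI) (simp_all add: Psi_zero Psi_add Psi_smult Psi_mult)
  moreover have "\<rho>e \<subseteq> {f \<in> carrier S. \<Psi> f = \<zero>\<^bsub>T\<^esub>}"
    using Psi_relations S.rel_in by blast
  ultimately have "S.I \<subseteq> {f \<in> carrier S. \<Psi> f = \<zero>\<^bsub>T\<^esub>}" by (rule S.I_minimal)
  then show "f \<in> S.I \<Longrightarrow> \<Psi> f = \<zero>\<^bsub>T\<^esub>" by blast
qed

section \<open>Kernel, image and the presentation\<close>

lemma Psi_cong:
  assumes "f \<in> carrier S" "g \<in> carrier S" "S.proj f = S.proj g"
  shows "\<Psi> f = \<Psi> g"
proof -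
  have "\<Psi> f \<ominus>\<^bsub>T\<^esub> \<Psi> g = \<zero>\<^bsub>T\<^esub>"
    using assms Psi_I[of "f \<ominus>\<^bsub>S\<^esub> g"] by (simp add: S.proj_eq_iff Psi_minus)
  then show ?thesis
    using assms T.minus_equality[of "\<Psi> f" "\<ominus>\<^bsub>T\<^esub> \<Psi> g"] by (simp add: a_minus_def)
qed

lemma Psi_kernel:
  assumes f: "f \<in> carrier S" and 0: "\<Psi> f = \<zero>\<^bsub>T\<^esub>"
  shows "f \<in> S.I"
proof -
  obtain u v where uv: "u \<in> carrier R" "v \<in> carrier R"
    and eq: "S.proj f = S.proj (embed u \<oplus>\<^bsub>S\<^esub> embed v \<otimes>\<^bsub>S\<^esub> asum)"
    using normal_form[OF f] unfolding normal_def by blast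
  obtain F where F: "\<Psi> (embed u \<oplus>\<^bsub>S\<^esub> embed v \<otimes>\<^bsub>S\<^esub> asum) = (proj u, F)"
    "\<And>g. g \<in> carrier R \<Longrightarrow> F (\<sigma> (proj g)) = phi (g \<otimes> v)"
    using Psi_normal[OF uv] by metis
  have "(proj u, F) = \<zero>\<^bsub>T\<^esub>"
    using Psi_cong[OF f _ eq] 0 F(1) uv by simp
  then have u: "proj u = \<zero>\<^bsub>L\<^esub>" and F0: "F = zeroD" by (simp_all add: T_zero_eq)
  have "u \<in> I" using u uv by (simp add: proj_eq_zero_iff)
  moreover have "v \<in> I"
  proof (rule phi_nondegenerate_right[OF uv(2)])
    show "phi (g \<otimes> v) = 0" if "g \<in> carrier R" for g
      using F(2)[OF that] F0 that by simp
  qed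
  ultimately have "embed u \<oplus>\<^bsub>S\<^esub> embed v \<otimes>\<^bsub>S\<^esub> asum \<in> S.I"
    by (intro S.I.a_closed S.I.I_r_closed embed_I) auto
  then show ?thesis using eq f uv by (simp add: S.proj_eq_zero_iff flip: S.proj_eq_zero_iff)
qed

lemma Psi_surj: "\<Psi> ` carrier S = carrier T"
proof
  show "\<Psi> ` carrier S \<subseteq> carrier T" by auto
  show "carrier T \<subseteq> \<Psi> ` carrier S"
  proof
    fix X assume "X \<in> carrier T"
    then obtain x f where X: "X = (x, f)" "x \<in> carrier L" "f \<in> L.dual" by (auto simp: T_carrier)
    obtain u where u: "u \<in> carrier R" "x = proj u" using X(2) carrier_L by blast
    note f = L.dual_simps[OF X(3)]
    \<comment> \<open>Pulling \<open>f\<close> back along \<open>\<sigma>\<close> and the projection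
      gives a function on \<open>kQ\<close> that vanishes on \<open>I\<close>; its representing
      element is the coefficient of \<open>\<alpha>\<close> in the preimage.\<close>
    have "functional R (\<lambda>g. f (\<sigma> (proj g)))"
      by (rule functionalI) (simp_all add: proj_add sigma_add proj_smult sigma_smult f)
    moreover have "f (\<sigma> (proj g)) = 0" if "g \<in> I" for g
      using that by (simp add: proj_eq_zero_iff[THEN iffD2] sigma_zero f)
    ultimately obtain v where v: "v \<in> carrier R" "\<And>g. g \<in> carrier R \<Longrightarrow> f (\<sigma> (proj g)) = phi (g \<otimes> v)"
      using phi_representable[of "\<lambda>g. f (\<sigma> (proj g))"] by blast
    obtain F where F: "\<Psi> (embed u \<oplus>\<^bsub>S\<^esub> embed v \<otimes>\<^bsub>S\<^esub> asum) = (proj u, F)" "F \<in> extensional (carrier L)"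
      "\<And>g. g \<in> carrier R \<Longrightarrow> F (\<sigma> (proj g)) = phi (g \<otimes> v)"
      using Psi_normal[OF u(1) v(1)] by metis
    have "f = F"
    proof (rule extensionalityI)
      show "f \<in> extensional (carrier L)" using X(3) by (simp add: L.dual_def)
      show "f x = F x" if x: "x \<in> carrier L" for x
      proof -
        obtain g where g: "g \<in> carrier R" "x = \<sigma> (proj g)" using sigma_proj_exhaust[OF x] .
        show ?thesis unfolding g(2) v(2)[OF g(1)] F(3)[OF g(1)] ..
      qed
    qed (rule F(2))
    then have "X = \<Psi> (embed u \<oplus>\<^bsub>S\<^esub> embed v \<otimes>\<^bsub>S\<^esub> asum)" using F(1) X(1) u(2) by simp
    then show "X \<in> \<Psi> ` carrier S" using u v by (intro image_eqI) auto
  qed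
qed

theorem presentation:
  "\<exists>\<Phi> \<in> alg_iso (bound_alg Qe \<rho>e) T.
     (\<forall>i\<in>verts Q. \<Phi> (path_class Qe \<rho>e (vertex_path i)) = (path_class Q \<rho> (vertex_path i), zeroD)) \<and>
     (\<forall>\<beta>\<in>arcs Q. \<Phi> (path_class Qe \<rho>e (arrow_path Qe (Inl \<beta>))) = (path_class Q \<rho> (arrow_path Q \<beta>), zeroD)) \<and>
     (\<forall>i\<in>verts Q. \<Phi> (path_class Qe \<rho>e (arrow_path Qe (Inr i))) = (\<zero>\<^bsub>L\<^esub>, dcoord i))"
proof -
  have "\<exists>\<Phi> \<in> alg_iso (quot_alg S S.I) T. \<forall>x\<in>carrier S. \<Phi> (S.I +>\<^bsub>S\<^esub> x) = \<Psi> x"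
  proof (rule S.quot_alg_iso[OF T.k_algebra_axioms Psi_alg_hom Psi_surj _ S.I_ideal])
    show "\<Psi> x = \<zero>\<^bsub>T\<^esub> \<longleftrightarrow> x \<in> S.I" if "x \<in> carrier S" for x
      using Psi_kernel[OF that] Psi_I by blast
  qed
  then obtain \<Phi> where \<Phi>: "\<Phi> \<in> alg_iso (bound_alg Qe \<rho>e) T" "\<And>x. x \<in> carrier S \<Longrightarrow> \<Phi> (S.proj x) = \<Psi> x"
    unfolding S.L_quot[symmetric] S.L_def S.proj_def by blast
  have "\<Phi> (path_class Qe \<rho>e (arrow_path Qe (Inl \<beta>))) = (path_class Q \<rho> (arrow_path Q \<beta>), zeroD)"
    if "\<beta> \<in> arcs Q" for \<beta>
  proof -
    have "\<Phi> (S.proj (embed (path_elt (arrow_path Q \<beta>)))) = (proj (path_elt (arrow_path Q \<beta>)), zeroD)"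
      using that \<Phi>(2) by (simp add: Psi_arrow)
    then show ?thesis
      by (simp add: S.path_class_eq path_class_eq embed_path_elt embed_path_arrow[of Q \<beta> \<tau>])
  qed
  moreover have "\<Phi> (path_class Qe \<rho>e (arrow_path Qe (Inr i))) = (\<zero>\<^bsub>L\<^esub>, dcoord i)" if "i \<in> verts Q" for i
    using that \<Phi>(2)[OF alpha_in[OF that]] unfolding S.path_class_eq alpha_def[symmetric] by (simp add: Psi_alpha)
  moreover have "\<Phi> (path_class Qe \<rho>e (vertex_path i)) = (path_class Q \<rho> (vertex_path i), zeroD)" if "i \<in> verts Q" for i
    using that \<Phi>(2) by (simp add: S.path_class_eq path_class_eq Psi_vertex)
  ultimately show ?thesis using \<Phi>(1) by blast
qed

end

text \<open>Prescribing the images of trivial paths and of both kinds of arrows determines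
  \<open>\<Phi>\<close>, because their classes generate the algebra; in this way the abstract
  isomorphism is tied to the chosen paths \<open>pm i\<close>.\<close>

theorem proposition2p6:
  fixes Q :: "('v, 'e) pre_digraph"
    and \<rho> :: "(('v, 'e) qpath \<Rightarrow> 'k::field) set"
    and \<tau> :: "'v \<Rightarrow> 'v"
    and l :: nat
    and \<sigma> :: "(('v, 'e) qpath \<Rightarrow> 'k) set \<Rightarrow> (('v, 'e) qpath \<Rightarrow> 'k) set"
    and B :: "('v, 'e) qpath set"
    and pm :: "'v \<Rightarrow> ('v, 'e) qpath"
  assumes "l \<ge> 1"
    and "stable_bound_quiver Q \<rho> \<tau> l"
    and "graded_self_injective Q \<rho> l"
    and "graded_automorphism Q \<rho> \<sigma>"
    and "\<And>i. i \<in> verts Q \<Longrightarrow>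
           \<sigma> (path_class Q \<rho> (vertex_path i)) = path_class Q \<rho> (vertex_path i)"
    and "bound_path_basis Q \<rho> B"
    and "\<And>i. i \<in> verts Q \<Longrightarrow>
           pm i \<in> B \<and> maximal_bound_path Q \<rho> (pm i) \<and> psrc (pm i) = \<tau> i \<and> ptgt (pm i) = i"
  shows "bound_quiver (ext_quiver Q \<tau>) (ext_relations Q \<rho> \<tau> l pm \<sigma>) \<and>
    (\<exists>\<Phi> \<in> alg_iso (bound_alg (ext_quiver Q \<tau>) (ext_relations Q \<rho> \<tau> l pm \<sigma>))
                  (twisted_trivial_extension (bound_alg Q \<rho>) \<sigma>).
       (\<forall>i\<in>verts Q.
          \<Phi> (path_class (ext_quiver Q \<tau>) (ext_relations Q \<rho> \<tau> l pm \<sigma>) (vertex_path i)) =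
          (path_class Q \<rho> (vertex_path i), \<lambda>x\<in>carrier (bound_alg Q \<rho>). 0)) \<and>
       (\<forall>\<beta>\<in>arcs Q.
          \<Phi> (path_class (ext_quiver Q \<tau>) (ext_relations Q \<rho> \<tau> l pm \<sigma>)
               (arrow_path (ext_quiver Q \<tau>) (Inl \<beta>))) =
          (path_class Q \<rho> (arrow_path Q \<beta>), \<lambda>x\<in>carrier (bound_alg Q \<rho>). 0)) \<and>
       (\<forall>i\<in>verts Q.
          \<Phi> (path_class (ext_quiver Q \<tau>) (ext_relations Q \<rho> \<tau> l pm \<sigma>)
               (arrow_path (ext_quiver Q \<tau>) (Inr i))) =
          (\<zero>\<^bsub>bound_alg Q \<rho>\<^esub>,
           \<lambda>x\<in>carrier (bound_alg Q \<rho>).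
             dual_basis_elt Q \<rho> B (pm i) (inv_into (carrier (bound_alg Q \<rho>)) \<sigma> x))))"
proof -
  have bq: "bound_quiver Q \<rho>" and homog: "homogeneous_relations \<rho>"
    using assms(2) by (simp_all add: stable_bound_quiver_def)
  interpret fin_digraph Q using bq by (simp add: bound_quiver_def)
  interpret twisted_stable_quiver_algebra Q "path_alg Q" \<rho> \<tau> l B pm \<sigma>
    by unfold_locales (use bq homog assms in auto)
  show ?thesis
    using ext_bound_quiver presentation
    unfolding \<rho>e_def L_def zeroD_def dcoord_def sinv_def by blast
qed

end
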